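(* For each integer $n\ge 2$, let $X_0,\dots,X_{n-1}$ be independent random variables with $\mathbb{P}(X_k=1)=\mathbb{P}(X_k=-1)=\tfrac12$, let $P(z)=\sum_{k=0}^{n-1}X_k z^k$, and let $\nu_n(\mathbb{D})$ denote the number of roots of $P$ in the unit disk $\mathbb{D}=\{z\in\mathbb{C}:|z|<1\}$, counted with multiplicity. Then $$\lim_{n\to\infty}\mathbb{P}\left(\left|\nu_n(\mathbb{D})-\frac n2\right|\ge n^{9/10}\right)=0.$$ In particular, $\nu_n(\mathbb{D})/n$ converges in probability to $1/2$ as $n\to\infty$.
   Context: $P$ is a polynomial chosen uniformly at random among all $2^n$ Littlewood polynomials (polynomials with all coefficients in $\{-1,1\}$) of degree $n-1$. The random measure $\nu_n=\sum_{z:P(z)=0}\delta_z$ is the counting measure of the roots of $P$. *)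

theory Defs
  imports "HOL-Probability.Probability" "HOL-Computational_Algebra.Polynomial"
begin

definition random_poly :: "nat \<Rightarrow> (nat \<Rightarrow> 'a \<Rightarrow> real) \<Rightarrow> 'a \<Rightarrow> complex poly" where
  "random_poly n X \<omega> = (\<Sum>k<n. monom (complex_of_real (X k \<omega>)) k)"

(* proots repeats each root according to its multiplicity; by convention proots 0 is empty. *)
definition root_count :: "complex poly \<Rightarrow> complex set \<Rightarrow> nat" where
  "root_count p A = size (filter_mset (\<lambda>z. z \<in> A) (proots p))"

definition unit_disk :: "complex set" where
  "unit_disk = {z. cmod z < 1}"

(* Y n may live on its own probability space M n. The definition is meant for (eventually)
   measurable Y n: measure is 0 on sets outside the sigma-algebra. *)
definition converges_in_probability ::
    "(nat \<Rightarrow> 'a measure) \<Rightarrow> (nat \<Rightarrow> 'a \<Rightarrow> real) \<Rightarrow> real \<Rightarrow> bool" where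
  "converges_in_probability M Y c \<longleftrightarrow>
     (\<forall>\<epsilon>>0. (\<lambda>n. \<P>(\<omega> in M n. \<bar>Y n \<omega> - c\<bar> \<ge> \<epsilon>)) \<longlonglongrightarrow> 0)"

end

theory Submission
  imports Defs "HOL-Real_Asymp.Real_Asymp" "HOL-Computational_Algebra.Fundamental_Theorem_Algebra"
begin

text \<open>
Write \<open>P\<close> for the random polynomial and \<open>J(r)\<close> for the mean of \<open>ln \<bar>P\<bar>\<close> over the circle of radius \<open>r\<close>.
By Jensen's formula \<open>J(r)\<close> is, up to a constant, the sum of \<open>ln (max r \<bar>z\<bar>)\<close> over the roots \<open>z\<close>, so
for every real \<open>s\<close> the number \<open>\<nu>\<close> of roots in the open disk satisfies \<open>s \<nu> \<le> J(exp s) - J(1)\<close>. Using this with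
\<open>s = \<delta> / n\<close> and \<open>s = - \<delta> / n\<close> traps \<open>\<nu>\<close> between two difference quotients of \<open>J\<close>. No information
about roots on or near the circle is needed, and the two cases \<open>s > 0\<close> and \<open>s < 0\<close> are treated alike.

Heuristically \<open>P / \<sigma>\<close>, with \<open>\<sigma>\<close> the standard deviation of \<open>P\<close> on the circle of radius \<open>r\<close>, is a
standard complex Gaussian at almost every point of that circle, whatever \<open>r\<close> close to \<open>1\<close> is. Hence
\<open>J(exp s) - J(1)\<close> is close to the logarithm of the ratio of the two standard deviations, which is
\<open>s n / 2 + O(\<delta>\<^sup>2)\<close>. With \<open>\<delta> = n powr (- 0.11)\<close>, an error below \<open>n powr (- 0.22)\<close> in this
comparison gives \<open>\<nu> = n / 2 + O(n powr 0.89)\<close>. Three estimates make this precise; in all of them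
the circle is replaced by the \<open>N\<close>-th roots of unity for a huge \<open>N\<close> and the probability space by the cube
of sign vectors, so that only finite sums occur.

\<^item> Concentration. The regularised mean of \<open>ln (\<bar>P / \<sigma>\<bar>\<^sup>2 + e) / 2\<close> has variance \<open>O(1 / (n e\<^sup>2))\<close>. Changing one
sign changes it by a Fourier coefficient of a bounded function, up to a second-order term; so the Efron-Stein
inequality together with Bessel's inequality gives the bound (\<open>grid_log_average_variance\<close>).

\<^item> Expectation. Since \<open>exp (- t \<bar>z\<bar>\<^sup>2)\<close> is a Gaussian average of characters, its expectation under a Rademacher
sum is a Gaussian average of products of cosines (\<open>sign_avg_exp_norm_square\<close>). Comparing each cosine with a
Gaussian yields the value \<open>1 / (1 + t)\<close> with an explicit error (\<open>sign_avg_exp_clt\<close>), and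
\<open>1 / (u + y)\<close> being the Laplace transform of \<open>exp (- t u)\<close>, the expectations of the regularised
logarithms for different radii agree (\<open>sign_avg_ln_compare\<close>).

\<^item> Small values. Only the lower bound for \<open>J(1)\<close> requires removing the regularisation. Down to a polynomially small
size of \<open>P\<close> the cost is controlled by the same products of cosines (\<open>sign_avg_ln_ratio\<close>). Below that size
the logarithm is bounded crudely by a multiple of \<open>n ln n\<close>, so the set of points where \<open>P\<close> is that small must have
expected measure a little below \<open>1 / n\<close>. This needs decay of the product of \<open>\<bar>cos (\<rho> cos (k \<theta> - \<psi>))\<bar>\<close> also for
\<open>\<rho>\<close> up to a small power of \<open>n\<close>, where the factors can be resonant. The terms \<open>\<rho> cos (k \<theta> - \<psi>)\<close> satisfy a
linear recurrence with coefficient \<open>2 cos \<theta>\<close>; if four consecutive terms are close to multiples of \<open>\<pi>\<close>, then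
\<open>2 cos \<theta>\<close> is close to a fraction with small denominator (\<open>one_of_four_far_from_lattice\<close>), and few grid points
have this property (\<open>card_grid_not_diophantine\<close>).
\<close>

section \<open>Averages over the cube of sign vectors and the Efron-Stein inequality\<close>

definition sign_cube :: "nat \<Rightarrow> (nat \<Rightarrow> real) set" where
  "sign_cube n = PiE {..<n} (\<lambda>_. {-1, 1})"

definition sign_avg :: "nat \<Rightarrow> ((nat \<Rightarrow> real) \<Rightarrow> real) \<Rightarrow> real" where
  "sign_avg n f = (\<Sum>x\<in>sign_cube n. f x) / 2 ^ n"

lemma finite_sign_cube [simp]: "finite (sign_cube n)"
  unfolding sign_cube_def by (intro finite_PiE) auto

lemma card_sign_cube: "card (sign_cube n) = 2 ^ n"
  unfolding sign_cube_def by (subst card_PiE) (auto simp: numeral_2_eq_2)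

lemma sign_cube_0: "sign_cube 0 = {\<lambda>_. undefined}"
  unfolding sign_cube_def by simp

lemma sign_cube_abs: "x \<in> sign_cube n \<Longrightarrow> k < n \<Longrightarrow> \<bar>x k\<bar> = 1"
  unfolding sign_cube_def by (force simp: PiE_iff)

lemma sum_sign_cube_Suc:
  "(\<Sum>x\<in>sign_cube (Suc n). f x) = (\<Sum>x\<in>sign_cube n. f (x(n := 1)) + f (x(n := -1)))"
proof -
  have "(\<Sum>x\<in>sign_cube (Suc n). f x) = (\<Sum>(y, g)\<in>{-1, 1} \<times> sign_cube n. f (g(n := y)))"
    unfolding sign_cube_def lessThan_Suc
    by (intro sum.reindex_bij_witness[of _ "\<lambda>(y, g). g(n := y)" "\<lambda>g. (g n, g(n := undefined))"])
       (auto simp: PiE_def extensional_def)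
  also have "\<dots> = (\<Sum>y\<in>{-1, 1}. \<Sum>g\<in>sign_cube n. f (g(n := y)))"
    by (subst sum.cartesian_product) auto
  also have "\<dots> = (\<Sum>x\<in>sign_cube n. f (x(n := 1)) + f (x(n := -1)))"
    by (simp add: sum.distrib add.commute)
  finally show ?thesis .
qed

lemma sign_avg_0 [simp]: "sign_avg 0 f = f (\<lambda>_. undefined)"
  by (simp add: sign_avg_def sign_cube_0)

lemma sign_avg_Suc: "sign_avg (Suc n) f = sign_avg n (\<lambda>x. (f (x(n := 1)) + f (x(n := -1))) / 2)"
  by (simp add: sign_avg_def sum_sign_cube_Suc flip: sum_divide_distrib)

lemma sign_avg_cong:
  "(\<And>x. x \<in> sign_cube n \<Longrightarrow> f x = g x) \<Longrightarrow> sign_avg n f = sign_avg n g"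
  by (simp add: sign_avg_def)

lemma sign_avg_const [simp]: "sign_avg n (\<lambda>_. c) = c"
  by (simp add: sign_avg_def card_sign_cube)

lemma sign_avg_add: "sign_avg n (\<lambda>x. f x + g x) = sign_avg n f + sign_avg n g"
  by (simp add: sign_avg_def sum.distrib add_divide_distrib)

lemma sign_avg_diff: "sign_avg n (\<lambda>x. f x - g x) = sign_avg n f - sign_avg n g"
  by (simp add: sign_avg_def sum_subtractf diff_divide_distrib)

lemma sign_avg_cmult: "sign_avg n (\<lambda>x. c * f x) = c * sign_avg n f"
  by (simp add: sign_avg_def sum_distrib_left)

lemma sign_avg_cdiv: "sign_avg n (\<lambda>x. f x / c) = sign_avg n f / c"
  using sign_avg_cmult[of n "1 / c" f] by simp

lemma sign_avg_sum: "sign_avg n (\<lambda>x. \<Sum>i\<in>I. f i x) = (\<Sum>i\<in>I. sign_avg n (f i))"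
  unfolding sign_avg_def by (subst sum.swap) (simp add: sum_divide_distrib)

lemma sign_avg_mono:
  "(\<And>x. x \<in> sign_cube n \<Longrightarrow> f x \<le> g x) \<Longrightarrow> sign_avg n f \<le> sign_avg n g"
  unfolding sign_avg_def by (intro divide_right_mono sum_mono) auto

lemma sign_avg_nonneg: "(\<And>x. x \<in> sign_cube n \<Longrightarrow> 0 \<le> f x) \<Longrightarrow> 0 \<le> sign_avg n f"
  using sign_avg_mono[of n "\<lambda>_. 0" f] by simp

lemma sign_avg_markov:
  assumes "\<And>x. x \<in> sign_cube n \<Longrightarrow> 0 \<le> f x" and "c > 0"
  shows "real (card {x \<in> sign_cube n. f x \<ge> c}) / 2 ^ n \<le> sign_avg n f / c"
proof -
  have "sign_avg n (\<lambda>x. if f x \<ge> c then 1 else 0) \<le> sign_avg n (\<lambda>x. f x / c)"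
    using assms by (intro sign_avg_mono) (auto simp: field_simps)
  also have "sign_avg n (\<lambda>x. if f x \<ge> c then 1 else 0) = real (card {x \<in> sign_cube n. f x \<ge> c}) / 2 ^ n"
    by (simp add: sign_avg_def sum.If_cases Int_def)
  finally show ?thesis
    by (simp add: sign_avg_cdiv)
qed

text \<open>
The characteristic function of a Rademacher sum; the shift \<open>c\<close> is what the induction over the
coordinates requires.
\<close>
lemma sign_avg_cos_sum: "sign_avg n (\<lambda>x. cos (c + (\<Sum>k<n. x k * v k))) = cos c * (\<Prod>k<n. cos (v k))"
proof (induction n arbitrary: c)
  case (Suc n)
  have "sign_avg (Suc n) (\<lambda>x. cos (c + (\<Sum>k<Suc n. x k * v k)))
      = sign_avg n (\<lambda>x. (cos ((c + v n) + (\<Sum>k<n. x k * v k)) + cos ((c - v n) + (\<Sum>k<n. x k * v k))) / 2)"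
    by (subst sign_avg_Suc) (simp add: algebra_simps)
  also have "\<dots> = (cos (c + v n) + cos (c - v n)) / 2 * (\<Prod>k<n. cos (v k))"
    by (simp add: sign_avg_add sign_avg_cdiv Suc.IH) (simp add: field_simps)
  also have "\<dots> = cos c * (\<Prod>k<Suc n. cos (v k))"
    by (simp add: cos_add cos_diff)
  finally show ?case .
qed simp

definition flip :: "nat \<Rightarrow> (nat \<Rightarrow> real) \<Rightarrow> nat \<Rightarrow> real" where
  "flip k x = x(k := - x k)"

text \<open>
Induction on the number of coordinates: the variance splits into the mean of the variances of the two
slices and a quarter of the squared difference of their means, and by the Cauchy-Schwarz inequality the latter is
at most the contribution of flipping the last coordinate.
\<close>
lemma efron_stein:
  "sign_avg n (\<lambda>x. (f x - sign_avg n f)\<^sup>2) \<le> sign_avg n (\<lambda>x. \<Sum>k<n. (f x - f (flip k x))\<^sup>2) / 4"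
proof (induction n arbitrary: f)
  case (Suc n)
  define f1 where "f1 = (\<lambda>x. f (x(n := 1)))"
  define f0 where "f0 = (\<lambda>x. f (x(n := -1)))"
  define m1 where "m1 = sign_avg n f1"
  define m0 where "m0 = sign_avg n f0"
  have var: "sign_avg n (\<lambda>x. (h x - c)\<^sup>2) = sign_avg n (\<lambda>x. (h x - sign_avg n h)\<^sup>2) + (sign_avg n h - c)\<^sup>2"
    for h c
  proof -
    have "sign_avg n (\<lambda>x. (h x - c)\<^sup>2) = sign_avg n (\<lambda>x. (h x - sign_avg n h)\<^sup>2 +
        (2 * (sign_avg n h - c) * (h x - sign_avg n h) + (sign_avg n h - c)\<^sup>2))"
      by (intro sign_avg_cong) (simp add: power2_eq_square algebra_simps)
    then show ?thesis
      by (simp add: sign_avg_add sign_avg_cmult sign_avg_diff)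
  qed
  have m: "sign_avg (Suc n) f = (m1 + m0) / 2"
    by (simp add: sign_avg_Suc m1_def m0_def f1_def f0_def sign_avg_add sign_avg_cdiv)
  have "sign_avg (Suc n) (\<lambda>x. (f x - sign_avg (Suc n) f)\<^sup>2)
      = (sign_avg n (\<lambda>x. (f1 x - (m1 + m0) / 2)\<^sup>2) + sign_avg n (\<lambda>x. (f0 x - (m1 + m0) / 2)\<^sup>2)) / 2"
    by (subst sign_avg_Suc) (simp add: m f1_def f0_def sign_avg_add sign_avg_cdiv)
  also have "\<dots> = (sign_avg n (\<lambda>x. (f1 x - m1)\<^sup>2) + sign_avg n (\<lambda>x. (f0 x - m0)\<^sup>2)) / 2 + (m1 - m0)\<^sup>2 / 4"
    by (subst (1 2) var) (simp add: m1_def[symmetric] m0_def[symmetric] power2_eq_square field_simps)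
  also have "(m1 - m0)\<^sup>2 \<le> sign_avg n (\<lambda>x. (f1 x - f0 x)\<^sup>2)"
  proof -
    have "sign_avg n (\<lambda>x. (f1 x - f0 x)\<^sup>2) \<ge> (sign_avg n (\<lambda>x. f1 x - f0 x) - 0)\<^sup>2"
      using var[of "\<lambda>x. f1 x - f0 x" 0] sign_avg_nonneg[of n "\<lambda>x. (f1 x - f0 x - sign_avg n (\<lambda>x. f1 x - f0 x))\<^sup>2"]
      by simp
    then show ?thesis
      by (simp add: sign_avg_diff m1_def m0_def)
  qed
  also have "sign_avg n (\<lambda>x. (f1 x - m1)\<^sup>2) \<le> sign_avg n (\<lambda>x. \<Sum>k<n. (f1 x - f1 (flip k x))\<^sup>2) / 4"
    unfolding m1_def by (rule Suc.IH)
  also have "sign_avg n (\<lambda>x. (f0 x - m0)\<^sup>2) \<le> sign_avg n (\<lambda>x. \<Sum>k<n. (f0 x - f0 (flip k x))\<^sup>2) / 4"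
    unfolding m0_def by (rule Suc.IH)
  also have "(sign_avg n (\<lambda>x. \<Sum>k<n. (f1 x - f1 (flip k x))\<^sup>2) / 4 +
      sign_avg n (\<lambda>x. \<Sum>k<n. (f0 x - f0 (flip k x))\<^sup>2) / 4) / 2 + sign_avg n (\<lambda>x. (f1 x - f0 x)\<^sup>2) / 4
      = sign_avg (Suc n) (\<lambda>x. \<Sum>k<Suc n. (f x - f (flip k x))\<^sup>2) / 4"
  proof -
    have "(\<Sum>k<Suc n. (f (x(n := 1)) - f (flip k (x(n := 1))))\<^sup>2)
        = (\<Sum>k<n. (f1 x - f1 (flip k x))\<^sup>2) + (f1 x - f0 x)\<^sup>2" for x
      by (auto simp: f1_def f0_def flip_def fun_upd_twist intro!: sum.cong)
    moreover have "(\<Sum>k<Suc n. (f (x(n := -1)) - f (flip k (x(n := -1))))\<^sup>2)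
        = (\<Sum>k<n. (f0 x - f0 (flip k x))\<^sup>2) + (f1 x - f0 x)\<^sup>2" for x
      by (auto simp: f1_def f0_def flip_def fun_upd_twist power2_commute intro!: sum.cong)
    ultimately show ?thesis
      by (simp only: sign_avg_Suc) (simp add: sign_avg_add sign_avg_cdiv sign_avg_cmult field_simps)
  qed
  finally show ?case
    by simp
qed simp

section \<open>The Gaussian average behind Laplace transforms of Rademacher sums\<close>

text \<open>
Up to a constant, the integrand against the Lebesgue measure is again a centred normal density.
\<close>
lemma std_normal_exp_square:
  fixes b :: real
  assumes "b > - 1 / 2"
  shows "has_bochner_integral std_normal_distribution (\<lambda>x. exp (- b * x\<^sup>2)) (1 / sqrt (1 + 2 * b))"
proof -
  define s where "s = 1 / sqrt (1 + 2 * b)"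
  have b: "1 + 2 * b > 0"
    using assms by simp
  have s: "s > 0" "s\<^sup>2 = 1 / (1 + 2 * b)"
    using b by (simp_all add: s_def power_divide)
  have eq: "std_normal_density x *\<^sub>R exp (- b * x\<^sup>2) = s * normal_density 0 s x" for x
  proof -
    have "- x\<^sup>2 / 2 + - b * x\<^sup>2 = - x\<^sup>2 / (2 * s\<^sup>2)"
      using b by (simp add: s field_simps)
    then have "exp (- x\<^sup>2 / 2) * exp (- b * x\<^sup>2) = exp (- x\<^sup>2 / (2 * s\<^sup>2))"
      by (simp flip: exp_add)
    moreover have "s / sqrt (2 * pi * s\<^sup>2) = 1 / sqrt (2 * pi)"
      using s(1) by (simp add: real_sqrt_mult)
    ultimately show ?thesis
      by (simp add: normal_density_def field_simps)
  qed
  have "has_bochner_integral lborel (\<lambda>x. std_normal_density x *\<^sub>R exp (- b * x\<^sup>2)) (s * 1)"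
    unfolding eq using s
    by (intro has_bochner_integral_mult_right)
       (auto simp: has_bochner_integral_iff)
  then show ?thesis
    unfolding s_def by (intro has_bochner_integral_density) auto
qed

definition gauss2 :: "(real \<times> real) measure" where
  "gauss2 = std_normal_distribution \<Otimes>\<^sub>M std_normal_distribution"

lemma sets_gauss2 [measurable_cong]: "sets gauss2 = sets (borel \<Otimes>\<^sub>M borel)"
  unfolding gauss2_def by (intro sets_pair_measure_cong) auto

lemma space_gauss2 [simp]: "space gauss2 = UNIV"
  unfolding gauss2_def by (simp add: space_pair_measure)

interpretation gauss: prob_space std_normal_distribution
  by (rule prob_space_normal_density) simp

interpretation gauss2: pair_prob_space std_normal_distribution std_normal_distribution ..

lemma gauss2_prob: "prob_space gauss2"
  unfolding gauss2_def by (rule gauss2.P.prob_space_axioms)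

lemma gauss2_product:
  fixes f g :: "real \<Rightarrow> 'b :: {real_normed_field, banach, second_countable_topology}"
  assumes "has_bochner_integral std_normal_distribution f a"
    and "has_bochner_integral std_normal_distribution g b"
  shows "has_bochner_integral gauss2 (\<lambda>p. f (fst p) * g (snd p)) (a * b)"
proof -
  have [measurable]: "f \<in> borel_measurable borel" "g \<in> borel_measurable borel"
    using assms by (auto simp: has_bochner_integral_iff dest: borel_measurable_integrable)
  have int: "integrable std_normal_distribution f" "integrable std_normal_distribution g"
    and val: "integral\<^sup>L std_normal_distribution f = a" "integral\<^sup>L std_normal_distribution g = b"
    using assms by (auto simp: has_bochner_integral_iff)
  have *: "integrable (std_normal_distribution \<Otimes>\<^sub>M std_normal_distribution) (\<lambda>p. f (fst p) * g (snd p))"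
  proof (rule gauss2.Fubini_integrable)
    show "integrable std_normal_distribution
        (\<lambda>x. LINT y|std_normal_distribution. norm (f (fst (x, y)) * g (snd (x, y))))"
      using int by (simp add: norm_mult)
    show "AE x in std_normal_distribution. integrable std_normal_distribution (\<lambda>y. f (fst (x, y)) * g (snd (x, y)))"
      using int by simp
  qed simp
  from gauss2.integral_fst'[OF *] have "integral\<^sup>L gauss2 (\<lambda>p. f (fst p) * g (snd p)) = a * b"
    using int by (simp add: val gauss2_def)
  with * show ?thesis
    by (simp add: has_bochner_integral_iff gauss2_def)
qed

lemma gauss2_exp_squares:
  fixes b c :: real
  assumes "b > - 1 / 2" "c > - 1 / 2"
  shows "has_bochner_integral gauss2 (\<lambda>g. exp (- b * (fst g)\<^sup>2 - c * (snd g)\<^sup>2))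
    (1 / (sqrt (1 + 2 * b) * sqrt (1 + 2 * c)))"
  using gauss2_product[OF std_normal_exp_square[OF assms(1)] std_normal_exp_square[OF assms(2)]]
  by (simp add: exp_diff exp_minus field_simps)

lemma gauss2_exp_norm:
  fixes b :: real
  assumes "b > - 1 / 2"
  shows "has_bochner_integral gauss2 (\<lambda>g. exp (- b * ((fst g)\<^sup>2 + (snd g)\<^sup>2))) (1 / (1 + 2 * b))"
  using gauss2_exp_squares[OF assms assms] assms by (simp add: algebra_simps)

lemma gauss2_cos:
  "has_bochner_integral gauss2 (\<lambda>g. cos (\<alpha> * fst g + \<beta> * snd g)) (exp (- (\<alpha>\<^sup>2 + \<beta>\<^sup>2) / 2))"
proof -
  have *: "has_bochner_integral std_normal_distribution (\<lambda>x. iexp (\<alpha> * x)) (complex_of_real (exp (- \<alpha>\<^sup>2 / 2)))" for \<alpha>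
    using fun_cong[OF char_std_normal_distribution, of \<alpha>]
    by (simp add: has_bochner_integral_iff char_def gauss.integrable_iexp)
  have "has_bochner_integral gauss2 (\<lambda>g. Re (iexp (\<alpha> * fst g) * iexp (\<beta> * snd g)))
     (Re (complex_of_real (exp (- \<alpha>\<^sup>2 / 2)) * complex_of_real (exp (- \<beta>\<^sup>2 / 2))))"
    using gauss2_product[OF *[of \<alpha>] *[of \<beta>]] by (rule has_bochner_integral_Re)
  moreover have eq: "- (\<alpha>\<^sup>2 + \<beta>\<^sup>2) / 2 = - (\<alpha>\<^sup>2 / 2) - \<beta>\<^sup>2 / 2"
    by (simp add: field_simps)
  ultimately show ?thesis
    unfolding eq
    by (simp add: exp_add[symmetric] distrib_left[symmetric] Re_exp cos_add
          del: of_real_mult flip: exp_add of_real_exp)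
qed

text \<open>
The function \<open>exp (- t \<bar>z\<bar>\<^sup>2)\<close> is the characteristic function of a planar Gaussian vector, evaluated
at \<open>sqrt (2 t) z\<close>. Averaging over the signs first turns each character into a product of cosines. This
identity is the source of both the central limit estimate and all small ball bounds.
\<close>
lemma sign_avg_exp_norm_square:
  fixes a :: "nat \<Rightarrow> complex"
  assumes "t \<ge> 0"
  shows "sign_avg n (\<lambda>x. exp (- t * (cmod (\<Sum>k<n. x k *\<^sub>R a k))\<^sup>2))
    = (LINT g|gauss2. (\<Prod>k<n. cos (sqrt (2 * t) * (fst g * Re (a k) + snd g * Im (a k)))))"
proof -
  have 1: "has_bochner_integral gauss2
      (\<lambda>g. cos (0 + (\<Sum>k<n. x k * (sqrt (2 * t) * (fst g * Re (a k) + snd g * Im (a k))))))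
      (exp (- t * (cmod (\<Sum>k<n. x k *\<^sub>R a k))\<^sup>2))" for x
  proof -
    define z where "z = (\<Sum>k<n. x k *\<^sub>R a k)"
    have z: "Re z = (\<Sum>k<n. x k * Re (a k))" "Im z = (\<Sum>k<n. x k * Im (a k))"
      by (simp_all add: z_def)
    have "has_bochner_integral gauss2 (\<lambda>g. cos ((sqrt (2 * t) * Re z) * fst g + (sqrt (2 * t) * Im z) * snd g))
        (exp (- ((sqrt (2 * t) * Re z)\<^sup>2 + (sqrt (2 * t) * Im z)\<^sup>2) / 2))"
      by (rule gauss2_cos)
    also have "(\<lambda>g::real \<times> real. (sqrt (2 * t) * Re z) * fst g + (sqrt (2 * t) * Im z) * snd g)
      = (\<lambda>g. 0 + (\<Sum>k<n. x k * (sqrt (2 * t) * (fst g * Re (a k) + snd g * Im (a k)))))"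
      by (auto simp: z sum_distrib_left sum_distrib_right sum.distrib algebra_simps)
    also have "- ((sqrt (2 * t) * Re z)\<^sup>2 + (sqrt (2 * t) * Im z)\<^sup>2) / 2 = - t * (cmod z)\<^sup>2"
      using assms by (simp add: power_mult_distrib cmod_power2 field_simps)
    finally show ?thesis
      by (simp add: z_def)
  qed
  have "has_bochner_integral gauss2
     (\<lambda>g. sign_avg n (\<lambda>x. cos (0 + (\<Sum>k<n. x k * (sqrt (2 * t) * (fst g * Re (a k) + snd g * Im (a k)))))))
     (sign_avg n (\<lambda>x. exp (- t * (cmod (\<Sum>k<n. x k *\<^sub>R a k))\<^sup>2)))"
    unfolding sign_avg_def
    by (intro has_bochner_integral_divide_zero has_bochner_integral_sum 1)
  then show ?thesis
    unfolding sign_avg_cos_sum by (simp add: has_bochner_integral_iff)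
qed

section \<open>A central limit estimate and small ball bounds\<close>

lemma cos_taylor_bound: "\<bar>cos x - (1 - x\<^sup>2 / 2)\<bar> \<le> x ^ 4 / 24" for x :: real
proof -
  obtain t where t: "cos x = (\<Sum>m<4. cos_coeff m * x ^ m) + cos (t + 1 / 2 * real 4 * pi) / fact 4 * x ^ 4"
    using Maclaurin_cos_expansion[of x 4] by auto
  have sum4: "(\<Sum>m<4. f m) = f 0 + f 1 + f 2 + f 3" for f :: "nat \<Rightarrow> real"
    by (simp add: numeral_eq_Suc)
  have "cos x - (1 - x\<^sup>2 / 2) = cos (t + 1 / 2 * real 4 * pi) * x ^ 4 / 24"
    unfolding t sum4 by (simp add: cos_coeff_def fact_numeral)
  then have "\<bar>cos x - (1 - x\<^sup>2 / 2)\<bar> = \<bar>cos (t + 1 / 2 * real 4 * pi) * x ^ 4 / 24\<bar>"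
    by (simp only:)
  then have "\<bar>cos x - (1 - x\<^sup>2 / 2)\<bar> = \<bar>cos (t + 1 / 2 * real 4 * pi)\<bar> * x ^ 4 / 24"
    by (simp add: abs_mult)
  also have "\<dots> \<le> 1 * x ^ 4 / 24"
    by (intro divide_right_mono mult_right_mono) (auto intro: abs_cos_le_one)
  finally show ?thesis by simp
qed

lemma exp_minus_taylor_bound:
  fixes y :: real
  assumes "y \<ge> 0"
  shows "\<bar>exp (- y) - (1 - y)\<bar> \<le> y\<^sup>2 / 2"
proof -
  have "exp (- y) \<ge> 1 - y"
    using exp_ge_add_one_self[of "- y"] by simp
  moreover have "exp (- y) \<le> 1 - y + y\<^sup>2 / 2"
  proof -
    have "(1 - y + y\<^sup>2 / 2) * (1 + y + y\<^sup>2 / 2) = 1 + (y\<^sup>2)\<^sup>2 / 4"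
      by (simp add: power2_eq_square field_simps)
    then have "1 \<le> (1 - y + y\<^sup>2 / 2) * (1 + y + y\<^sup>2 / 2)"
      by simp
    also have "\<dots> \<le> (1 - y + y\<^sup>2 / 2) * exp y"
    proof (rule mult_left_mono)
      show "1 + y + y\<^sup>2 / 2 \<le> exp y"
        using exp_lower_Taylor_quadratic[OF assms] by simp
      show "0 \<le> 1 - y + y\<^sup>2 / 2"
        using zero_le_power2[of "y - 1"] by (simp add: power2_eq_square algebra_simps)
    qed
    finally show ?thesis
      by (simp add: exp_minus field_simps)
  qed
  ultimately show ?thesis by simp
qed

lemma cos_close_to_gaussian: "\<bar>cos x - exp (- x\<^sup>2 / 2)\<bar> \<le> x ^ 4" for x :: real
proof -
  have "\<bar>exp (- (x\<^sup>2 / 2)) - (1 - x\<^sup>2 / 2)\<bar> \<le> (x\<^sup>2 / 2)\<^sup>2 / 2"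
    by (rule exp_minus_taylor_bound) simp
  moreover have "(x\<^sup>2 / 2)\<^sup>2 / 2 = x ^ 4 / 8"
    by (simp add: power2_eq_square power4_eq_xxxx)
  moreover have "x ^ 4 \<ge> 0" by simp
  moreover have "- x\<^sup>2 / 2 = - (x\<^sup>2 / 2)" by simp
  ultimately show ?thesis
    using cos_taylor_bound[of x] by (simp only:)
qed

lemma abs_cos_le_gaussian:
  fixes x :: real
  assumes "\<bar>x\<bar> \<le> pi / 2"
  shows "\<bar>cos x\<bar> \<le> exp (- x\<^sup>2 / 3)"
proof -
  have "\<bar>x\<bar> \<le> 2"
    using assms pi_less_4 by linarith
  then have "x\<^sup>2 \<le> 4"
    using power_mono[of "\<bar>x\<bar>" 2 2] by simp
  then have "x\<^sup>2 * x\<^sup>2 \<le> x\<^sup>2 * 4"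
    by (intro mult_left_mono) auto
  then have "x ^ 4 / 24 \<le> x\<^sup>2 / 6"
    by (simp add: power4_eq_xxxx power2_eq_square)
  then have "cos x \<le> 1 - x\<^sup>2 / 3"
    using cos_taylor_bound[of x] by linarith
  also have "\<dots> \<le> exp (- x\<^sup>2 / 3)"
    using exp_ge_add_one_self[of "- x\<^sup>2 / 3"] by simp
  finally have "cos x \<le> exp (- x\<^sup>2 / 3)" .
  moreover have "cos x \<ge> 0"
    using assms by (intro cos_ge_zero) auto
  ultimately show ?thesis by simp
qed

text \<open>
The absolute value of the cosine has period \<open>\<pi>\<close>, so the argument may be reduced to distance at most
\<open>\<pi> / 2\<close> from zero.
\<close>
lemma abs_cos_far_from_zero_mod_pi:
  fixes x \<tau> :: real
  assumes "0 \<le> \<tau>" and far: "\<And>m::int. \<bar>x - pi * m\<bar> \<ge> \<tau>"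
  shows "\<bar>cos x\<bar> \<le> exp (- \<tau>\<^sup>2 / 3)"
proof -
  define m where "m = round (x / pi)"
  define y where "y = x - pi * m"
  have "\<bar>x / pi - m\<bar> \<le> 1 / 2"
    unfolding m_def using of_int_round_abs_le[of "x / pi"] by (simp add: abs_minus_commute)
  then have "\<bar>y\<bar> \<le> pi / 2"
    by (simp add: y_def abs_le_iff field_simps)
  moreover have "\<bar>y\<bar> \<ge> \<tau>"
    using far[of m] by (simp add: y_def)
  then have "\<tau>\<^sup>2 \<le> y\<^sup>2"
    using power_mono[of \<tau> "\<bar>y\<bar>" 2] assms(1) by simp
  moreover have "\<bar>cos x\<bar> = \<bar>cos y\<bar>"
  proof -
    have "sin (pi * m) = 0"
      using sin_int_times_real[of m 1] sin_zero_iff_int2[of "pi * m"] by (auto simp: mult.commute)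
    then have "\<bar>cos (pi * m)\<bar> = 1"
      using sin_cos_squared_add[of "pi * m"] by (auto simp: power2_eq_1_iff)
    moreover have "cos x = cos y * cos (pi * m) - sin y * sin (pi * m)"
      using cos_add[of y "pi * m"] by (simp add: y_def)
    ultimately show ?thesis
      using \<open>sin (pi * m) = 0\<close> by (simp add: abs_mult)
  qed
  ultimately show ?thesis
    using abs_cos_le_gaussian[of y] by (smt (verit) exp_le_cancel_iff divide_right_mono)
qed

text \<open>
The arguments of the cosines in \<open>sign_avg_exp_norm_square\<close>.
\<close>
definition phase :: "real \<Rightarrow> (nat \<Rightarrow> complex) \<Rightarrow> real \<times> real \<Rightarrow> nat \<Rightarrow> real" where
  "phase t a g k = sqrt (2 * t) * (fst g * Re (a k) + snd g * Im (a k))"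

definition sqn :: "real \<times> real \<Rightarrow> real" where
  "sqn g = (fst g)\<^sup>2 + (snd g)\<^sup>2"

lemma sqn_nonneg [simp]: "sqn g \<ge> 0"
  by (simp add: sqn_def)

lemma gauss2_exp_sqn:
  "b > - 1 / 2 \<Longrightarrow> has_bochner_integral gauss2 (\<lambda>g. exp (- b * sqn g)) (1 / (1 + 2 * b))"
  unfolding sqn_def by (rule gauss2_exp_norm)

lemma gauss2_exp_sqn_quarter: "has_bochner_integral gauss2 (\<lambda>g. exp (sqn g / 4)) 2"
  using gauss2_exp_sqn[of "- 1 / 4"] by simp

lemma phase_sq_eq:
  assumes "t \<ge> 0"
  shows "(phase t a g k)\<^sup>2 = t * (sqn g * (cmod (a k))\<^sup>2 + Re ((Complex (fst g) (- snd g))\<^sup>2 * (a k)\<^sup>2))"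
  using assms unfolding phase_def sqn_def cmod_power2 power_mult_distrib
  by (simp add: power2_eq_square algebra_simps)

lemma phase_sq_le:
  assumes "t \<ge> 0"
  shows "(phase t a g k)\<^sup>2 \<le> 2 * t * sqn g * (cmod (a k))\<^sup>2"
proof -
  have "Re ((Complex (fst g) (- snd g))\<^sup>2 * (a k)\<^sup>2) \<le> cmod ((Complex (fst g) (- snd g))\<^sup>2 * (a k)\<^sup>2)"
    by (rule complex_Re_le_cmod)
  also have "\<dots> = sqn g * (cmod (a k))\<^sup>2"
    by (simp add: norm_mult norm_power sqn_def cmod_power2)
  finally show ?thesis
    unfolding phase_sq_eq[OF assms] using assms
      mult_left_mono[of "Re ((Complex (fst g) (- snd g))\<^sup>2 * (a k)\<^sup>2)" "sqn g * (cmod (a k))\<^sup>2" t]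
    by (simp only: distrib_left) (simp add: mult_ac)
qed

text \<open>
For complex coefficients \<open>a k\<close>, the covariance of \<open>\<Sum>k<n. x k * a k\<close> differs from that of a rotation
invariant variable only through the sum of the squares \<open>(a k)\<^sup>2\<close>.
\<close>
lemma sum_phase_sq:
  assumes "t \<ge> 0" and "(\<Sum>k<n. (cmod (a k))\<^sup>2) = 1"
  shows "\<bar>(\<Sum>k<n. (phase t a g k)\<^sup>2) - t * sqn g\<bar> \<le> t * sqn g * cmod (\<Sum>k<n. (a k)\<^sup>2)"
proof -
  have "(\<Sum>k<n. (phase t a g k)\<^sup>2)
      = t * (sqn g * (\<Sum>k<n. (cmod (a k))\<^sup>2) + Re ((Complex (fst g) (- snd g))\<^sup>2 * (\<Sum>k<n. (a k)\<^sup>2)))"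
    unfolding phase_sq_eq[OF assms(1)] sum_distrib_left[symmetric] sum.distrib
    by (simp only: sum_distrib_left Re_sum)
  then have "(\<Sum>k<n. (phase t a g k)\<^sup>2) - t * sqn g = t * Re ((Complex (fst g) (- snd g))\<^sup>2 * (\<Sum>k<n. (a k)\<^sup>2))"
    by (simp only: assms(2)) (simp only: distrib_left mult_1_right add_diff_cancel_left')
  then have "\<bar>(\<Sum>k<n. (phase t a g k)\<^sup>2) - t * sqn g\<bar> = t * \<bar>Re ((Complex (fst g) (- snd g))\<^sup>2 * (\<Sum>k<n. (a k)\<^sup>2))\<bar>"
    using assms(1) by (simp only: abs_mult abs_of_nonneg)
  also have "\<dots> \<le> t * cmod ((Complex (fst g) (- snd g))\<^sup>2 * (\<Sum>k<n. (a k)\<^sup>2))"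
    by (intro mult_left_mono abs_Re_le_cmod assms)
  also have "\<dots> = t * sqn g * cmod (\<Sum>k<n. (a k)\<^sup>2)"
    by (simp add: norm_mult norm_power sqn_def cmod_power2)
  finally show ?thesis .
qed

lemma prod_cos_measurable [measurable]: "(\<lambda>g. \<Prod>k<n. cos (phase t a g k)) \<in> borel_measurable gauss2"
  unfolding phase_def by measurable

lemma abs_prod_cos_le_1: "\<bar>\<Prod>k<n. cos (f k)\<bar> \<le> (1 :: real)"
  unfolding abs_prod by (intro prod_le_1) auto

lemma prod_cos_integrable: "integrable gauss2 (\<lambda>g. \<Prod>k<n. cos (phase t a g k))"
proof -
  interpret prob_space gauss2 by (rule gauss2_prob)
  show ?thesis
    by (rule integrable_const_bound[where B = 1]) (auto simp: abs_prod_cos_le_1)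
qed

lemma sign_avg_exp_le:
  assumes "t \<ge> 0" and h: "has_bochner_integral gauss2 h H"
    and le: "\<And>g. \<bar>\<Prod>k<n. cos (phase t a g k)\<bar> \<le> h g"
  shows "sign_avg n (\<lambda>x. exp (- t * (cmod (\<Sum>k<n. x k *\<^sub>R a k))\<^sup>2)) \<le> H"
proof -
  have "(LINT g|gauss2. (\<Prod>k<n. cos (phase t a g k))) \<le> (LINT g|gauss2. h g)"
    using h le by (intro integral_mono prod_cos_integrable) (auto simp: has_bochner_integral_iff abs_le_iff)
  then show ?thesis
    using h unfolding sign_avg_exp_norm_square[OF assms(1)] phase_def
    by (simp add: has_bochner_integral_iff)
qed

text \<open>
The product of cosines is replaced by the product of the Gaussians \<open>exp (- v\<^sup>2 / 2)\<close>, at a cost of the sum of the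
fourth powers of the phases, and the resulting quadratic form by \<open>t * sqn g\<close>. Integrating the Gaussian that is left
gives \<open>1 / (1 + t)\<close>. The polynomial factors in the errors are absorbed by \<open>exp (sqn g / 4)\<close>, whose mean is \<open>2\<close>.
\<close>
lemma sign_avg_exp_clt:
  assumes t: "t \<ge> 0" and one: "(\<Sum>k<n. (cmod (a k))\<^sup>2) = 1"
    and kap: "\<And>k. k < n \<Longrightarrow> (cmod (a k))\<^sup>2 \<le> \<kappa>"
  shows "\<bar>sign_avg n (\<lambda>x. exp (- t * (cmod (\<Sum>k<n. x k *\<^sub>R a k))\<^sup>2)) - 1 / (1 + t)\<bar>
    \<le> 256 * \<kappa> * t\<^sup>2 + 4 * t * cmod (\<Sum>k<n. (a k)\<^sup>2)"
proof -
  define c where "c = cmod (\<Sum>k<n. (a k)\<^sup>2)"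
  define C where "C = 128 * \<kappa> * t\<^sup>2 + 2 * t * c"
  have pt: "\<bar>(\<Prod>k<n. cos (phase t a g k)) - exp (- (t / 2) * sqn g)\<bar> \<le> C * exp (sqn g / 4)" for g
  proof -
    have "\<bar>(\<Prod>k<n. cos (phase t a g k)) - (\<Prod>k<n. exp (- (phase t a g k)\<^sup>2 / 2))\<bar>
        \<le> (\<Sum>k<n. \<bar>cos (phase t a g k) - exp (- (phase t a g k)\<^sup>2 / 2)\<bar>)"
      using norm_prod_diff[of "{..<n}" "\<lambda>k. cos (phase t a g k)" "\<lambda>k. exp (- (phase t a g k)\<^sup>2 / 2)"]
      by simp
    also have "\<dots> \<le> (\<Sum>k<n. (phase t a g k) ^ 4)"
      by (intro sum_mono cos_close_to_gaussian)
    also have "\<dots> \<le> (\<Sum>k<n. 4 * t\<^sup>2 * \<kappa> * (sqn g)\<^sup>2 * (cmod (a k))\<^sup>2)"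
    proof (rule sum_mono)
      fix k assume k: "k \<in> {..<n}"
      have "(phase t a g k) ^ 4 = ((phase t a g k)\<^sup>2)\<^sup>2"
        by simp
      also have "\<dots> \<le> (2 * t * sqn g * (cmod (a k))\<^sup>2)\<^sup>2"
        by (intro power_mono phase_sq_le t) auto
      also have "\<dots> = 4 * t\<^sup>2 * (sqn g)\<^sup>2 * (cmod (a k))\<^sup>2 * (cmod (a k))\<^sup>2"
        by (simp add: power2_eq_square)
      also have "\<dots> \<le> 4 * t\<^sup>2 * (sqn g)\<^sup>2 * (cmod (a k))\<^sup>2 * \<kappa>"
        using k by (intro mult_left_mono kap) auto
      finally show "(phase t a g k) ^ 4 \<le> 4 * t\<^sup>2 * \<kappa> * (sqn g)\<^sup>2 * (cmod (a k))\<^sup>2"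
        by (simp add: mult_ac)
    qed
    also have "\<dots> = 4 * t\<^sup>2 * \<kappa> * (sqn g)\<^sup>2"
      using one by (simp flip: sum_distrib_left)
    finally have 1: "\<bar>(\<Prod>k<n. cos (phase t a g k)) - exp (- (\<Sum>k<n. (phase t a g k)\<^sup>2) / 2)\<bar> \<le> 4 * t\<^sup>2 * \<kappa> * (sqn g)\<^sup>2"
      by (simp add: sum_negf exp_sum[symmetric] flip: sum_divide_distrib)
    have lip: "\<bar>exp (- u) - exp (- v)\<bar> \<le> \<bar>u - v\<bar>" if "0 \<le> u" "0 \<le> v" for u v :: real
    proof -
      have *: "\<bar>exp (- u) - exp (- v)\<bar> \<le> \<bar>u - v\<bar>" if "0 \<le> u" "u \<le> v" for u v :: real
      proof -
        have "exp (- u) - exp (- v) = exp (- u) * (1 - exp (- (v - u)))"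
          by (simp add: algebra_simps flip: exp_add)
        also have "\<dots> \<le> 1 * (v - u)"
          using that exp_ge_add_one_self[of "- (v - u)"] by (intro mult_mono) (simp_all del: minus_diff_eq)
        finally show ?thesis
          using that by simp
      qed
      show ?thesis
        using *[of u v] *[of v u] that by (cases "u \<le> v") auto
    qed
    have "\<bar>exp (- (\<Sum>k<n. (phase t a g k)\<^sup>2) / 2) - exp (- (t / 2) * sqn g)\<bar> \<le> \<bar>(\<Sum>k<n. (phase t a g k)\<^sup>2) / 2 - t / 2 * sqn g\<bar>"
      using lip[of "(\<Sum>k<n. (phase t a g k)\<^sup>2) / 2" "t / 2 * sqn g"] t by (simp add: sum_nonneg)
    also have "\<dots> = \<bar>(\<Sum>k<n. (phase t a g k)\<^sup>2) - t * sqn g\<bar> / 2"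
      by (simp add: field_simps abs_if)
    also have "\<dots> \<le> t * sqn g * c / 2"
      using sum_phase_sq[OF t one, of g] by (simp add: c_def)
    finally have 2: "\<bar>exp (- (\<Sum>k<n. (phase t a g k)\<^sup>2) / 2) - exp (- (t / 2) * sqn g)\<bar> \<le> t * sqn g * c / 2" .
    have w1: "sqn g \<le> 4 * exp (sqn g / 4)"
      using exp_ge_add_one_self[of "sqn g / 4"] by linarith
    have w2: "(sqn g)\<^sup>2 \<le> 32 * exp (sqn g / 4)"
    proof -
      have "1 + sqn g / 4 + (sqn g / 4)\<^sup>2 / 2 \<le> exp (sqn g / 4)"
        by (rule exp_lower_Taylor_quadratic) simp
      moreover have "(sqn g / 4)\<^sup>2 / 2 = (sqn g)\<^sup>2 / 32"
        by (simp add: power2_eq_square)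
      ultimately show ?thesis
        using sqn_nonneg[of g] by linarith
    qed
    have kap0: "\<kappa> \<ge> 0"
    proof -
      have "n > 0"
        using one by (cases n) auto
      then show ?thesis
        using kap[of 0] order_trans zero_le_power2 by blast
    qed
    have "4 * t\<^sup>2 * \<kappa> * (sqn g)\<^sup>2 \<le> 4 * t\<^sup>2 * \<kappa> * (32 * exp (sqn g / 4))"
      using kap0 by (intro mult_left_mono w2) auto
    moreover have "(t * c / 2) * sqn g \<le> (t * c / 2) * (4 * exp (sqn g / 4))"
      using t by (intro mult_left_mono w1) (auto simp: c_def)
    moreover have "C * exp (sqn g / 4) = 4 * t\<^sup>2 * \<kappa> * (32 * exp (sqn g / 4)) + (t * c / 2) * (4 * exp (sqn g / 4))"
      by (simp add: C_def algebra_simps)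
    moreover have "t * sqn g * c / 2 = (t * c / 2) * sqn g"
      by simp
    ultimately show ?thesis
      using 1 2 by linarith
  qed
  have g: "has_bochner_integral gauss2 (\<lambda>g. exp (- (t / 2) * sqn g)) (1 / (1 + t))"
    using gauss2_exp_sqn[of "t / 2"] t by simp
  have e: "has_bochner_integral gauss2 (\<lambda>g. C * exp (sqn g / 4)) (C * 2)"
    by (intro has_bochner_integral_mult_right gauss2_exp_sqn_quarter)
  have "\<bar>(LINT g|gauss2. (\<Prod>k<n. cos (phase t a g k)) - exp (- (t / 2) * sqn g))\<bar>
      \<le> (LINT g|gauss2. C * exp (sqn g / 4))"
  proof (rule integral_abs_bound_integral)
    show "integrable gauss2 (\<lambda>g. (\<Prod>k<n. cos (phase t a g k)) - exp (- (t / 2) * sqn g))"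
      using g by (intro Bochner_Integration.integrable_diff prod_cos_integrable) (simp only: has_bochner_integral_iff)
    show "integrable gauss2 (\<lambda>g. C * exp (sqn g / 4))"
      using e by (simp only: has_bochner_integral_iff)
  qed (rule pt)
  moreover have "(LINT g|gauss2. (\<Prod>k<n. cos (phase t a g k)) - exp (- (t / 2) * sqn g))
     = (LINT g|gauss2. (\<Prod>k<n. cos (phase t a g k))) - (LINT g|gauss2. exp (- (t / 2) * sqn g))"
    using g by (intro Bochner_Integration.integral_diff prod_cos_integrable) (auto simp: has_bochner_integral_iff)
  ultimately show ?thesis
    using g e unfolding sign_avg_exp_norm_square[OF t] phase_def
    by (simp add: has_bochner_integral_iff C_def c_def algebra_simps)
qed

text \<open>
As long as all phases are at most one, each cosine is dominated by a Gaussian; for larger \<open>g\<close> the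
second exponential on the right exceeds one.
\<close>
lemma prod_cos_gaussian_or_large:
  assumes "t > 0" "\<kappa> > 0" and kap: "\<And>k. k < n \<Longrightarrow> (cmod (a k))\<^sup>2 \<le> \<kappa>"
  shows "\<bar>\<Prod>k<n. cos (phase t a g k)\<bar> \<le> exp (- (\<Sum>k<n. (phase t a g k)\<^sup>2) / 3) + exp (sqn g / 4 - 1 / (8 * t * \<kappa>))"
proof (cases "2 * t * sqn g * \<kappa> \<le> 1")
  case True
  have "\<bar>\<Prod>k<n. cos (phase t a g k)\<bar> \<le> (\<Prod>k<n. exp (- (phase t a g k)\<^sup>2 / 3))"
    unfolding abs_prod
  proof (intro prod_mono conjI abs_cos_le_gaussian)
    fix k assume k: "k \<in> {..<n}"
    have "(phase t a g k)\<^sup>2 \<le> 2 * t * sqn g * (cmod (a k))\<^sup>2"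
      using assms by (intro phase_sq_le) auto
    also have "\<dots> \<le> 2 * t * sqn g * \<kappa>"
      using assms k by (intro mult_left_mono kap) auto
    finally have "(phase t a g k)\<^sup>2 \<le> 1"
      using True by simp
    then have "\<bar>phase t a g k\<bar> \<le> 1"
      by (simp add: abs_square_le_1)
    then show "\<bar>phase t a g k\<bar> \<le> pi / 2"
      using pi_ge_two by linarith
  qed auto
  also have "\<dots> = exp (- (\<Sum>k<n. (phase t a g k)\<^sup>2) / 3)"
    by (simp add: sum_negf exp_sum[symmetric] flip: sum_divide_distrib)
  finally show ?thesis
    by (smt (verit) exp_gt_zero)
next
  case False
  then have "sqn g / 4 - 1 / (8 * t * \<kappa>) \<ge> 0"
    using assms by (simp add: field_simps)
  then have "exp (sqn g / 4 - 1 / (8 * t * \<kappa>)) \<ge> 1"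
    by simp
  then show ?thesis
    using abs_prod_cos_le_1[of "phase t a g" n] by (smt (verit) exp_gt_zero)
qed

text \<open>
The planar case: if the squares of the coefficients cancel, then the quadratic form of the phases is
comparable with \<open>t * sqn g\<close>, and the bound is of order \<open>1 / t\<close>.
\<close>
lemma small_ball_nondegenerate:
  assumes "t > 0" "\<kappa> > 0" and kap: "\<And>k. k < n \<Longrightarrow> (cmod (a k))\<^sup>2 \<le> \<kappa>"
    and one: "(\<Sum>k<n. (cmod (a k))\<^sup>2) = 1" and c: "cmod (\<Sum>k<n. (a k)\<^sup>2) \<le> 1 / 2"
  shows "sign_avg n (\<lambda>x. exp (- t * (cmod (\<Sum>k<n. x k *\<^sub>R a k))\<^sup>2))
    \<le> 1 / (1 + t / 3) + 2 * exp (- 1 / (8 * t * \<kappa>))"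
proof (rule sign_avg_exp_le)
  show "has_bochner_integral gauss2 (\<lambda>g. exp (- (t / 6) * sqn g) + exp (- 1 / (8 * t * \<kappa>)) * exp (sqn g / 4))
     (1 / (1 + t / 3) + 2 * exp (- 1 / (8 * t * \<kappa>)))"
    using has_bochner_integral_add[OF gauss2_exp_sqn[of "t / 6"]
        has_bochner_integral_mult_right[OF gauss2_exp_sqn_quarter, of "exp (- 1 / (8 * t * \<kappa>))"]] assms(1)
    by (simp add: mult.commute)
  have split: "exp (sqn g / 4 - 1 / (8 * t * \<kappa>)) = exp (- 1 / (8 * t * \<kappa>)) * exp (sqn g / 4)" for g
    by (simp flip: exp_add)
  fix g
  have "\<bar>(\<Sum>k<n. (phase t a g k)\<^sup>2) - t * sqn g\<bar> \<le> t * sqn g * cmod (\<Sum>k<n. (a k)\<^sup>2)"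
    using assms by (intro sum_phase_sq) auto
  also have "\<dots> \<le> t * sqn g * (1 / 2)"
    using assms by (intro mult_left_mono c) auto
  finally have "(\<Sum>k<n. (phase t a g k)\<^sup>2) / 3 \<ge> t / 6 * sqn g"
    by linarith
  then have "exp (- (\<Sum>k<n. (phase t a g k)\<^sup>2) / 3) \<le> exp (- (t / 6) * sqn g)"
    by simp
  then show "\<bar>\<Prod>k<n. cos (phase t a g k)\<bar> \<le> exp (- (t / 6) * sqn g) + exp (- 1 / (8 * t * \<kappa>)) * exp (sqn g / 4)"
    using prod_cos_gaussian_or_large[where n = n and a = a and g = g, OF assms(1,2) kap] split[of g] by linarith
qed (use assms in auto)

lemma small_ball_one_dim:
  fixes b :: "nat \<Rightarrow> real"
  assumes "t > 0" "\<kappa> > 0" and kap: "\<And>k. k < n \<Longrightarrow> (b k)\<^sup>2 \<le> \<kappa>"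
    and half: "(\<Sum>k<n. (b k)\<^sup>2) \<ge> 1 / 2"
  shows "sign_avg n (\<lambda>x. exp (- t * (\<Sum>k<n. x k * b k)\<^sup>2))
    \<le> 1 / sqrt (1 + 2 * t / 3) + 2 * exp (- 1 / (8 * t * \<kappa>))"
proof -
  have "sign_avg n (\<lambda>x. exp (- t * (cmod (\<Sum>k<n. x k *\<^sub>R complex_of_real (b k)))\<^sup>2))
    \<le> 1 / sqrt (1 + 2 * t / 3) + 2 * exp (- 1 / (8 * t * \<kappa>))"
  proof (rule sign_avg_exp_le)
    show "has_bochner_integral gauss2 (\<lambda>g. exp (- (t / 3) * (fst g)\<^sup>2 - 0 * (snd g)\<^sup>2) + exp (- 1 / (8 * t * \<kappa>)) * exp (sqn g / 4))
       (1 / sqrt (1 + 2 * t / 3) + 2 * exp (- 1 / (8 * t * \<kappa>)))"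
      using has_bochner_integral_add[OF gauss2_exp_squares[of "t / 3" 0]
          has_bochner_integral_mult_right[OF gauss2_exp_sqn_quarter, of "exp (- 1 / (8 * t * \<kappa>))"]] assms(1)
      by (simp add: mult.commute)
    have split: "exp (sqn g / 4 - 1 / (8 * t * \<kappa>)) = exp (- 1 / (8 * t * \<kappa>)) * exp (sqn g / 4)" for g
      by (simp flip: exp_add)
    fix g
    have "(\<Sum>k<n. (phase t (\<lambda>k. complex_of_real (b k)) g k)\<^sup>2) = 2 * t * (fst g)\<^sup>2 * (\<Sum>k<n. (b k)\<^sup>2)"
      using assms(1) by (simp add: phase_def power_mult_distrib sum_distrib_left mult_ac)
    also have "\<dots> \<ge> 2 * t * (fst g)\<^sup>2 * (1 / 2)"
      using assms by (intro mult_left_mono half) auto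
    finally have "exp (- (\<Sum>k<n. (phase t (\<lambda>k. complex_of_real (b k)) g k)\<^sup>2) / 3) \<le> exp (- (t / 3) * (fst g)\<^sup>2 - 0 * (snd g)\<^sup>2)"
      by simp
    moreover have "\<bar>\<Prod>k<n. cos (phase t (\<lambda>k. complex_of_real (b k)) g k)\<bar>
       \<le> exp (- (\<Sum>k<n. (phase t (\<lambda>k. complex_of_real (b k)) g k)\<^sup>2) / 3) + exp (sqn g / 4 - 1 / (8 * t * \<kappa>))"
      by (rule prod_cos_gaussian_or_large[OF assms(1,2)]) (simp add: kap)
    ultimately show "\<bar>\<Prod>k<n. cos (phase t (\<lambda>k. complex_of_real (b k)) g k)\<bar>
       \<le> exp (- (t / 3) * (fst g)\<^sup>2 - 0 * (snd g)\<^sup>2) + exp (- 1 / (8 * t * \<kappa>)) * exp (sqn g / 4)"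
      using split[of g] by linarith
  qed (use assms in auto)
  then show ?thesis
    by (simp add: scaleR_conv_of_real flip: of_real_mult of_real_sum)
qed

text \<open>
Without any assumption on the squares of the coefficients, the real or the imaginary parts still carry at least
half of the variance; the one-dimensional bound of order \<open>1 / sqrt t\<close> applies to them.
\<close>
lemma small_ball_general:
  assumes "t > 0" "\<kappa> > 0" and kap: "\<And>k. k < n \<Longrightarrow> (cmod (a k))\<^sup>2 \<le> \<kappa>"
    and one: "(\<Sum>k<n. (cmod (a k))\<^sup>2) = 1"
  shows "sign_avg n (\<lambda>x. exp (- t * (cmod (\<Sum>k<n. x k *\<^sub>R a k))\<^sup>2))
    \<le> 1 / sqrt (1 + 2 * t / 3) + 2 * exp (- 1 / (8 * t * \<kappa>))"
proof -
  have ReIm: "(\<Sum>k<n. (Re (a k))\<^sup>2) + (\<Sum>k<n. (Im (a k))\<^sup>2) = 1"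
    using one by (simp add: cmod_power2 sum.distrib)
  then have "\<exists>b. (\<Sum>k<n. (b k)\<^sup>2) \<ge> 1 / 2 \<and> (\<forall>k. (b k)\<^sup>2 \<le> (cmod (a k))\<^sup>2) \<and>
      (\<forall>x. (\<Sum>k<n. x k * b k)\<^sup>2 \<le> (cmod (\<Sum>k<n. x k *\<^sub>R a k))\<^sup>2)"
  proof (cases "(\<Sum>k<n. (Re (a k))\<^sup>2) \<ge> 1 / 2")
    case True
    then show ?thesis
      by (intro exI[of _ "\<lambda>k. Re (a k)"]) (simp add: cmod_power2)
  next
    case False
    with ReIm show ?thesis
      by (intro exI[of _ "\<lambda>k. Im (a k)"]) (simp add: cmod_power2)
  qed
  then obtain b where b: "(\<Sum>k<n. (b k)\<^sup>2) \<ge> 1 / 2" "\<And>k. (b k)\<^sup>2 \<le> (cmod (a k))\<^sup>2"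
    "\<And>x. (\<Sum>k<n. x k * b k)\<^sup>2 \<le> (cmod (\<Sum>k<n. x k *\<^sub>R a k))\<^sup>2"
    by blast
  have "sign_avg n (\<lambda>x. exp (- t * (cmod (\<Sum>k<n. x k *\<^sub>R a k))\<^sup>2)) \<le> sign_avg n (\<lambda>x. exp (- t * (\<Sum>k<n. x k * b k)\<^sup>2))"
    using assms(1) by (intro sign_avg_mono) (simp add: b(3))
  also have "\<dots> \<le> 1 / sqrt (1 + 2 * t / 3) + 2 * exp (- 1 / (8 * t * \<kappa>))"
    using assms b(1) order_trans[OF b(2) kap] by (intro small_ball_one_dim)
  finally show ?thesis .
qed

section \<open>Resonances of a sampled cosine\<close>

text \<open>
A Diophantine condition on \<open>2 cos \<theta>\<close>, truncated at denominators of size \<open>R\<close>.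
\<close>
definition diophantine :: "real \<Rightarrow> real \<Rightarrow> real \<Rightarrow> bool" where
  "diophantine R \<eta> \<theta> \<longleftrightarrow>
     (\<forall>q::nat. \<forall>p::int. 1 \<le> q \<longrightarrow> real q \<le> R \<longrightarrow> \<bar>2 * real q * cos \<theta> - of_int p\<bar> > \<eta>)"

text \<open>
The denominator \<open>q = 1\<close> with \<open>p = 2\<close> and \<open>p = -2\<close> keeps the cosine away from \<open>1\<close> and \<open>-1\<close>.
\<close>
lemma diophantine_sin:
  assumes "diophantine R \<eta> \<theta>" "1 \<le> R" "0 < \<eta>" "\<eta> \<le> 1 / 2"
  shows "\<eta>\<^sup>2 < (sin \<theta>)\<^sup>2"
proof -
  have "\<bar>2 * real 1 * cos \<theta> - of_int 2\<bar> > \<eta>" "\<bar>2 * real 1 * cos \<theta> - of_int (-2)\<bar> > \<eta>"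
    using assms(1,2) unfolding diophantine_def by (metis le_refl of_nat_1)+
  then have c: "\<bar>cos \<theta>\<bar> < 1 - \<eta> / 2"
    using cos_le_one[of \<theta>] cos_ge_minus_one[of \<theta>] by (auto simp: abs_if split: if_splits; linarith)
  have "\<eta>\<^sup>2 \<le> \<eta> / 2"
    using mult_left_mono[OF assms(4), of \<eta>] assms(3) by (simp add: power2_eq_square)
  also have "\<dots> < 1 - \<bar>cos \<theta>\<bar>"
    using c by simp
  also have "\<dots> \<le> 1 - (cos \<theta>)\<^sup>2"
    using mult_right_mono[of "\<bar>cos \<theta>\<bar>" 1 "\<bar>cos \<theta>\<bar>"] by (simp add: power2_eq_square flip: abs_mult)
  also have "\<dots> = (sin \<theta>)\<^sup>2"
    by (simp add: sin_squared_eq)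
  finally show ?thesis .
qed

text \<open>
Suppose that four consecutive terms \<open>x i\<close> are all close to multiples \<open>\<pi> m i\<close>. The recurrence
\<open>x (i + 2) + x i = 2 cos \<theta> x (i + 1)\<close> then makes \<open>2 cos \<theta> m (i + 1)\<close> almost the integer \<open>m i + m (i + 2)\<close>, so
\<open>m 1\<close> and \<open>m 2\<close> must vanish. But two consecutive terms of an oscillation of amplitude at least one cannot both be
small unless \<open>sin \<theta>\<close> is small.
\<close>
lemma one_of_four_far_from_lattice:
  assumes dio: "diophantine R \<eta> \<theta>" and R: "1 \<le> \<rho>" "\<rho> \<le> R" and eta: "0 < \<eta>" "\<eta> \<le> 1 / 2"
  shows "\<exists>i\<in>{0, 1, 2, 3}. \<forall>m::int. \<bar>\<rho> * cos (\<phi> + real i * \<theta>) - pi * of_int m\<bar> \<ge> \<eta> / 2"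
proof (rule ccontr)
  define x where "x i = \<rho> * cos (\<phi> + real i * \<theta>)" for i :: nat
  assume "\<not> ?thesis"
  then have "\<forall>i\<in>{0, 1, 2, 3::nat}. \<exists>m::int. \<bar>x i - pi * of_int m\<bar> < \<eta> / 2"
    by (auto simp: x_def not_le)
  then obtain m where m: "\<And>i. i \<in> {0, 1, 2, 3::nat} \<Longrightarrow> \<bar>x i - pi * of_int (m i :: int)\<bar> < \<eta> / 2"
    by metis
  have rec: "x (i + 2) = 2 * cos \<theta> * x (i + 1) - x i" for i
  proof -
    have "cos (\<phi> + real (i + 2) * \<theta>) + cos (\<phi> + real i * \<theta>)
        = 2 * cos \<theta> * cos (\<phi> + real (i + 1) * \<theta>)"
      using cos_add[of "\<phi> + real (i + 1) * \<theta>" \<theta>] cos_diff[of "\<phi> + real (i + 1) * \<theta>" \<theta>]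
      by (simp add: algebra_simps)
    then have "\<rho> * (cos (\<phi> + real (i + 2) * \<theta>) + cos (\<phi> + real i * \<theta>))
        = \<rho> * (2 * cos \<theta> * cos (\<phi> + real (i + 1) * \<theta>))"
      by (simp only:)
    then show ?thesis
      unfolding x_def by (simp only: distrib_left) (simp add: mult_ac)
  qed
  \<comment> \<open>a nonzero lattice point in the middle of three consecutive terms makes a multiple of the cosine nearly an integer\<close>
  have zero: "m (i + 1) = 0" if i: "i \<in> {0, 1}" for i
  proof (rule ccontr)
    assume nz: "m (i + 1) \<noteq> 0"
    have i': "i \<in> {0, 1, 2, 3}" "i + 1 \<in> {0, 1, 2, 3}" "i + 2 \<in> {0, 1, 2, 3}"
      using i by auto
    define u where "u = x i - pi * of_int (m i)"
    define v where "v = x (i + 1) - pi * of_int (m (i + 1))"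
    define w where "w = x (i + 2) - pi * of_int (m (i + 2))"
    have b: "\<bar>u\<bar> < \<eta> / 2" "\<bar>v\<bar> < \<eta> / 2" "\<bar>w\<bar> < \<eta> / 2"
      using m[OF i'(1)] m[OF i'(2)] m[OF i'(3)] by (simp_all add: u_def v_def w_def)
    have "pi * (2 * cos \<theta> * of_int (m (i + 1)) - of_int (m i + m (i + 2))) = u + w - 2 * cos \<theta> * v"
      using rec[of i] by (simp add: u_def v_def w_def algebra_simps)
    then have "pi * \<bar>2 * cos \<theta> * of_int (m (i + 1)) - of_int (m i + m (i + 2))\<bar> = \<bar>u + w - 2 * cos \<theta> * v\<bar>"
      by (metis abs_mult abs_of_pos pi_gt_zero)
    also have "\<dots> \<le> \<bar>u\<bar> + \<bar>w\<bar> + 2 * \<bar>v\<bar>"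
    proof -
      have "\<bar>2 * cos \<theta> * v\<bar> \<le> 2 * \<bar>v\<bar>"
        using mult_right_mono[OF abs_cos_le_one[of \<theta>], of "2 * \<bar>v\<bar>"] by (simp add: abs_mult)
      then show ?thesis by linarith
    qed
    also have "\<dots> < 2 * \<eta>"
      using b by linarith
    also have "\<dots> \<le> pi * \<eta>"
      using pi_ge_two eta by (intro mult_right_mono) auto
    finally have close: "\<bar>2 * cos \<theta> * of_int (m (i + 1)) - of_int (m i + m (i + 2))\<bar> < \<eta>"
      by simp
    define q where "q = nat \<bar>m (i + 1)\<bar>"
    have q: "1 \<le> q" "real q = \<bar>of_int (m (i + 1))\<bar>"
      using nz by (auto simp: q_def)
    have "pi * real q = \<bar>x (i + 1) - v\<bar>"
      by (simp add: q v_def abs_mult)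
    also have "\<dots> \<le> \<bar>x (i + 1)\<bar> + \<bar>v\<bar>"
      by (rule abs_triangle_ineq4)
    also have "\<bar>x (i + 1)\<bar> \<le> \<rho> * 1"
      unfolding x_def abs_mult using R abs_cos_le_one by (intro mult_mono) auto
    finally have "pi * real q \<le> \<rho> + 1 / 4"
      using b eta by linarith
    moreover have "2 * real q \<le> pi * real q"
      by (intro mult_right_mono pi_ge_two) auto
    ultimately have "real q \<le> R"
      using R by linarith
    then have *: "\<bar>2 * real q * cos \<theta> - of_int p\<bar> > \<eta>" for p
      using dio q(1) unfolding diophantine_def by blast
    show False
    proof (cases "m (i + 1) > 0")
      case True
      then show False
        using *[of "m i + m (i + 2)"] close q by (simp add: mult_ac)
    next
      case False
      then show False
        using *[of "- (m i + m (i + 2))"] close q nz by (simp add: mult_ac abs_minus_commute)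
    qed
  qed
  have "\<bar>x 1\<bar> < \<eta> / 2" "\<bar>x 2\<bar> < \<eta> / 2"
    using zero[of 0] zero[of 1] m[of 1] m[of 2] by (simp_all add: numeral_2_eq_2)
  \<comment> \<open>two consecutive small terms force the sine to be small\<close>
  moreover have "\<rho>\<^sup>2 * (sin \<theta>)\<^sup>2 = (x 1)\<^sup>2 + (x 2)\<^sup>2 - 2 * cos \<theta> * (x 1 * x 2)"
  proof -
    define \<alpha> where "\<alpha> = \<phi> + \<theta>"
    have x12: "x 1 = \<rho> * cos \<alpha>" "x 2 = \<rho> * (cos \<alpha> * cos \<theta> - sin \<alpha> * sin \<theta>)"
    proof -
      have "\<phi> + real 1 * \<theta> = \<alpha>" "\<phi> + real 2 * \<theta> = \<alpha> + \<theta>"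
        by (simp_all add: \<alpha>_def)
      then show "x 1 = \<rho> * cos \<alpha>" "x 2 = \<rho> * (cos \<alpha> * cos \<theta> - sin \<alpha> * sin \<theta>)"
        by (simp_all only: x_def cos_add)
    qed
    have "(cos \<alpha>)\<^sup>2 + (cos \<alpha> * cos \<theta> - sin \<alpha> * sin \<theta>)\<^sup>2 - 2 * cos \<theta> * (cos \<alpha> * (cos \<alpha> * cos \<theta> - sin \<alpha> * sin \<theta>))
      = (cos \<alpha>)\<^sup>2 * (1 - (cos \<theta>)\<^sup>2) + (sin \<alpha>)\<^sup>2 * (sin \<theta>)\<^sup>2"
      by (simp add: power2_eq_square algebra_simps)
    also have "\<dots> = (sin \<theta>)\<^sup>2 * ((cos \<alpha>)\<^sup>2 + (sin \<alpha>)\<^sup>2)"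
      by (simp add: sin_squared_eq algebra_simps)
    finally have sq: "(sin \<theta>)\<^sup>2 = (cos \<alpha>)\<^sup>2 + (cos \<alpha> * cos \<theta> - sin \<alpha> * sin \<theta>)\<^sup>2
        - 2 * cos \<theta> * (cos \<alpha> * (cos \<alpha> * cos \<theta> - sin \<alpha> * sin \<theta>))"
      by simp
    show ?thesis
      unfolding x12 by (subst sq) (simp add: power2_eq_square algebra_simps)
  qed
  moreover have "\<bar>2 * cos \<theta> * (x 1 * x 2)\<bar> \<le> 2 * (\<bar>x 1\<bar> * \<bar>x 2\<bar>)"
    using mult_right_mono[OF abs_cos_le_one[of \<theta>], of "2 * (\<bar>x 1\<bar> * \<bar>x 2\<bar>)"] by (simp add: abs_mult)
  ultimately have "\<rho>\<^sup>2 * (sin \<theta>)\<^sup>2 \<le> (\<bar>x 1\<bar> + \<bar>x 2\<bar>)\<^sup>2"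
    by (simp add: power2_sum abs_le_iff)
  also have "\<dots> \<le> \<eta>\<^sup>2"
    using \<open>\<bar>x 1\<bar> < \<eta> / 2\<close> \<open>\<bar>x 2\<bar> < \<eta> / 2\<close> by (intro power_mono) auto
  finally have "\<rho>\<^sup>2 * (sin \<theta>)\<^sup>2 \<le> \<eta>\<^sup>2" .
  moreover have "1 * (sin \<theta>)\<^sup>2 \<le> \<rho>\<^sup>2 * (sin \<theta>)\<^sup>2"
    using R by (intro mult_right_mono) auto
  ultimately show False
    using diophantine_sin[OF dio _ eta] R by simp
qed

lemma card_le_diameter:
  fixes J :: "nat set"
  assumes "finite J" "0 \<le> d" and diam: "\<And>i j. i \<in> J \<Longrightarrow> j \<in> J \<Longrightarrow> i \<le> j \<Longrightarrow> real j - real i \<le> d"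
  shows "real (card J) \<le> d + 1"
proof (cases "J = {}")
  case False
  have "card J \<le> card {Min J..Max J}"
    using assms(1) False by (intro card_mono) auto
  then have "card J \<le> Suc (Max J) - Min J"
    by simp
  moreover have "real (Max J) - real (Min J) \<le> d"
    using assms(1) False by (intro diam) auto
  moreover have "Min J \<le> Max J"
    using assms(1) False by simp
  ultimately have "real (card J) \<le> real (Max J) - real (Min J) + 1" "real (Max J) - real (Min J) \<le> d"
    by linarith+
  then show ?thesis
    by linarith
qed (use assms in simp)

lemma sin_ge_linear:
  assumes "0 \<le> d" "d \<le> pi / 2"
  shows "sin d \<ge> d / 2"
proof -
  have half: "cos d' \<ge> 1 / 2" if "0 \<le> d'" "d' \<le> pi / 3" for d'
    using that cos_monotone_0_pi_le[of d' "pi / 3"] by (simp add: cos_60)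
  show ?thesis
  proof (cases "d \<le> pi / 3")
    case True
    have mvt: "\<exists>z>0. z < d \<and> sin d - sin 0 = (d - 0) * cos z" if "d > 0"
      using that by (intro MVT2) (auto intro!: derivative_eq_intros)
    then show ?thesis
    proof (cases "d > 0")
      case True
      with mvt obtain z where z: "0 < z" "z < d" "sin d = d * cos z"
        by auto
      have "cos z \<ge> 1 / 2"
        using z \<open>d \<le> pi / 3\<close> half[of z] by simp
      then show ?thesis
        using z by (simp add: mult_left_mono[of "1 / 2" "cos z" d, simplified])
    qed (use assms in simp)
  next
    case False
    then have "sin (pi / 3) \<le> sin d"
      using assms by (intro sin_monotone_2pi_le) auto
    moreover have "17 / 10 \<le> sqrt 3"
      by (rule real_le_rsqrt) (simp add: power2_eq_square)
    moreover have "pi / 2 \<le> 17 / 10"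
      using pi_less_4 pi_approx by simp
    ultimately show ?thesis
      using assms by (simp add: sin_60)
  qed
qed

text \<open>
Both bounds come from writing the difference as \<open>2 sin ((\<alpha> + \<beta>) / 2) sin ((\<beta> - \<alpha>) / 2)\<close>. They limit the length of an
arc on which the cosine stays in a short interval: in general by the square root of the length of the interval, and
linearly where the sine is bounded below.
\<close>
lemma cos_diff_lower_bounds:
  assumes "0 \<le> \<alpha>" "\<alpha> \<le> \<beta>" "\<beta> \<le> pi"
  shows "cos \<alpha> - cos \<beta> \<ge> (\<beta> - \<alpha>)\<^sup>2 / 8"
    and "s \<le> sin \<alpha> \<Longrightarrow> s \<le> sin \<beta> \<Longrightarrow> 0 \<le> s \<Longrightarrow> cos \<alpha> - cos \<beta> \<ge> s * (\<beta> - \<alpha>) / 2"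
proof -
  define d where "d = (\<beta> - \<alpha>) / 2"
  define m where "m = (\<alpha> + \<beta>) / 2"
  have d: "0 \<le> d" "d \<le> pi / 2" "d \<le> m" "m \<le> pi - d"
    using assms by (auto simp: d_def m_def field_simps)
  have eq: "cos \<alpha> - cos \<beta> = 2 * sin m * sin d"
    using cos_diff_cos[of \<alpha> \<beta>] by (simp add: m_def d_def)
  have mid: "min (sin u) (sin v) \<le> sin m" if "0 \<le> u" "u \<le> m" "m \<le> v" "v \<le> pi" for u v
  proof (cases "m \<le> pi / 2")
    case True
    then have "sin u \<le> sin m"
      using that by (intro sin_monotone_2pi_le) auto
    then show ?thesis by simp
  next
    case False
    then have "sin (pi - v) \<le> sin (pi - m)"
      using that by (intro sin_monotone_2pi_le) auto
    then show ?thesis by simp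
  qed
  have sd: "sin d \<ge> d / 2"
    using d by (intro sin_ge_linear)
  have "sin m \<ge> sin d"
    using mid[of d "pi - d"] d by simp
  then have "sin m * sin d \<ge> (d / 2) * (d / 2)"
    using sd d by (intro mult_mono) auto
  then show "cos \<alpha> - cos \<beta> \<ge> (\<beta> - \<alpha>)\<^sup>2 / 8"
    unfolding eq by (simp add: d_def power2_eq_square field_simps)
  assume s: "s \<le> sin \<alpha>" "s \<le> sin \<beta>" "0 \<le> s"
  have "sin m \<ge> s"
    using mid[of \<alpha> \<beta>] s assms by (simp add: m_def min_def split: if_splits)
  then have "sin m * sin d \<ge> s * (d / 2)"
    using sd d s by (intro mult_mono) auto
  then show "cos \<alpha> - cos \<beta> \<ge> s * (\<beta> - \<alpha>) / 2"
    unfolding eq by (simp add: d_def field_simps)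
qed

section \<open>From Laplace transforms to expected logarithms\<close>

lemma nondecreasing_le_limit:
  fixes f :: "real \<Rightarrow> real"
  assumes "\<And>x. x \<ge> a \<Longrightarrow> \<exists>y. DERIV f x :> y \<and> y \<ge> 0" and lim: "(f \<longlongrightarrow> L) at_top"
  shows "f a \<le> L"
proof (rule tendsto_lowerbound[OF lim])
  have "f a \<le> f b" if "a \<le> b" for b
  proof (rule DERIV_nonneg_imp_nondecreasing[OF that])
    fix x assume "a \<le> x"
    then show "\<exists>y. DERIV f x :> y \<and> y \<ge> 0"
      by (rule assms(1))
  qed
  then show "eventually (\<lambda>b. f a \<le> f b) at_top"
    by (rule eventually_mono[OF eventually_ge_at_top[of a]])
qed simp

lemma sign_avg_has_integral:
  assumes "\<And>x. x \<in> sign_cube n \<Longrightarrow> (f x has_integral i x) S"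
  shows "((\<lambda>t. sign_avg n (\<lambda>x. f x t)) has_integral sign_avg n i) S"
  unfolding sign_avg_def using assms
  by (intro has_integral_divide has_integral_sum) auto

lemma sign_avg_has_derivative:
  assumes "\<And>x. x \<in> sign_cube n \<Longrightarrow> (f x has_real_derivative f' x) (at y)"
  shows "((\<lambda>y. sign_avg n (\<lambda>x. f x y)) has_real_derivative sign_avg n f') (at y)"
  unfolding sign_avg_def using assms
  by (auto intro!: derivative_eq_intros sum.cong)

lemma sign_avg_tendsto_zero:
  assumes "\<And>x. x \<in> sign_cube n \<Longrightarrow> (f x \<longlongrightarrow> 0) F"
  shows "((\<lambda>y. sign_avg n (\<lambda>x. f x y)) \<longlongrightarrow> 0) F"
  unfolding sign_avg_def using assms by (intro tendsto_divide_zero tendsto_null_sum)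

text \<open>
The factor \<open>1 / (u + y)\<close> is the Laplace transform of \<open>exp (- t u)\<close>; the average is a finite sum and so commutes with the
integral.
\<close>
lemma laplace_inverse:
  fixes u :: "(nat \<Rightarrow> real) \<Rightarrow> real"
  assumes u: "\<And>x. x \<in> sign_cube n \<Longrightarrow> 0 \<le> u x" and "y > 0"
  shows "((\<lambda>t. exp (- y * t) * sign_avg n (\<lambda>x. exp (- t * u x))) has_integral sign_avg n (\<lambda>x. 1 / (u x + y))) {0..}"
proof -
  have "((\<lambda>t. sign_avg n (\<lambda>x. exp (- (u x + y) * t))) has_integral sign_avg n (\<lambda>x. 1 / (u x + y))) {0..}"
  proof (rule sign_avg_has_integral)
    fix x assume "x \<in> sign_cube n"
    then have "u x + y > 0"
      using u assms(2) by force
    then show "((\<lambda>t. exp (- (u x + y) * t)) has_integral 1 / (u x + y)) {0..}"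
      using has_integral_exp_minus_to_infinity[of "u x + y" 0] by simp
  qed
  moreover have "sign_avg n (\<lambda>x. exp (- (u x + y) * t)) = exp (- y * t) * sign_avg n (\<lambda>x. exp (- t * u x))" for t
    unfolding sign_avg_cmult[symmetric]
    by (intro sign_avg_cong) (simp add: algebra_simps flip: exp_add)
  ultimately show ?thesis by simp
qed

text \<open>
The derivative in \<open>y\<close> of the difference of the averages of \<open>ln (u + y)\<close> and \<open>ln (v + y)\<close> is an integral of the difference of
the Laplace transforms, and the difference itself tends to zero as \<open>y\<close> grows. Integrating the bound for the
derivative from \<open>e\<close> to infinity gives the claim.
\<close>
lemma sign_avg_ln_compare:
  fixes u v :: "(nat \<Rightarrow> real) \<Rightarrow> real"
  assumes u: "\<And>x. x \<in> sign_cube n \<Longrightarrow> 0 \<le> u x" and v: "\<And>x. x \<in> sign_cube n \<Longrightarrow> 0 \<le> v x"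
    and AB: "A \<ge> 0" "B \<ge> 0" and e: "e > 0"
    and close: "\<And>t. t \<ge> 0 \<Longrightarrow>
      \<bar>sign_avg n (\<lambda>x. exp (- t * u x)) - sign_avg n (\<lambda>x. exp (- t * v x))\<bar> \<le> A * t\<^sup>2 + B * t"
  shows "\<bar>sign_avg n (\<lambda>x. ln (u x + e)) - sign_avg n (\<lambda>x. ln (v x + e))\<bar> \<le> 8 * A / e\<^sup>2 + 4 * B / e"
proof -
  define h where "h y = sign_avg n (\<lambda>x. ln (u x + y) - ln (v x + y))" for y
  define h' where "h' y = sign_avg n (\<lambda>x. 1 / (u x + y) - 1 / (v x + y))" for y
  \<comment> \<open>up to sign, the antiderivative that vanishes at infinity of the bound for \<open>\<bar>h'\<bar>\<close>\<close>
  define W where "W y = 8 * A / y\<^sup>2 + 4 * B / y" for y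
  define W' where "W' y = - (16 * A / y ^ 3 + 4 * B / y\<^sup>2)" for y
  have bound: "\<bar>h' y\<bar> \<le> - W' y" if y: "y > 0" for y
  proof -
    define g where "g t = exp (- y * t) * sign_avg n (\<lambda>x. exp (- t * u x)) - exp (- y * t) * sign_avg n (\<lambda>x. exp (- t * v x))" for t
    have g: "(g has_integral h' y) {0..}"
      unfolding g_def h'_def sign_avg_diff using u v y by (intro has_integral_diff laplace_inverse)
    \<comment> \<open>half of the exponential decay absorbs the polynomial factors\<close>
    define b where "b t = (8 * A / y\<^sup>2 + 2 * B / y) * exp (- (y / 2) * t)" for t
    have "(b has_integral (8 * A / y\<^sup>2 + 2 * B / y) * (exp (- (y / 2) * 0) / (y / 2))) {0..}"
      unfolding b_def using y by (intro has_integral_mult_right has_integral_exp_minus_to_infinity) auto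
    then have b: "(b has_integral (- W' y)) {0..}"
      using y by (simp add: W'_def field_simps power2_eq_square power3_eq_cube)
    have le: "\<bar>g t\<bar> \<le> b t" if t: "t \<ge> 0" for t
    proof -
      have "\<bar>g t\<bar> = exp (- y * t) * \<bar>sign_avg n (\<lambda>x. exp (- t * u x)) - sign_avg n (\<lambda>x. exp (- t * v x))\<bar>"
        unfolding g_def by (simp add: abs_mult flip: right_diff_distrib)
      also have "\<dots> \<le> exp (- y * t) * (A * t\<^sup>2 + B * t)"
        using close[OF t] by (intro mult_left_mono) auto
      also have "A * t\<^sup>2 + B * t \<le> (8 * A / y\<^sup>2 + 2 * B / y) * exp (y / 2 * t)"
      proof -
        define w where "w = y / 2 * t"
        have w: "w \<ge> 0" "t = 2 * w / y"
          using y t by (auto simp: w_def)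
        have "w \<le> exp w"
          using exp_ge_add_one_self[of w] by linarith
        moreover have "1 + w + w\<^sup>2 / 2 \<le> exp w"
          using w by (intro exp_lower_Taylor_quadratic)
        ultimately have 1: "t \<le> 2 / y * exp w" and ww: "4 * w\<^sup>2 \<le> 8 * exp w"
          using w y by (auto simp: field_simps)
        have "t\<^sup>2 * y\<^sup>2 = 4 * w\<^sup>2"
          using y by (simp add: w_def power_mult_distrib power_divide)
        then have 2: "t\<^sup>2 \<le> 8 / y\<^sup>2 * exp w"
          using ww y by (simp add: field_simps)
        show ?thesis
          using mult_left_mono[OF 2 AB(1)] mult_left_mono[OF 1 AB(2)]
          unfolding w_def[symmetric] by (simp add: algebra_simps)
      qed
      also have "exp (- y * t) * ((8 * A / y\<^sup>2 + 2 * B / y) * exp (y / 2 * t)) = b t"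
      proof -
        have "exp (- y * t) * exp (y / 2 * t) = exp (- (y / 2) * t)"
          by (simp flip: exp_add)
        then show ?thesis
          by (simp add: b_def mult_ac)
      qed
      finally show ?thesis
        by (simp add: mult_left_mono)
    qed
    have "h' y \<le> - W' y"
      using le by (intro has_integral_le[OF g b]) (auto simp: abs_le_iff)
    moreover have "- h' y \<le> - W' y"
      using le by (intro has_integral_le[OF has_integral_neg[OF g] b]) (auto simp: abs_le_iff)
    ultimately show ?thesis by simp
  qed
  have dh: "(h has_real_derivative h' y) (at y)" if y: "y > 0" for y
    unfolding h_def h'_def
  proof (rule sign_avg_has_derivative)
    fix x assume x: "x \<in> sign_cube n"
    then have "u x + y > 0" "v x + y > 0"
      using u[OF x] v[OF x] y by auto
    then show "((\<lambda>y. ln (u x + y) - ln (v x + y)) has_real_derivative 1 / (u x + y) - 1 / (v x + y)) (at y)"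
      by (auto intro!: derivative_eq_intros)
  qed
  have dW: "(W has_real_derivative W' y) (at y)" if y: "y > 0" for y
    unfolding W_def W'_def using y
    by (auto intro!: derivative_eq_intros simp: field_simps power2_eq_square power3_eq_cube)
  have limh: "(h \<longlongrightarrow> 0) at_top"
    unfolding h_def
  proof (rule sign_avg_tendsto_zero)
    have "((\<lambda>y. ln (a + y) - ln (b + y)) \<longlongrightarrow> 0) at_top" for a b :: real
      by real_asymp
    then show "((\<lambda>y. ln (u x + y) - ln (v x + y)) \<longlongrightarrow> 0) at_top" for x .
  qed
  have limW: "(W \<longlongrightarrow> 0) at_top"
    unfolding W_def by real_asymp
  have "h e - W e \<le> 0"
  proof (rule nondecreasing_le_limit[where f = "\<lambda>y. h y - W y"])
    show "((\<lambda>y. h y - W y) \<longlongrightarrow> 0) at_top"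
      using tendsto_diff[OF limh limW] by simp
    fix y assume "e \<le> y"
    then have "y > 0" using e by simp
    then show "\<exists>d. ((\<lambda>y. h y - W y) has_real_derivative d) (at y) \<and> 0 \<le> d"
      using bound[of y] by (intro exI[of _ "h' y - W' y"]) (auto intro!: derivative_intros dh dW simp: abs_le_iff)
  qed
  moreover have "- h e - W e \<le> 0"
  proof (rule nondecreasing_le_limit[where f = "\<lambda>y. - h y - W y"])
    show "((\<lambda>y. - h y - W y) \<longlongrightarrow> 0) at_top"
      using tendsto_diff[OF tendsto_minus[OF limh] limW] by simp
    fix y assume "e \<le> y"
    then have "y > 0" using e by simp
    then show "\<exists>d. ((\<lambda>y. - h y - W y) has_real_derivative d) (at y) \<and> 0 \<le> d"
      using bound[of y] by (intro exI[of _ "- h' y - W' y"]) (auto intro!: derivative_intros dh dW simp: abs_le_iff)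
  qed
  ultimately have "\<bar>h e\<bar> \<le> W e"
    by simp
  then show ?thesis
    by (simp add: h_def W_def sign_avg_diff)
qed

text \<open>
This bounds the expected cost of lowering the regularisation of a logarithm from \<open>e\<close> to \<open>d\<close>. The average of
\<open>1 / (u + y)\<close>, for \<open>y\<close> between \<open>d\<close> and \<open>e\<close>, is at most the Laplace transform of the assumed bound: the term \<open>1 / (1 + t / 3)\<close>
contributes a logarithm and the floor \<open>f\<close> contributes \<open>f / y\<close>.
\<close>
lemma sign_avg_ln_ratio:
  fixes u :: "(nat \<Rightarrow> real) \<Rightarrow> real"
  assumes u: "\<And>x. x \<in> sign_cube n \<Longrightarrow> 0 \<le> u x" and d: "0 < d" "d \<le> e" and f: "f \<ge> 0"
    and small: "\<And>t. t \<ge> 0 \<Longrightarrow> sign_avg n (\<lambda>x. exp (- t * u x)) \<le> 1 / (1 + t / 3) + f"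
  shows "sign_avg n (\<lambda>x. ln ((u x + e) / (u x + d))) \<le> f * ln (e / d) + (3 * ln (1 + 1 / (3 * d)) + 3) * e"
proof -
  define L where "L = 3 * ln (1 + 1 / (3 * d)) + 3"
  have L: "L \<ge> 0"
    using d by (simp add: L_def ln_ge_zero)
  have bound: "sign_avg n (\<lambda>x. 1 / (u x + y)) \<le> f / y + L" if y: "y \<ge> d" for y
  proof -
    have y0: "y > 0" using y d by simp
    \<comment> \<open>up to time \<open>1 / y\<close> the exponential factor is dropped, afterwards \<open>1 / (1 + t / 3)\<close> is at most \<open>3 y\<close>\<close>
    define g where "g t = (if t \<le> 1 / y then 1 / (1 + t / 3) else 3 * y * exp (- y * t))" for t
    have "((\<lambda>t. 1 / (1 + t / 3)) has_integral 3 * ln (1 + 1 / y / 3) - 3 * ln (1 + 0 / 3)) {0..1 / y}"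
    proof (intro fundamental_theorem_of_calculus)
      fix t assume "t \<in> {0..1 / y}"
      then have "1 + t / 3 > 0" by simp
      then have "((\<lambda>t. 3 * ln (1 + t / 3)) has_real_derivative 3 * ((1 / 3) / (1 + t / 3))) (at t within {0..1 / y})"
        by (auto intro!: derivative_eq_intros)
      moreover have "3 * ((1 / 3) / s) = 1 / s" for s :: real
        by simp
      ultimately show "((\<lambda>t. 3 * ln (1 + t / 3)) has_vector_derivative 1 / (1 + t / 3)) (at t within {0..1 / y})"
        by (simp only: has_real_derivative_iff_has_vector_derivative)
    qed (use y0 in auto)
    then have g1: "(g has_integral 3 * ln (1 + 1 / y / 3)) {0..1 / y}"
      by (subst has_integral_cong[where g = "\<lambda>t. 1 / (1 + t / 3)"]) (auto simp: g_def)
    have "((\<lambda>t. 3 * y * exp (- y * t)) has_integral 3 * y * (exp (- y * (1 / y)) / y)) {1 / y..}"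
      using y0 by (intro has_integral_mult_right has_integral_exp_minus_to_infinity)
    then have g2: "(g has_integral 3 * y * (exp (- y * (1 / y)) / y)) {1 / y..}"
      by (rule has_integral_spike[of "{1 / y}", rotated 2]) (auto simp: g_def)
    have "(g has_integral 3 * ln (1 + 1 / y / 3) + 3 * y * (exp (- y * (1 / y)) / y)) ({0..1 / y} \<union> {1 / y..})"
    proof (rule has_integral_Un[OF g1 g2])
      have "{0..1 / y} \<inter> {1 / y..} = {1 / y}"
        using y0 by auto
      then show "negligible ({0..1 / y} \<inter> {1 / y..})" by simp
    qed
    moreover have "{0..1 / y} \<union> {1 / y..} = {0..}"
    proof -
      have "{0..c} \<union> {c..} = {0..}" if "0 \<le> c" for c :: real
        using that by auto
      moreover have "0 \<le> 1 / y"
        using y0 by simp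
      ultimately show ?thesis
        by blast
    qed
    ultimately have g: "(g has_integral 3 * ln (1 + 1 / y / 3) + 3 * exp (- 1)) {0..}"
      using y0 by simp
    have ef: "((\<lambda>t. f * exp (- y * t)) has_integral f * (exp (- y * 0) / y)) {0..}"
      using y0 by (intro has_integral_mult_right has_integral_exp_minus_to_infinity)
    have "sign_avg n (\<lambda>x. 1 / (u x + y)) \<le> 3 * ln (1 + 1 / y / 3) + 3 * exp (- 1) + f * (exp (- y * 0) / y)"
    proof (rule has_integral_le[OF laplace_inverse[OF u y0] has_integral_add[OF g ef]])
      fix t :: real assume "t \<in> {0..}"
      then have t: "t \<ge> 0" by simp
      have "exp (- y * t) * sign_avg n (\<lambda>x. exp (- t * u x)) \<le> exp (- y * t) * (1 / (1 + t / 3) + f)"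
        using small[OF t] by (intro mult_left_mono) auto
      also have "\<dots> = exp (- y * t) * (1 / (1 + t / 3)) + f * exp (- y * t)"
        by (simp only: distrib_left mult.commute[of f])
      also have "exp (- y * t) * (1 / (1 + t / 3)) \<le> g t"
      proof (cases "t \<le> 1 / y")
        case True
        have "exp (- y * t) * (1 / (1 + t / 3)) \<le> 1 * (1 / (1 + t / 3))"
          using y0 t by (intro mult_right_mono) auto
        then show ?thesis using True by (simp add: g_def)
      next
        case False
        have "1 / y > 0"
          using y0 by simp
        then have t0: "t > 0"
          using False by linarith
        then have "1 / (1 + t / 3) \<le> 3 / t"
          by (simp add: field_simps)
        also have "\<dots> \<le> 3 * y"
          using False y0 t0 by (simp add: field_simps)
        finally have "exp (- y * t) * (1 / (1 + t / 3)) \<le> exp (- y * t) * (3 * y)"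
          by (intro mult_left_mono) auto
        then show ?thesis using False by (simp add: g_def mult_ac)
      qed
      finally show "exp (- y * t) * sign_avg n (\<lambda>x. exp (- t * u x)) \<le> g t + f * exp (- y * t)"
        by simp
    qed
    moreover have "ln (1 + 1 / y / 3) \<le> ln (1 + 1 / (3 * d))"
      using y d by (intro ln_mono) (auto simp: field_simps add_pos_pos)
    moreover have "exp (- 1 :: real) \<le> 1" by simp
    moreover have "f * (exp (- y * 0) / y) = f / y" by simp
    ultimately show ?thesis
      unfolding L_def by linarith
  qed
  define K where "K y = sign_avg n (\<lambda>x. ln (u x + y)) - f * ln y - L * y" for y
  have "K d \<ge> K e"
  proof (rule DERIV_nonpos_imp_nonincreasing[OF d(2)])
    fix y assume y: "d \<le> y" "y \<le> e"
    have "((\<lambda>y. sign_avg n (\<lambda>x. ln (u x + y))) has_real_derivative sign_avg n (\<lambda>x. 1 / (u x + y))) (at y)"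
    proof (rule sign_avg_has_derivative)
      fix x assume "x \<in> sign_cube n"
      then have "u x + y > 0"
        using u[of x] y d by auto
      then show "((\<lambda>y. ln (u x + y)) has_real_derivative 1 / (u x + y)) (at y)"
        by (auto intro!: derivative_eq_intros)
    qed
    then have "(K has_real_derivative sign_avg n (\<lambda>x. 1 / (u x + y)) - f / y - L) (at y)"
      unfolding K_def using y d by (auto intro!: derivative_eq_intros)
    then show "\<exists>z. (K has_real_derivative z) (at y) \<and> z \<le> 0"
      using bound[OF y(1)] by (intro exI) auto
  qed
  moreover have ratio: "sign_avg n (\<lambda>x. ln ((u x + e) / (u x + d))) = sign_avg n (\<lambda>x. ln (u x + e)) - sign_avg n (\<lambda>x. ln (u x + d))"
    unfolding sign_avg_diff[symmetric]
  proof (intro sign_avg_cong)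
    fix x assume "x \<in> sign_cube n"
    then have "u x + e > 0" "u x + d > 0"
      using u[of x] d by auto
    then show "ln ((u x + e) / (u x + d)) = ln (u x + e) - ln (u x + d)"
      by (simp add: ln_div)
  qed
  moreover have "L * d \<ge> 0" using L d by simp
  moreover have "f * ln (e / d) = f * ln e - f * ln d"
    using d by (simp add: ln_div right_diff_distrib)
  ultimately show ?thesis
    unfolding ratio K_def L_def[symmetric] by linarith
qed

section \<open>Fourier analysis on the roots of unity\<close>

definition grid :: "nat \<Rightarrow> nat \<Rightarrow> complex" where
  "grid N j = cis (2 * pi * real j / real N)"

lemma norm_grid [simp]: "cmod (grid N j) = 1"
  by (simp add: grid_def)

lemma grid_power: "grid N j ^ k = cis (2 * pi * real j * real k / real N)"
  unfolding grid_def Complex.DeMoivre by (simp add: mult_ac)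

lemma sum_cis_grid:
  assumes "d \<noteq> 0" "\<bar>d\<bar> < int N"
  shows "(\<Sum>j<N. cis (2 * pi * of_int d / real N) ^ j) = 0"
proof -
  define z where "z = cis (2 * pi * of_int d / real N)"
  have N: "N > 0" using assms by simp
  have "z \<noteq> 1"
  proof
    assume "z = 1"
    then have "cos (2 * pi * of_int d / real N) = 1"
      by (simp add: z_def complex_eq_iff)
    then obtain m :: int where "2 * pi * of_int d / real N = of_int m * 2 * pi"
      by (auto simp: cos_one_2pi_int)
    then have "real_of_int d = of_int (m * int N)"
      using N by (simp add: field_simps)
    then have "d = m * int N"
      by (simp only: of_int_eq_iff)
    then show False
      using assms by (auto simp: abs_mult)
  qed
  moreover have "z ^ N = 1"
  proof -
    have "real N * (2 * pi * of_int d / real N) = 2 * pi * of_int d"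
      using N by simp
    moreover have "z ^ N = cis (real N * (2 * pi * of_int d / real N))"
      unfolding z_def by (rule Complex.DeMoivre)
    ultimately have "z ^ N = cis (2 * pi * of_int d)"
      by (simp only:)
    then show ?thesis
      by (simp add: cis_multiple_2pi)
  qed
  ultimately show ?thesis
    by (simp add: z_def[symmetric] sum_gp_strict)
qed

lemma grid_orthogonal:
  assumes "k < N" "l < N"
  shows "(\<Sum>j<N. grid N j ^ k * cnj (grid N j ^ l)) = (if k = l then of_nat N else 0)"
proof (cases "k = l")
  case True
  then show ?thesis
    by (simp add: complex_norm_square[symmetric] norm_power del: complex_cnj_power)
next
  case False
  have "grid N j ^ k * cnj (grid N j ^ l) = cis (2 * pi * of_int (int k - int l) / real N) ^ j" for j
    by (simp add: grid_power Complex.DeMoivre cis_cnj cis_mult diff_divide_distrib algebra_simps)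
  then show ?thesis
    using False sum_cis_grid[of "int k - int l" N] assms by simp
qed

lemma grid_parseval:
  fixes n :: nat
  assumes "\<And>k. k < n \<Longrightarrow> e k < N" "inj_on e {..<n}"
  shows "(\<Sum>j<N. (cmod (\<Sum>k<n. b k * grid N j ^ e k))\<^sup>2) = real N * (\<Sum>k<n. (cmod (b k))\<^sup>2)"
proof -
  have "complex_of_real (\<Sum>j<N. (cmod (\<Sum>k<n. b k * grid N j ^ e k))\<^sup>2)
     = (\<Sum>j<N. (\<Sum>k<n. b k * grid N j ^ e k) * cnj (\<Sum>k<n. b k * grid N j ^ e k))"
    by (simp only: of_real_sum complex_norm_square)
  also have "\<dots> = (\<Sum>j<N. \<Sum>k<n. \<Sum>l<n. b k * cnj (b l) * (grid N j ^ e k * cnj (grid N j ^ e l)))"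
    by (simp add: sum_product mult_ac)
  also have "\<dots> = (\<Sum>k<n. \<Sum>l<n. b k * cnj (b l) * (\<Sum>j<N. grid N j ^ e k * cnj (grid N j ^ e l)))"
    by (subst sum.swap, rule sum.cong[OF refl], subst sum.swap) (simp add: sum_distrib_left)
  also have "\<dots> = (\<Sum>k<n. \<Sum>l<n. if l = k then b k * cnj (b l) * of_nat N else 0)"
    using assms by (intro sum.cong refl) (auto simp: grid_orthogonal inj_on_eq_iff simp del: complex_cnj_power)
  also have "\<dots> = (\<Sum>k<n. of_nat N * (b k * cnj (b k)))"
  proof (rule sum.cong[OF refl])
    fix k assume "k \<in> {..<n}"
    then have "(\<Sum>l<n. if l = k then b k * cnj (b l) * of_nat N else 0) = (\<Sum>l\<in>{k}. b k * cnj (b l) * of_nat N)"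
      by (intro sum.mono_neutral_cong_right) auto
    then show "(\<Sum>l<n. if l = k then b k * cnj (b l) * of_nat N else 0) = of_nat N * (b k * cnj (b k))"
      by simp
  qed
  also have "\<dots> = complex_of_real (real N * (\<Sum>k<n. (cmod (b k))\<^sup>2))"
    by (simp add: complex_norm_square sum_distrib_left del: of_real_power)
  finally show ?thesis
    by (simp only: of_real_eq_iff)
qed

lemma grid_bessel:
  assumes "n \<le> N" "N > 0"
  shows "(\<Sum>k<n. (cmod ((\<Sum>j<N. F j * cnj (grid N j ^ k)) / of_nat N))\<^sup>2) \<le> (\<Sum>j<N. (cmod (F j))\<^sup>2) / real N"
proof -
  define b where "b k = (\<Sum>j<N. F j * cnj (grid N j ^ k)) / of_nat N" for k
  define G where "G j = (\<Sum>k<n. b k * grid N j ^ k)" for j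
  have GG: "(\<Sum>j<N. (cmod (G j))\<^sup>2) = real N * (\<Sum>k<n. (cmod (b k))\<^sup>2)"
    unfolding G_def using assms by (intro grid_parseval) auto
  have "(\<Sum>j<N. F j * cnj (G j)) = (\<Sum>k<n. cnj (b k) * (\<Sum>j<N. F j * cnj (grid N j ^ k)))"
    unfolding G_def cnj_sum complex_cnj_mult sum_distrib_left
    by (subst sum.swap) (simp add: mult_ac)
  also have "\<dots> = (\<Sum>k<n. cnj (b k) * (of_nat N * b k))"
    using assms by (simp add: b_def)
  also have "\<dots> = complex_of_real (real N * (\<Sum>k<n. (cmod (b k))\<^sup>2))"
    by (simp add: complex_norm_square sum_distrib_left mult_ac del: of_real_power)
  finally have FG: "Re (\<Sum>j<N. F j * cnj (G j)) = real N * (\<Sum>k<n. (cmod (b k))\<^sup>2)"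
    by simp
  have "0 \<le> (\<Sum>j<N. (cmod (F j - G j))\<^sup>2)"
    by (intro sum_nonneg) auto
  also have "\<dots> = (\<Sum>j<N. (cmod (F j))\<^sup>2 + (cmod (G j))\<^sup>2 - 2 * Re (F j * cnj (G j)))"
    by (intro sum.cong refl) (simp only: cmod_power2, simp add: power2_eq_square algebra_simps)
  also have "\<dots> = (\<Sum>j<N. (cmod (F j))\<^sup>2) - real N * (\<Sum>k<n. (cmod (b k))\<^sup>2)"
    using FG by (simp add: sum.distrib sum_subtractf GG flip: sum_distrib_left)
  finally show ?thesis
    using assms by (simp add: b_def field_simps)
qed

lemma grid_inj: "inj_on (grid N) {..<N}"
proof (rule inj_onI)
  fix i j assume ij: "i \<in> {..<N}" "j \<in> {..<N}" "grid N i = grid N j"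
  have "cis (2 * pi * of_int (int i - int j) / real N) = grid N i / grid N j"
    by (simp add: grid_def cis_divide algebra_simps diff_divide_distrib)
  then have *: "cis (2 * pi * of_int (int i - int j) / real N) = 1"
    using ij norm_grid[of N j] by (metis divide_self norm_zero zero_neq_one)
  show "i = j"
  proof (rule ccontr)
    assume "i \<noteq> j"
    then have "(\<Sum>k<N. cis (2 * pi * of_int (int i - int j) / real N) ^ k) = 0"
      using ij by (intro sum_cis_grid) auto
    then show False
      using * ij by simp
  qed
qed

lemma grid_power_N: "N > 0 \<Longrightarrow> grid N j ^ N = 1"
  by (simp add: grid_power)

text \<open>
Both sides are polynomials in \<open>x\<close> of degree at most \<open>N\<close> that agree at zero and at the inverses of the
\<open>N\<close>-th roots of unity.
\<close>
lemma grid_prod: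
  assumes "N > 0"
  shows "(\<Prod>j<N. 1 - x * grid N j) = 1 - x ^ N"
proof -
  define p where "p = (\<Prod>j<N. [:1, - grid N j:])"
  define q :: "complex poly" where "q = 1 - monom 1 N"
  have g0: "grid N j \<noteq> 0" for j
    using norm_grid[of N j] by force
  have "p = q"
  proof (rule poly_eqI_degree)
    define A where "A = insert 0 ((\<lambda>j. inverse (grid N j)) ` {..<N})"
    have "card ((\<lambda>j. inverse (grid N j)) ` {..<N}) = N"
      using grid_inj[of N] by (subst card_image) (auto simp: inj_on_def)
    then have card: "card A = Suc N"
      using g0 by (auto simp: A_def card_insert_if)
    show "poly p x = poly q x" if xA: "x \<in> A" for x
    proof (cases "x = 0")
      case True
      then show ?thesis
        using assms by (simp add: p_def q_def poly_prod poly_monom)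
    next
      case False
      then obtain j where j: "j < N" "x = inverse (grid N j)"
        using xA by (auto simp: A_def)
      have "poly p x = 0"
        using j g0 by (auto simp: p_def poly_prod prod_zero_iff intro!: bexI[of _ j])
      moreover have "poly q x = 0"
        using j assms by (simp add: q_def poly_monom power_inverse grid_power_N)
      ultimately show ?thesis by simp
    qed
    have "degree p \<le> N"
      unfolding p_def using degree_prod_sum_le[of "{..<N}" "\<lambda>j. [:1, - grid N j:]"] by (simp add: g0)
    then show "degree p < card A"
      using card by simp
    have "degree q \<le> N"
      unfolding q_def by (intro degree_diff_le degree_monom_le) auto
    then show "degree q < card A"
      using card by simp
  qed
  then have "poly p x = poly q x" by simp
  then show ?thesis
    by (simp add: p_def q_def poly_prod poly_monom)
qed

section \<open>Concentration of regularised logarithmic means\<close>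

text \<open>
A first-order expansion with a remainder uniform in \<open>z\<close>. The bounds \<open>1 - 1 / w \<le> ln w \<le> w - 1\<close> reduce it to
algebra, the denominators being at least \<open>e\<close>.
\<close>
lemma ln_norm_square_taylor:
  fixes z h :: complex
  assumes e: "e > 0"
  shows "\<bar>ln ((cmod (z + h))\<^sup>2 + e) / 2 - ln ((cmod z)\<^sup>2 + e) / 2 - Re (cnj h * z) / ((cmod z)\<^sup>2 + e)\<bar> \<le> 2 * (cmod h)\<^sup>2 / e"
proof -
  define D where "D = (cmod z)\<^sup>2 + e"
  define D' where "D' = (cmod (z + h))\<^sup>2 + e"
  define t where "t = Re (cnj h * z)"
  define H where "H = (cmod h)\<^sup>2"
  have D: "D \<ge> e" "D' \<ge> e" "D > 0" "D' > 0"
    using e by (auto simp: D_def D'_def add_nonneg_pos)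
  have H: "H \<ge> 0" by (simp add: H_def)
  have D'eq: "D' = D + (2 * t + H)"
    unfolding D_def D'_def t_def H_def cmod_power2 by (simp add: power2_eq_square algebra_simps)
  have HD: "H / D \<le> H / e" "H / D' \<le> H / e"
    using D H e by (auto intro!: divide_left_mono)
  have "ln D' - ln D = ln (D' / D)"
    using D by (simp add: ln_div)
  also have "\<dots> \<le> D' / D - 1"
    using D by (intro ln_le_minus_one) auto
  also have "\<dots> = 2 * (t / D) + H / D"
    using D by (simp add: D'eq field_simps)
  finally have up0: "ln D' - ln D \<le> 2 * (t / D) + H / D" .
  have up: "ln D' / 2 - ln D / 2 - t / D \<le> H / e"
  proof -
    have "0 \<le> H / e"
      using H e by simp
    then show ?thesis
      using HD up0 by linarith
  qed
  have "ln D - ln D' = ln (D / D')"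
    using D by (simp add: ln_div)
  also have "\<dots> \<le> D / D' - 1"
    using D by (intro ln_le_minus_one) auto
  also have "\<dots> = - (2 * t + H) / D'"
    using D by (simp add: D'eq field_simps)
  also have "\<dots> = - ((2 * t + H) / D')"
    by (simp only: minus_divide_left)
  finally have lo0: "ln D - ln D' \<le> - ((2 * t + H) / D')" .
  have "y / 2 \<le> u / 2 - v / 2" if "v - u \<le> - y" for u v y :: real
    using that by simp
  from this[OF lo0] have lo1: "ln D' / 2 - ln D / 2 \<ge> (2 * t + H) / D' / 2" .
  have "t * (2 * t + H) / (D * D') \<le> 2 * (H / e)"
  proof -
    have "\<bar>t\<bar> \<le> cmod h * cmod z"
      unfolding t_def using abs_Re_le_cmod[of "cnj h * z"] by (simp add: norm_mult)
    moreover have "2 * t + H = Re (cnj h * (z + (z + h)))"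
      unfolding t_def H_def cmod_power2 by (simp add: power2_eq_square algebra_simps)
    then have "\<bar>2 * t + H\<bar> \<le> cmod h * cmod (z + (z + h))"
      using abs_Re_le_cmod[of "cnj h * (z + (z + h))"] by (simp add: norm_mult)
    then have "\<bar>2 * t + H\<bar> \<le> cmod h * (cmod z + cmod (z + h))"
      using norm_triangle_ineq[of z "z + h"] mult_left_mono[of "cmod (z + (z + h))" "cmod z + cmod (z + h)" "cmod h"]
      by simp
    ultimately have "\<bar>t\<bar> * \<bar>2 * t + H\<bar> \<le> (cmod h * cmod z) * (cmod h * (cmod z + cmod (z + h)))"
      by (intro mult_mono) auto
    also have "\<dots> = H * ((cmod z)\<^sup>2 + cmod z * cmod (z + h))"
      by (simp add: H_def power2_eq_square algebra_simps)
    also have "\<dots> \<le> H * (D + (D + D') / 2)"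
    proof (intro mult_left_mono add_mono)
      show "cmod z * cmod (z + h) \<le> (D + D') / 2"
        using zero_le_power2[of "cmod z - cmod (z + h)"] e unfolding D_def D'_def power2_diff by simp
    qed (use e H in \<open>auto simp: D_def\<close>)
    finally have "t * (2 * t + H) \<le> H * (D + (D + D') / 2)"
      by (simp add: abs_mult[symmetric])
    then have "t * (2 * t + H) / (D * D') \<le> H * (D + (D + D') / 2) / (D * D')"
      using D by (intro divide_right_mono) auto
    also have "\<dots> = H / D' + (H / D' + H / D) / 2"
      using D by (simp add: field_simps)
    also have "\<dots> \<le> 2 * (H / e)"
    proof -
      have "x + (x + y) / 2 \<le> 2 * v" if "y \<le> v" "x \<le> v" for x y v :: real
        using that by (simp add: field_simps)
      from this[OF HD] show ?thesis .
    qed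
    finally show ?thesis .
  qed
  moreover have "(2 * t + H) / D' / 2 - t / D = H / (2 * D') - t * (2 * t + H) / (D * D')"
  proof -
    have "w / D' / 2 - t / D = (w - 2 * t) / (2 * D') - t * (D' - D) / (D * D')" for w
      using D by (simp add: field_simps)
    from this[of "2 * t + H"] show ?thesis
      using D'eq by simp
  qed
  moreover have "H / (2 * D') \<ge> 0"
    using H D by simp
  ultimately have "ln D' / 2 - ln D / 2 - t / D \<ge> - (2 * (H / e))"
    using lo1 by linarith
  with up show ?thesis
    unfolding D_def D'_def t_def H_def using e by (simp add: abs_le_iff)
qed

definition random_sum :: "nat \<Rightarrow> (nat \<Rightarrow> complex) \<Rightarrow> (nat \<Rightarrow> real) \<Rightarrow> complex" where
  "random_sum n a x = (\<Sum>k<n. x k *\<^sub>R a k)"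

lemma random_sum_flip:
  assumes "k < n"
  shows "random_sum n a (flip k x) = random_sum n a x + (- 2 * x k) *\<^sub>R a k"
proof -
  have "random_sum n a (flip k x) = (\<Sum>i<n. x i *\<^sub>R a i + (if i = k then (- 2 * x k) *\<^sub>R a k else 0))"
    unfolding random_sum_def by (intro sum.cong refl) (auto simp: flip_def scaleR_conv_of_real)
  then show ?thesis
    using assms by (simp add: sum.distrib random_sum_def)
qed

text \<open>
By \<open>ln_norm_square_taylor\<close>, flipping the \<open>k\<close>-th sign changes \<open>f\<close> to first order by \<open>a k\<close> times the \<open>k\<close>-th
Fourier coefficient of the function \<open>F = Z / (\<bar>Z\<bar>\<^sup>2 + e)\<close>, which is bounded by \<open>1 / (2 sqrt e)\<close>. Bessel's inequality
bounds the sum over \<open>k\<close> of the squares of these coefficients without a factor \<open>n\<close>; only the quadratic remainders are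
summed trivially.
\<close>
lemma grid_log_average_variance:
  fixes a :: "nat \<Rightarrow> real"
  assumes N: "n \<le> N" "N > 0" and e: "e > 0" and \<kappa>: "\<And>k. k < n \<Longrightarrow> (a k)\<^sup>2 \<le> \<kappa>" "\<kappa> \<ge> 0"
  defines "Z \<equiv> \<lambda>j. random_sum n (\<lambda>k. of_real (a k) * grid N j ^ k)"
  defines "f \<equiv> \<lambda>x. (\<Sum>j<N. ln ((cmod (Z j x))\<^sup>2 + e) / 2) / real N"
  shows "sign_avg n (\<lambda>x. (f x - sign_avg n f)\<^sup>2) \<le> \<kappa> / (2 * e) + 32 * real n * \<kappa>\<^sup>2 / e\<^sup>2"
proof -
  have var: "(\<Sum>k<n. (f x - f (flip k x))\<^sup>2) \<le> 2 * \<kappa> / e + 128 * real n * \<kappa>\<^sup>2 / e\<^sup>2"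
    if x: "x \<in> sign_cube n" for x
  proof -
    define F where "F j = Z j x / of_real ((cmod (Z j x))\<^sup>2 + e)" for j
    define b where "b k = (\<Sum>j<N. F j * cnj (grid N j ^ k)) / of_nat N" for k
    have Fle: "(cmod (F j))\<^sup>2 \<le> 1 / (4 * e)" for j
    proof -
      define y where "y = (cmod (Z j x))\<^sup>2"
      have y: "y \<ge> 0" "y + e > 0" using e by (auto simp: y_def add_nonneg_pos)
      have "4 * (y * e) \<le> (y + e)\<^sup>2"
        using zero_le_power2[of "y - e"] by (simp add: power2_eq_square algebra_simps)
      then have "y / (y + e)\<^sup>2 \<le> 1 / (4 * e)"
        using e y by (simp add: field_simps)
      moreover have "(cmod (F j))\<^sup>2 = y / (y + e)\<^sup>2"
        using y by (simp add: F_def norm_divide power_divide y_def[symmetric] del: of_real_add of_real_power)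
      ultimately show ?thesis by simp
    qed
    have "(\<Sum>k<n. (cmod (b k))\<^sup>2) \<le> (\<Sum>j<N. (cmod (F j))\<^sup>2) / real N"
      unfolding b_def by (rule grid_bessel[OF N])
    also have "\<dots> \<le> (\<Sum>j<N. 1 / (4 * e)) / real N"
      by (intro divide_right_mono sum_mono Fle) auto
    also have "\<dots> = 1 / (4 * e)"
      using N by simp
    finally have bessel: "(\<Sum>k<n. (cmod (b k))\<^sup>2) \<le> 1 / (4 * e)" .
    have diff: "\<bar>f x - f (flip k x)\<bar> \<le> 2 * \<bar>a k\<bar> * cmod (b k) + 8 * (a k)\<^sup>2 / e" if k: "k < n" for k
    proof -
      have xk: "\<bar>x k\<bar> = 1"
        using x k by (rule sign_cube_abs)
      define h where "h j = (- 2 * x k) *\<^sub>R (of_real (a k) * grid N j ^ k)" for j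
      have Zf: "Z j (flip k x) = Z j x + h j" for j
        unfolding Z_def h_def by (rule random_sum_flip[OF k])
      have nh: "(cmod (h j))\<^sup>2 = 4 * (a k)\<^sup>2" for j
        using xk by (simp add: h_def norm_mult norm_power power_mult_distrib abs_mult)
      define R where "R j = ln ((cmod (Z j (flip k x)))\<^sup>2 + e) / 2 - ln ((cmod (Z j x))\<^sup>2 + e) / 2 - Re (cnj (h j) * F j)" for j
      have R: "\<bar>R j\<bar> \<le> 8 * (a k)\<^sup>2 / e" for j
      proof -
        have "Re (cnj (h j) * F j) = Re (cnj (h j) * Z j x) / ((cmod (Z j x))\<^sup>2 + e)"
          unfolding F_def times_divide_eq_right by (rule Re_divide_of_real)
        then show ?thesis
          using ln_norm_square_taylor[OF e, of "Z j x" "h j"] by (simp add: R_def Zf nh)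
      qed
      have "(\<Sum>j<N. Re (cnj (h j) * F j)) = Re (\<Sum>j<N. (- 2 * x k * a k) *\<^sub>R (F j * cnj (grid N j ^ k)))"
        unfolding Re_sum h_def by (intro sum.cong refl arg_cong[of _ _ Re]) (simp add: scaleR_conv_of_real mult_ac)
      also have "\<dots> = real N * (- 2 * x k * a k * Re (b k))"
      proof -
        have "(\<Sum>j<N. F j * cnj (grid N j ^ k)) = of_real (real N) * b k"
          using N by (simp add: b_def)
        then show ?thesis
          unfolding scaleR_sum_right[symmetric] by simp
      qed
      finally have main: "(\<Sum>j<N. Re (cnj (h j) * F j)) = real N * (- 2 * x k * a k * Re (b k))" .
      have "f (flip k x) - f x = (\<Sum>j<N. Re (cnj (h j) * F j) + R j) / real N"
        unfolding f_def R_def by (simp add: sum_subtractf sum.distrib diff_divide_distrib)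
      also have "\<dots> = - 2 * x k * a k * Re (b k) + (\<Sum>j<N. R j) / real N"
        unfolding sum.distrib main using N by (simp add: field_simps)
      finally have eq: "f (flip k x) - f x = - 2 * x k * a k * Re (b k) + (\<Sum>j<N. R j) / real N" .
      have "\<bar>\<Sum>j<N. R j\<bar> \<le> (\<Sum>j<N. 8 * (a k)\<^sup>2 / e)"
        by (rule order_trans[OF sum_abs]) (intro sum_mono R)
      then have "\<bar>(\<Sum>j<N. R j) / real N\<bar> \<le> 8 * (a k)\<^sup>2 / e"
        using N by (simp add: field_simps)
      moreover have "\<bar>- 2 * x k * a k * Re (b k)\<bar> \<le> 2 * \<bar>a k\<bar> * cmod (b k)"
        using xk abs_Re_le_cmod[of "b k"] by (simp add: abs_mult mult_left_mono)
      ultimately show ?thesis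
        using eq by linarith
    qed
    have "(\<Sum>k<n. (f x - f (flip k x))\<^sup>2) \<le> (\<Sum>k<n. 8 * \<kappa> * (cmod (b k))\<^sup>2 + 128 * \<kappa>\<^sup>2 / e\<^sup>2)"
    proof (rule sum_mono)
      fix k assume "k \<in> {..<n}"
      then have k: "k < n" by simp
      have "(f x - f (flip k x))\<^sup>2 \<le> (2 * \<bar>a k\<bar> * cmod (b k) + 8 * (a k)\<^sup>2 / e)\<^sup>2"
        using power_mono[OF diff[OF k], of 2] by simp
      also have "\<dots> \<le> 2 * (2 * \<bar>a k\<bar> * cmod (b k))\<^sup>2 + 2 * (8 * (a k)\<^sup>2 / e)\<^sup>2"
        using sum_squares_bound[of "2 * \<bar>a k\<bar> * cmod (b k)" "8 * (a k)\<^sup>2 / e"] by (simp add: power2_sum)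
      also have "\<dots> = 8 * (a k)\<^sup>2 * (cmod (b k))\<^sup>2 + 128 * ((a k)\<^sup>2)\<^sup>2 / e\<^sup>2"
        by (simp add: power_mult_distrib power_divide)
      also have "\<dots> \<le> 8 * \<kappa> * (cmod (b k))\<^sup>2 + 128 * \<kappa>\<^sup>2 / e\<^sup>2"
        using \<kappa>(1)[OF k] by (intro add_mono mult_right_mono divide_right_mono mult_left_mono power_mono) auto
      finally show "(f x - f (flip k x))\<^sup>2 \<le> 8 * \<kappa> * (cmod (b k))\<^sup>2 + 128 * \<kappa>\<^sup>2 / e\<^sup>2" .
    qed
    also have "\<dots> = 8 * \<kappa> * (\<Sum>k<n. (cmod (b k))\<^sup>2) + 128 * real n * \<kappa>\<^sup>2 / e\<^sup>2"
      by (simp add: sum.distrib sum_distrib_left)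
    also have "\<dots> \<le> 8 * \<kappa> * (1 / (4 * e)) + 128 * real n * \<kappa>\<^sup>2 / e\<^sup>2"
      using bessel \<kappa>(2) by (intro add_mono mult_left_mono) auto
    finally show ?thesis
      by simp
  qed
  have "sign_avg n (\<lambda>x. (f x - sign_avg n f)\<^sup>2) \<le> sign_avg n (\<lambda>x. \<Sum>k<n. (f x - f (flip k x))\<^sup>2) / 4"
    by (rule efron_stein)
  also have "\<dots> \<le> sign_avg n (\<lambda>_. 2 * \<kappa> / e + 128 * real n * \<kappa>\<^sup>2 / e\<^sup>2) / 4"
    using var by (intro divide_right_mono sign_avg_mono) auto
  finally show ?thesis
    by simp
qed

section \<open>Counting roots by logarithmic means over a grid\<close>

text \<open>
The factorisation \<open>A - B cos \<theta> = c \<bar>1 - q exp (i \<theta>)\<bar>\<^sup>2\<close> of a positive trigonometric polynomial.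
\<close>
lemma quadratic_factor:
  fixes A B :: real
  assumes "0 \<le> B" "B < A"
  defines "c \<equiv> (A + sqrt (A\<^sup>2 - B\<^sup>2)) / 2"
  defines "q \<equiv> B / (2 * c)"
  shows "c > 0" "c * (1 + q\<^sup>2) = A" "2 * c * q = B" "0 \<le> q" "q < 1" "A / 2 \<le> c"
proof -
  have sq: "B\<^sup>2 \<le> A\<^sup>2"
    using assms by (intro power_mono) auto
  then have s: "(sqrt (A\<^sup>2 - B\<^sup>2))\<^sup>2 = A\<^sup>2 - B\<^sup>2" "sqrt (A\<^sup>2 - B\<^sup>2) \<ge> 0"
    by simp_all
  show c: "c > 0" "A / 2 \<le> c"
    using s(2) assms(1,2) add_pos_nonneg[of A "sqrt (A\<^sup>2 - B\<^sup>2)"] unfolding c_def by auto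
  show "2 * c * q = B"
    using c by (simp add: q_def)
  have "2 * c - A = sqrt (A\<^sup>2 - B\<^sup>2)"
    by (simp add: c_def field_simps)
  then have "(2 * c - A)\<^sup>2 = A\<^sup>2 - B\<^sup>2"
    using s(1) by simp
  then have "4 * c\<^sup>2 + B\<^sup>2 = 4 * c * A"
    by (simp add: power2_eq_square algebra_simps)
  then show "c * (1 + q\<^sup>2) = A"
    using c by (simp add: q_def field_simps power2_eq_square)
  show "0 \<le> q"
    using c assms(1) by (simp add: q_def)
  show "q < 1"
    using c assms(2) by (simp add: q_def field_simps)
qed

text \<open>
Adding \<open>g\<^sup>2\<close> moves the singularity away from the circle: the regularised factor equals
\<open>c \<bar>1 - q \<zeta> w\<bar>\<^sup>2\<close> with \<open>q < 1\<close>, and the product of the latter over all \<open>N\<close>-th roots of unity \<open>w\<close> is explicit. Thus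
\<open>ln c\<close> replaces \<open>2 ln (max r \<bar>z\<bar>)\<close> in Jensen's formula.
\<close>
lemma sum_ln_grid_shifted:
  fixes z :: complex
  assumes r: "r > 0" and g: "g > 0"
  obtains c q \<zeta> where "0 \<le> q" "q < 1" "cmod \<zeta> = 1" "(max r (cmod z))\<^sup>2 \<le> c" "c \<le> (max r (cmod z) + g)\<^sup>2"
    and "\<And>N. N > 0 \<Longrightarrow> (\<Sum>j<N. ln ((cmod (of_real r * grid N j - z))\<^sup>2 + g\<^sup>2))
      = real N * ln c + 2 * ln (cmod (1 - (of_real q * \<zeta>) ^ N))"
proof -
  define A where "A = r\<^sup>2 + (cmod z)\<^sup>2 + g\<^sup>2"
  define B where "B = 2 * r * cmod z"
  define c where "c = (A + sqrt (A\<^sup>2 - B\<^sup>2)) / 2"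
  define q where "q = B / (2 * c)"
  define \<zeta> where "\<zeta> = (if z = 0 then 1 else cnj z / of_real (cmod z))"
  define m where "m = max r (cmod z)"
  define D where "D = \<bar>r\<^sup>2 - (cmod z)\<^sup>2\<bar>"
  have B: "0 \<le> B" "B < A"
  proof -
    have "2 * r * cmod z \<le> r\<^sup>2 + (cmod z)\<^sup>2"
      using zero_le_power2[of "r - cmod z"] by (simp add: power2_diff)
    moreover have "g\<^sup>2 > 0"
      using g by simp
    ultimately show "B < A"
      unfolding A_def B_def by linarith
    show "0 \<le> B"
      using r by (simp add: B_def)
  qed
  note fac = quadratic_factor[OF B, folded c_def, folded q_def]
  have mD: "r\<^sup>2 + (cmod z)\<^sup>2 + D = 2 * m\<^sup>2"
  proof (cases "cmod z \<le> r")
    case True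
    then have "(cmod z)\<^sup>2 \<le> r\<^sup>2" by (intro power_mono) auto
    then show ?thesis using True by (simp add: m_def D_def max_def)
  next
    case False
    then have "r\<^sup>2 \<le> (cmod z)\<^sup>2" using r by (intro power_mono) auto
    then show ?thesis using False by (simp add: m_def D_def max_def)
  qed
  have disc: "A\<^sup>2 - B\<^sup>2 = D\<^sup>2 + 2 * g\<^sup>2 * (r\<^sup>2 + (cmod z)\<^sup>2) + g\<^sup>2 * g\<^sup>2"
    by (simp add: A_def B_def D_def power2_eq_square algebra_simps)
  have "D \<le> sqrt (A\<^sup>2 - B\<^sup>2)"
    unfolding disc by (rule real_le_rsqrt) simp
  moreover have "A \<ge> r\<^sup>2 + (cmod z)\<^sup>2"
    by (simp add: A_def)
  ultimately have "r\<^sup>2 + (cmod z)\<^sup>2 + D \<le> A + sqrt (A\<^sup>2 - B\<^sup>2)"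
    by (intro add_mono)
  then have "m\<^sup>2 \<le> c"
    unfolding mD by (simp add: c_def)
  moreover have "sqrt (A\<^sup>2 - B\<^sup>2) \<le> D + 2 * g * m + g\<^sup>2"
  proof (rule real_le_lsqrt)
    have m0: "m > 0" using r by (simp add: m_def)
    show "0 \<le> D + 2 * g * m + g\<^sup>2"
      using m0 g by (simp add: D_def)
    have "2 * g\<^sup>2 * (r\<^sup>2 + (cmod z)\<^sup>2) \<le> 2 * g\<^sup>2 * (2 * m\<^sup>2)"
      using mD by (intro mult_left_mono) (auto simp: D_def)
    also have "\<dots> = (2 * g * m)\<^sup>2"
      by (simp add: power_mult_distrib)
    finally have "A\<^sup>2 - B\<^sup>2 \<le> D\<^sup>2 + (2 * g * m)\<^sup>2 + (g\<^sup>2)\<^sup>2"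
      unfolding disc by (simp add: power2_eq_square)
    also have "\<dots> \<le> (D + 2 * g * m + g\<^sup>2)\<^sup>2"
    proof -
      have "(D + 2 * g * m + g\<^sup>2)\<^sup>2 = D\<^sup>2 + (2 * g * m)\<^sup>2 + (g\<^sup>2)\<^sup>2 + 2 * (D * (2 * g * m) + D * g\<^sup>2 + 2 * g * m * g\<^sup>2)"
        by (simp add: power2_eq_square algebra_simps)
      moreover have "0 \<le> D * (2 * g * m) + D * g\<^sup>2 + 2 * g * m * g\<^sup>2"
        using m0 g by (simp add: D_def)
      ultimately show ?thesis by simp
    qed
    finally show "A\<^sup>2 - B\<^sup>2 \<le> (D + 2 * g * m + g\<^sup>2)\<^sup>2" .
  qed
  then have "c \<le> m\<^sup>2 + g * m + g\<^sup>2"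
    using mD by (simp add: c_def A_def field_simps)
  moreover have "m\<^sup>2 + g * m + g\<^sup>2 \<le> (m + g)\<^sup>2"
    using r g by (simp add: power2_sum m_def)
  moreover have z1: "cmod \<zeta> = 1"
    by (simp add: \<zeta>_def norm_divide)
  moreover have "(\<Sum>j<N. ln ((cmod (of_real r * grid N j - z))\<^sup>2 + g\<^sup>2))
      = real N * ln c + 2 * ln (cmod (1 - (of_real q * \<zeta>) ^ N))" if N: "N > 0" for N
  proof -
    have eq: "(cmod (of_real r * grid N j - z))\<^sup>2 + g\<^sup>2 = c * (cmod (1 - of_real q * \<zeta> * grid N j))\<^sup>2" for j
    proof -
      define w where "w = grid N j"
      have w: "(cmod w)\<^sup>2 = 1"
        by (simp add: w_def)
      have sqd: "(cmod (x - y))\<^sup>2 = (cmod x)\<^sup>2 + (cmod y)\<^sup>2 - 2 * Re (x * cnj y)" for x y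
        unfolding cmod_power2 by (simp add: power2_eq_square algebra_simps)
      have zz: "of_real (cmod z) * \<zeta> = cnj z"
        by (simp add: \<zeta>_def)
      have "(cmod (of_real r * w - z))\<^sup>2 + g\<^sup>2 = A - 2 * r * Re (w * cnj z)"
        unfolding sqd using r by (simp add: norm_mult power_mult_distrib w A_def) (simp add: algebra_simps)
      also have "Re (w * cnj z) = cmod z * Re (\<zeta> * w)"
        unfolding zz[symmetric] by (simp add: algebra_simps)
      also have "A - 2 * r * (cmod z * Re (\<zeta> * w)) = c * (1 + q\<^sup>2) - 2 * c * q * Re (\<zeta> * w)"
        unfolding fac by (simp add: B_def)
      also have "\<dots> = c * (1 + q\<^sup>2 - 2 * Re (of_real q * \<zeta> * w))"
        by (simp add: algebra_simps)
      also have "1 + q\<^sup>2 - 2 * Re (of_real q * \<zeta> * w) = (cmod (1 - of_real q * \<zeta> * w))\<^sup>2"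
        unfolding sqd using fac(4) by (simp add: norm_mult power_mult_distrib w z1)
      finally show ?thesis
        by (simp add: w_def)
    qed
    have nz: "cmod (1 - of_real q * \<zeta> * grid N j) > 0" for j
    proof -
      have "cmod (of_real q * \<zeta> * grid N j) < 1"
        using fac z1 by (simp add: norm_mult)
      then show ?thesis by auto
    qed
    have "(\<Sum>j<N. ln ((cmod (of_real r * grid N j - z))\<^sup>2 + g\<^sup>2))
        = (\<Sum>j<N. ln c + 2 * ln (cmod (1 - of_real q * \<zeta> * grid N j)))"
      unfolding eq using fac(1) nz
      by (intro sum.cong refl) (subst ln_mult_pos, auto simp: ln_realpow)
    also have "\<dots> = real N * ln c + 2 * (\<Sum>j<N. ln (cmod (1 - of_real q * \<zeta> * grid N j)))"
      by (simp add: sum.distrib sum_distrib_left)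
    also have "(\<Sum>j<N. ln (cmod (1 - of_real q * \<zeta> * grid N j))) = ln (\<Prod>j<N. cmod (1 - of_real q * \<zeta> * grid N j))"
      using nz by (subst ln_prod) auto
    also have "(\<Prod>j<N. cmod (1 - of_real q * \<zeta> * grid N j)) = cmod (1 - (of_real q * \<zeta>) ^ N)"
      unfolding prod_norm grid_prod[OF N] ..
    finally show ?thesis .
  qed
  ultimately show ?thesis
    using that[of q \<zeta> c] fac(4,5) by (simp add: m_def)
qed

lemma grid_ln_upper:
  fixes z :: complex
  assumes g: "g > 0" and N: "N > 0"
  shows "(\<Sum>j<N. ln ((cmod (grid N j - z))\<^sup>2 + g\<^sup>2) / 2) \<le> real N * (ln (max 1 (cmod z)) + g) + ln 2"
proof -
  obtain c q \<zeta> where q: "0 \<le> q" "q < 1" "cmod \<zeta> = 1" and c: "(max 1 (cmod z))\<^sup>2 \<le> c" "c \<le> (max 1 (cmod z) + g)\<^sup>2"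
    and eq: "\<And>N. N > 0 \<Longrightarrow> (\<Sum>j<N. ln ((cmod (of_real 1 * grid N j - z))\<^sup>2 + g\<^sup>2))
      = real N * ln c + 2 * ln (cmod (1 - (of_real q * \<zeta>) ^ N))"
    by (rule sum_ln_grid_shifted[OF zero_less_one g, of z]) (rule that, assumption+)
  define m where "m = max 1 (cmod z)"
  have m: "m \<ge> 1" by (simp add: m_def)
  have "ln c \<le> ln ((m + g)\<^sup>2)"
    using c m unfolding m_def[symmetric] by (intro ln_mono) (auto intro: less_le_trans[OF _ c(1)[folded m_def]])
  also have "\<dots> = 2 * ln (m * (1 + g / m))"
    using m g by (simp add: ln_realpow distrib_left)
  also have "\<dots> = 2 * ln m + 2 * ln (1 + g / m)"
    using m g by (subst ln_mult_pos) (auto simp: add_pos_pos)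
  also have "ln (1 + g / m) \<le> g / m"
    using m g by (intro ln_add_one_self_le_self) auto
  also have "g / m \<le> g"
    using m g by (simp add: field_simps)
  finally have lc: "ln c \<le> 2 * ln m + 2 * g" by simp
  have "cmod ((of_real q * \<zeta>) ^ N) \<le> 1"
    using q by (simp add: norm_power norm_mult power_le_one)
  then have "cmod (1 - (of_real q * \<zeta>) ^ N) \<le> 2"
    using norm_triangle_ineq4[of 1 "(of_real q * \<zeta>) ^ N"] by simp
  moreover have "cmod (1 - (of_real q * \<zeta>) ^ N) > 0"
  proof -
    have "cmod ((of_real q * \<zeta>) ^ N) < 1"
      using q N by (simp add: norm_power norm_mult power_less_one_iff)
    then show ?thesis by auto
  qed
  ultimately have l2: "ln (cmod (1 - (of_real q * \<zeta>) ^ N)) \<le> ln 2"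
    by (intro ln_mono) auto
  have "(\<Sum>j<N. ln ((cmod (grid N j - z))\<^sup>2 + g\<^sup>2)) = real N * ln c + 2 * ln (cmod (1 - (of_real q * \<zeta>) ^ N))"
    using eq[OF N] by simp
  also have "\<dots> \<le> real N * (2 * ln m + 2 * g) + 2 * ln 2"
    using lc l2 by (intro add_mono mult_left_mono) auto
  finally show ?thesis
    by (simp add: m_def[symmetric] algebra_simps flip: sum_divide_distrib)
qed

lemma grid_ln_lower:
  fixes z :: complex
  assumes r: "r > 0" and g: "g > 0"
  shows "eventually (\<lambda>N. (\<Sum>j<N. ln ((cmod (of_real r * grid N j - z))\<^sup>2 + g\<^sup>2) / 2) \<ge> real N * ln (max r (cmod z)) - ln 2) sequentially"
proof -
  obtain c q \<zeta> where q: "0 \<le> q" "q < 1" "cmod \<zeta> = 1" and c: "(max r (cmod z))\<^sup>2 \<le> c" "c \<le> (max r (cmod z) + g)\<^sup>2"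
    and eq: "\<And>N. N > 0 \<Longrightarrow> (\<Sum>j<N. ln ((cmod (of_real r * grid N j - z))\<^sup>2 + g\<^sup>2))
      = real N * ln c + 2 * ln (cmod (1 - (of_real q * \<zeta>) ^ N))"
    by (rule sum_ln_grid_shifted[OF r g, of z]) (rule that, assumption+)
  have "(\<lambda>N. q ^ N) \<longlonglongrightarrow> 0"
    using q by (intro LIMSEQ_power_zero) auto
  then have "eventually (\<lambda>N. q ^ N < 1 / 2) sequentially"
    by (rule order_tendstoD) simp
  then show ?thesis
    using eventually_gt_at_top[of 0]
  proof eventually_elim
    case (elim N)
    have "cmod ((of_real q * \<zeta>) ^ N) = q ^ N"
      using q by (simp add: norm_power norm_mult)
    then have "cmod (1 - (of_real q * \<zeta>) ^ N) \<ge> 1 / 2"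
      using norm_triangle_ineq2[of 1 "(of_real q * \<zeta>) ^ N"] elim by simp
    then have l2: "ln (cmod (1 - (of_real q * \<zeta>) ^ N)) \<ge> ln (1 / 2)"
      by (intro ln_mono) auto
    have m: "max r (cmod z) > 0" using r by simp
    have "2 * ln (max r (cmod z)) = ln ((max r (cmod z))\<^sup>2)"
      using m by (simp add: ln_realpow)
    also have "\<dots> \<le> ln c"
      using m c by (intro ln_mono) auto
    finally have "real N * (2 * ln (max r (cmod z))) \<le> real N * ln c"
      by (intro mult_left_mono) auto
    then show ?case
      using eq[OF elim(2)] l2 by (simp add: ln_div flip: sum_divide_distrib)
  qed
qed

text \<open>
The left-hand side is a convex function of \<open>y\<close>, hence below its chord between \<open>0\<close> and \<open>1\<close>.
\<close>
lemma prod_add_le: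
  fixes a :: "'i \<Rightarrow> real"
  assumes "finite I" "\<And>i. i \<in> I \<Longrightarrow> 0 \<le> a i" "0 \<le> y" "y \<le> 1"
  shows "(\<Prod>i\<in>I. a i + y) \<le> (1 - y) * (\<Prod>i\<in>I. a i) + y * (\<Prod>i\<in>I. a i + 1)"
  using assms(1,2)
proof (induction I rule: finite_induct)
  case (insert i I)
  define P where "P = (\<Prod>i\<in>I. a i)"
  define Q where "Q = (\<Prod>i\<in>I. a i + 1)"
  have ai: "a i \<ge> 0" using insert by auto
  have PQ: "P \<le> Q"
    unfolding P_def Q_def using insert.prems by (intro prod_mono) auto
  have "(\<Prod>i\<in>insert i I. a i + y) = (a i + y) * (\<Prod>i\<in>I. a i + y)"
    using insert by simp
  also have "\<dots> \<le> (a i + y) * ((1 - y) * P + y * Q)"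
    using insert ai assms(3) unfolding P_def Q_def by (intro mult_left_mono) auto
  also have "\<dots> = (1 - y) * (a i * P) + y * ((a i + 1) * Q) - y * (1 - y) * (Q - P)"
    by (simp add: algebra_simps)
  also have "\<dots> \<le> (1 - y) * (a i * P) + y * ((a i + 1) * Q)"
    using assms PQ by simp
  finally show ?case
    using insert by (simp add: P_def Q_def)
qed (use assms in simp)

lemma complex_poly_root_list:
  fixes p :: "complex poly"
  assumes "cmod (lead_coeff p) = 1"
  obtains z :: "nat \<Rightarrow> complex" where
    "\<And>w. cmod (poly p w) = (\<Prod>i<degree p. cmod (w - z i))"
    and "\<And>A. real (root_count p A) = (\<Sum>i<degree p. if z i \<in> A then 1 else 0)"
proof -
  obtain zs where zs: "mset zs = proots p"
    using ex_mset by blast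
  have len: "length zs = degree p"
    using arg_cong[OF zs, of size] by (simp add: size_proots_complex)
  have p: "p = smult (lead_coeff p) (\<Prod>x\<leftarrow>zs. [:-x, 1:])"
    using complex_poly_decompose_multiset[of p] unfolding zs[symmetric] by (simp add: prod_mset_prod_list flip: mset_map)
  show ?thesis
  proof (rule that[of "\<lambda>i. zs ! i"])
    fix w
    have poly_prod: "poly (\<Prod>x\<leftarrow>xs. [:-x, 1:]) w = (\<Prod>x\<leftarrow>xs. w - x)" for xs :: "complex list"
      by (induction xs) (auto simp: algebra_simps)
    have "poly p w = lead_coeff p * (\<Prod>x\<leftarrow>zs. w - x)"
      by (subst p) (simp add: poly_prod)
    also have "(\<Prod>x\<leftarrow>zs. w - x) = (\<Prod>i<degree p. w - zs ! i)"
      by (simp add: prod.list_conv_set_nth len atLeast0LessThan)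
    finally show "cmod (poly p w) = (\<Prod>i<degree p. cmod (w - zs ! i))"
      using assms by (simp add: norm_mult prod_norm)
  next
    fix A
    have "root_count p A = length (filter (\<lambda>z. z \<in> A) zs)"
      unfolding root_count_def zs[symmetric] by (simp flip: mset_filter)
    also have "\<dots> = card {i. i < degree p \<and> zs ! i \<in> A}"
      by (simp add: length_filter_conv_card len)
    finally show "real (root_count p A) = (\<Sum>i<degree p. if zs ! i \<in> A then 1 else 0)"
      by (simp add: sum.If_cases Int_def)
  qed
qed

text \<open>
Regularising the square of the polynomial by \<open>e\<close> dominates regularising each of its linear factors by a sufficiently
small \<open>g\<^sup>2\<close>; the size of \<open>g\<close> only affects how large \<open>N\<close> has to be.
\<close>
lemma grid_ln_poly_lower:
  fixes z :: "nat \<Rightarrow> complex"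
  assumes r: "r > 0" and e: "e > 0"
  shows "eventually (\<lambda>N. (\<Sum>j<N. ln ((\<Prod>i<m. cmod (of_real r * grid N j - z i))\<^sup>2 + e) / 2)
      \<ge> real N * (\<Sum>i<m. ln (max r (cmod (z i)))) - real m * ln 2) sequentially"
proof -
  define K where "K = (\<Prod>i<m. (r + cmod (z i))\<^sup>2 + 1)"
  have K: "K > 0"
    unfolding K_def by (intro prod_pos) (auto intro: add_nonneg_pos)
  \<comment> \<open>\<open>K\<close> dominates the chord slope in \<open>prod_add_le\<close> at every point of the circle\<close>
  define g where "g = sqrt (min 1 (e / K))"
  have g: "g > 0" "g\<^sup>2 \<le> 1" "g\<^sup>2 * K \<le> e"
    using e K by (auto simp: g_def min_def field_simps)
  have "eventually (\<lambda>N. \<forall>i\<in>{..<m}. (\<Sum>j<N. ln ((cmod (of_real r * grid N j - z i))\<^sup>2 + g\<^sup>2) / 2)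
      \<ge> real N * ln (max r (cmod (z i))) - ln 2) sequentially"
    using grid_ln_lower[OF r g(1)] by (intro eventually_ball_finite) auto
  then show ?thesis
  proof eventually_elim
    case (elim N)
    have "real N * (\<Sum>i<m. ln (max r (cmod (z i)))) - real m * ln 2 = (\<Sum>i<m. real N * ln (max r (cmod (z i))) - ln 2)"
      by (simp add: sum_subtractf sum_distrib_left)
    also have "\<dots> \<le> (\<Sum>i<m. \<Sum>j<N. ln ((cmod (of_real r * grid N j - z i))\<^sup>2 + g\<^sup>2) / 2)"
      using elim by (intro sum_mono) auto
    also have "\<dots> = (\<Sum>j<N. (\<Sum>i<m. ln ((cmod (of_real r * grid N j - z i))\<^sup>2 + g\<^sup>2)) / 2)"
      by (subst sum.swap) (simp add: sum_divide_distrib)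
    also have "\<dots> \<le> (\<Sum>j<N. ln ((\<Prod>i<m. cmod (of_real r * grid N j - z i))\<^sup>2 + e) / 2)"
    proof (intro sum_mono divide_right_mono)
      fix j
      define a where "a i = (cmod (of_real r * grid N j - z i))\<^sup>2" for i
      have a: "a i \<ge> 0" for i by (simp add: a_def)
      have ag: "a i + g\<^sup>2 > 0" for i
        using a[of i] g(1) by (simp add: add_nonneg_pos)
      have "(\<Prod>i<m. a i + 1) \<le> K"
        unfolding K_def
      proof (intro prod_mono conjI)
        fix i
        have "cmod (of_real r * grid N j - z i) \<le> r + cmod (z i)"
          using norm_triangle_ineq4[of "of_real r * grid N j" "z i"] r by (simp add: norm_mult)
        then show "a i + 1 \<le> (r + cmod (z i))\<^sup>2 + 1"
          unfolding a_def by (intro add_mono power_mono) auto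
      qed (use a in auto)
      then have "g\<^sup>2 * (\<Prod>i<m. a i + 1) \<le> g\<^sup>2 * K"
        by (intro mult_left_mono) auto
      moreover have "(1 - g\<^sup>2) * (\<Prod>i<m. a i) \<le> 1 * (\<Prod>i<m. a i)"
        using a by (intro mult_right_mono prod_nonneg) auto
      moreover have "(\<Prod>i<m. a i + g\<^sup>2) \<le> (1 - g\<^sup>2) * (\<Prod>i<m. a i) + g\<^sup>2 * (\<Prod>i<m. a i + 1)"
        using a g by (intro prod_add_le) auto
      ultimately have "(\<Prod>i<m. a i + g\<^sup>2) \<le> (\<Prod>i<m. a i) + e"
        using g(3) by linarith
      moreover have "(\<Prod>i<m. a i + g\<^sup>2) > 0"
        using ag by (intro prod_pos) auto
      ultimately have "ln (\<Prod>i<m. a i + g\<^sup>2) \<le> ln ((\<Prod>i<m. a i) + e)"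
        by (intro ln_mono) auto
      moreover have "ln (\<Prod>i<m. a i + g\<^sup>2) = (\<Sum>i<m. ln (a i + g\<^sup>2))"
        using ag less_imp_neq[OF ag] by (subst ln_prod) auto
      moreover have "(\<Prod>i<m. a i) = (\<Prod>i<m. cmod (of_real r * grid N j - z i))\<^sup>2"
        by (simp add: a_def prod_power_distrib)
      ultimately show "(\<Sum>i<m. ln ((cmod (of_real r * grid N j - z i))\<^sup>2 + g\<^sup>2))
          \<le> ln ((\<Prod>i<m. cmod (of_real r * grid N j - z i))\<^sup>2 + e)"
        by (simp add: a_def)
    qed simp
    finally show ?case .
  qed
qed

text \<open>
The regularised sum is at least \<open>ln P / 2\<close> and at least \<open>- m ln (1 / g)\<close>. The second bound, of
order \<open>m\<close> up to a logarithm, is the price at the points where \<open>P\<close> is below the threshold \<open>h\<close>.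
\<close>
lemma sum_ln_regularised_lower:
  fixes z :: "nat \<Rightarrow> complex" and w :: complex and m :: nat
  assumes d: "0 < d" "0 < h" "h + d \<le> 1" and g: "0 < g" "g \<le> 1"
  defines "P \<equiv> (\<Prod>i<m. cmod (w - z i))\<^sup>2"
  shows "ln (P + d) / 2 \<le> (\<Sum>i<m. ln ((cmod (w - z i))\<^sup>2 + g\<^sup>2) / 2) + d / (2 * h)
    + (if P < h then real m * ln (1 / g) else 0)"
proof -
  define V where "V = (\<Sum>i<m. ln ((cmod (w - z i))\<^sup>2 + g\<^sup>2) / 2)"
  have pos: "(cmod (w - z i))\<^sup>2 + g\<^sup>2 > 0" for i
    using g by (simp add: add_nonneg_pos)
  have P0: "P \<ge> 0" by (simp add: P_def)
  show ?thesis
  proof (cases "P < h")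
    case True
    have "ln (P + d) \<le> 0"
      using True d P0 by (subst ln_le_zero_iff) auto
    moreover have "V \<ge> (\<Sum>i<m. - ln (1 / g))"
      unfolding V_def
    proof (rule sum_mono)
      fix i
      have "- ln (1 / g) = ln (g\<^sup>2) / 2"
        using g by (simp add: ln_div ln_realpow)
      also have "\<dots> \<le> ln ((cmod (w - z i))\<^sup>2 + g\<^sup>2) / 2"
        using g by (intro divide_right_mono ln_mono) auto
      finally show "- ln (1 / g) \<le> ln ((cmod (w - z i))\<^sup>2 + g\<^sup>2) / 2" .
    qed
    moreover have "d / (2 * h) \<ge> 0"
      using d by simp
    ultimately show ?thesis
      using True by (simp add: V_def[symmetric])
  next
    case False
    then have P: "P > 0" using d by simp
    have "ln P = ln (\<Prod>i<m. (cmod (w - z i))\<^sup>2)"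
      by (simp add: P_def prod_power_distrib)
    also have "\<dots> \<le> ln (\<Prod>i<m. (cmod (w - z i))\<^sup>2 + g\<^sup>2)"
    proof (rule ln_mono)
      show "0 < (\<Prod>i<m. (cmod (w - z i))\<^sup>2)"
        using P by (simp add: P_def prod_power_distrib)
      show "(\<Prod>i<m. (cmod (w - z i))\<^sup>2) \<le> (\<Prod>i<m. (cmod (w - z i))\<^sup>2 + g\<^sup>2)"
        by (intro prod_mono) auto
    qed
    also have "\<dots> = 2 * V"
      using pos g by (subst ln_prod) (auto simp: V_def sum_divide_distrib[symmetric])
    finally have "ln P \<le> 2 * V" .
    moreover have "ln (P + d) = ln P + ln (1 + d / P)"
      using P d by (subst ln_mult_pos[symmetric]) (auto simp: field_simps add_pos_pos)
    moreover have "ln (1 + d / P) \<le> d / P"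
      using P d by (intro ln_add_one_self_le_self) auto
    moreover have "d / P \<le> d / h"
      using False d by (intro divide_left_mono) auto
    ultimately show ?thesis
      using False by (simp add: V_def[symmetric])
  qed
qed

text \<open>
A discrete one-sided form of Jensen's formula. Every root satisfies
\<open>ln (max 1 \<bar>z\<bar>) + s * (if \<bar>z\<bar> < 1 then 1 else 0) \<le> ln (max (exp s) \<bar>z\<bar>)\<close>, for either sign of \<open>s\<close>. The right-hand side is
bounded above by the grid mean on the circle of radius \<open>exp s\<close>, regularised by \<open>e\<close>, and the left-hand side below by the grid
mean on the unit circle, where the points with a small value of \<open>p\<close> are paid for separately.
\<close>
lemma root_count_via_grid:
  fixes p :: "complex poly" and s :: real
  assumes lead: "cmod (lead_coeff p) = 1" and deg: "degree p = m" and e: "e > 0"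
    and d: "0 < d" "0 < h" "h + d \<le> 1" and g: "0 < g" "g \<le> 1"
  shows "eventually (\<lambda>N. real N * s * real (root_count p unit_disk)
    \<le> (\<Sum>j<N. ln ((cmod (poly p (of_real (exp s) * grid N j)))\<^sup>2 + e) / 2)
      - (\<Sum>j<N. ln ((cmod (poly p (grid N j)))\<^sup>2 + d) / 2)
      + real N * (d / (2 * h)) + real m * ln (1 / g) * real (card {j. j < N \<and> (cmod (poly p (grid N j)))\<^sup>2 < h})
      + real N * real m * g + 2 * real m * ln 2) sequentially"
proof -
  obtain z where z: "\<And>w. cmod (poly p w) = (\<Prod>i<m. cmod (w - z i))"
    and cnt: "\<And>A. real (root_count p A) = (\<Sum>i<m. if z i \<in> A then 1 else 0)"
    using complex_poly_root_list[OF lead] unfolding deg by metis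
  have "exp s > 0" by simp
  from grid_ln_poly_lower[OF this e, of z m] show ?thesis
    using eventually_gt_at_top[of 0]
  proof eventually_elim
    case (elim N)
    define V where "V = (\<Sum>j<N. \<Sum>i<m. ln ((cmod (grid N j - z i))\<^sup>2 + g\<^sup>2) / 2)"
    have "(\<Sum>j<N. ln ((cmod (poly p (grid N j)))\<^sup>2 + d) / 2)
       \<le> (\<Sum>j<N. (\<Sum>i<m. ln ((cmod (grid N j - z i))\<^sup>2 + g\<^sup>2) / 2) + d / (2 * h)
           + (if (cmod (poly p (grid N j)))\<^sup>2 < h then real m * ln (1 / g) else 0))"
      unfolding z using d g by (intro sum_mono sum_ln_regularised_lower)
    also have "\<dots> = V + real N * (d / (2 * h)) + real m * ln (1 / g) * real (card {j. j < N \<and> (cmod (poly p (grid N j)))\<^sup>2 < h})"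
      by (simp add: sum.distrib V_def sum.If_cases Int_def)
    finally have 1: "(\<Sum>j<N. ln ((cmod (poly p (grid N j)))\<^sup>2 + d) / 2)
       \<le> V + real N * (d / (2 * h)) + real m * ln (1 / g) * real (card {j. j < N \<and> (cmod (poly p (grid N j)))\<^sup>2 < h})" .
    have "V = (\<Sum>i<m. \<Sum>j<N. ln ((cmod (grid N j - z i))\<^sup>2 + g\<^sup>2) / 2)"
      unfolding V_def by (rule sum.swap)
    also have "\<dots> \<le> (\<Sum>i<m. real N * (ln (max 1 (cmod (z i))) + g) + ln 2)"
      using g elim by (intro sum_mono grid_ln_upper)
    also have "\<dots> = real N * (\<Sum>i<m. ln (max 1 (cmod (z i)))) + real N * real m * g + real m * ln 2"
      by (simp add: sum.distrib sum_distrib_left algebra_simps)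
    finally have 2: "V \<le> real N * (\<Sum>i<m. ln (max 1 (cmod (z i)))) + real N * real m * g + real m * ln 2" .
    have "(\<Sum>i<m. ln (max 1 (cmod (z i)))) + s * real (root_count p unit_disk)
       = (\<Sum>i<m. ln (max 1 (cmod (z i))) + s * (if z i \<in> unit_disk then 1 else 0))"
      by (simp add: cnt sum.distrib sum_distrib_left)
    also have "\<dots> \<le> (\<Sum>i<m. ln (max (exp s) (cmod (z i))))"
    proof (rule sum_mono)
      fix i
      show "ln (max 1 (cmod (z i))) + s * (if z i \<in> unit_disk then 1 else 0) \<le> ln (max (exp s) (cmod (z i)))"
      proof (cases "cmod (z i) < 1")
        case True
        have "ln (exp s) \<le> ln (max (exp s) (cmod (z i)))"
          by (intro ln_mono) auto
        then show ?thesis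
          using True by (simp add: unit_disk_def)
      next
        case False
        then have "ln (cmod (z i)) \<le> ln (max (exp s) (cmod (z i)))"
          by (intro ln_mono) auto
        then show ?thesis
          using False by (simp add: unit_disk_def)
      qed
    qed
    finally have "real N * ((\<Sum>i<m. ln (max 1 (cmod (z i)))) + s * real (root_count p unit_disk))
      \<le> real N * (\<Sum>i<m. ln (max (exp s) (cmod (z i))))"
      by (intro mult_left_mono) auto
    with 1 2 elim(1) show ?case
      unfolding z by (simp add: distrib_left mult_ac)
  qed
qed

section \<open>Small ball bounds away from resonances\<close>

text \<open>
Here \<open>\<rho>\<close> is the amplitude of the phases. For \<open>\<rho> \<le> 1\<close> all factors are below Gaussians; for \<open>1 \<le> \<rho> \<le> R\<close> one of
any four consecutive factors is at most \<open>exp (- \<eta>\<^sup>2 / 12)\<close>; and for \<open>\<rho> > R\<close> the last term exceeds one.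
\<close>
lemma diophantine_small_ball_pointwise:
  assumes dio: "diophantine R \<eta> \<theta>" and eta: "0 < \<eta>" "\<eta> \<le> 1 / 2" and R: "1 \<le> R" and t: "t > 0" and n: "n > 0"
  defines "a \<equiv> \<lambda>k. of_real (1 / sqrt (real n)) * cis \<theta> ^ k"
  assumes c: "cmod (\<Sum>k<n. (a k)\<^sup>2) \<le> 1 / 2"
  shows "\<bar>\<Prod>k<n. cos (phase t a g k)\<bar> \<le> exp (- (t / 6) * sqn g) + exp (- real (n div 4) * \<eta>\<^sup>2 / 12)
     + exp (- R\<^sup>2 * real n / (8 * t)) * exp (sqn g / 4)"
proof -
  define \<rho> where "\<rho> = sqrt (2 * t / real n) * sqrt (sqn g)"
  have \<rho>2: "\<rho>\<^sup>2 = 2 * t * sqn g / real n"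
    using t by (simp add: \<rho>_def power_mult_distrib)
  obtain \<psi> where \<psi>: "fst g = sqrt (sqn g) * cos \<psi>" "snd g = sqrt (sqn g) * sin \<psi>"
  proof -
    have "Complex (fst g) (snd g) = rcis (cmod (Complex (fst g) (snd g))) (Arg (Complex (fst g) (snd g)))"
      by (simp add: rcis_cmod_Arg)
    then show ?thesis
      using that[of "Arg (Complex (fst g) (snd g))"]
      by (auto simp: complex_eq_iff sqn_def cmod_def)
  qed
  have phase: "phase t a g k = \<rho> * cos (real k * \<theta> - \<psi>)" for k
  proof -
    have "a k = of_real (1 / sqrt (real n)) * cis (real k * \<theta>)"
      by (simp add: a_def Complex.DeMoivre)
    then have "phase t a g k = sqrt (2 * t) * (1 / sqrt (real n)) * (fst g * cos (real k * \<theta>) + snd g * sin (real k * \<theta>))"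
      by (simp add: phase_def algebra_simps)
    also have "\<dots> = sqrt (2 * t) * (1 / sqrt (real n)) * (sqrt (sqn g) * cos (real k * \<theta> - \<psi>))"
      unfolding \<psi> cos_diff by (simp add: \<psi>(1)[symmetric] \<psi>(2)[symmetric] algebra_simps)
    also have "sqrt (2 * t) * (1 / sqrt (real n)) * (sqrt (sqn g) * cos (real k * \<theta> - \<psi>)) = \<rho> * cos (real k * \<theta> - \<psi>)"
      by (simp add: \<rho>_def real_sqrt_divide)
    finally show ?thesis .
  qed
  have na: "cmod (a k) = 1 / sqrt (real n)" for k
    by (simp add: a_def norm_mult norm_power norm_divide)
  have one: "(\<Sum>k<n. (cmod (a k))\<^sup>2) = 1"
    using n by (simp add: na power_divide)
  have nonneg: "0 \<le> exp (- (t / 6) * sqn g)" "0 \<le> exp (- real (n div 4) * \<eta>\<^sup>2 / 12)"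
    "0 \<le> exp (- R\<^sup>2 * real n / (8 * t)) * exp (sqn g / 4)"
    by auto
  consider "\<rho> \<le> 1" | "1 \<le> \<rho>" "\<rho> \<le> R" | "R < \<rho>"
    by linarith
  then show ?thesis
  proof cases
    case 1
    have "\<bar>\<Prod>k<n. cos (phase t a g k)\<bar> \<le> (\<Prod>k<n. exp (- (phase t a g k)\<^sup>2 / 3))"
      unfolding abs_prod
    proof (intro prod_mono conjI abs_cos_le_gaussian)
      fix k
      have "\<bar>phase t a g k\<bar> \<le> 1 * 1"
        unfolding phase abs_mult using 1 t by (intro mult_mono) (auto simp: \<rho>_def)
      then show "\<bar>phase t a g k\<bar> \<le> pi / 2"
        using pi_ge_two by linarith
    qed auto
    also have "\<dots> = exp (- (\<Sum>k<n. (phase t a g k)\<^sup>2) / 3)"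
      by (simp add: sum_negf exp_sum[symmetric] flip: sum_divide_distrib)
    also have "\<dots> \<le> exp (- (t / 6) * sqn g)"
    proof -
      have "\<bar>(\<Sum>k<n. (phase t a g k)\<^sup>2) - t * sqn g\<bar> \<le> t * sqn g * cmod (\<Sum>k<n. (a k)\<^sup>2)"
        using t one by (intro sum_phase_sq) auto
      also have "\<dots> \<le> t * sqn g * (1 / 2)"
        using t by (intro mult_left_mono c) auto
      finally have "(\<Sum>k<n. (phase t a g k)\<^sup>2) / 3 \<ge> t / 6 * sqn g"
        by linarith
      then show ?thesis by simp
    qed
    finally show ?thesis
      using nonneg by linarith
  next
    case 2
    define P where "P k = \<bar>cos (phase t a g k)\<bar>" for k
    have P: "0 \<le> P k" "P k \<le> 1" for k
      by (auto simp: P_def)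
    \<comment> \<open>each block of four consecutive factors contributes one factor bounded away from one\<close>
    have block: "(\<Prod>k<4 * m. P k) \<le> exp (- \<eta>\<^sup>2 / 12) ^ m" for m
    proof (induction m)
      case (Suc m)
      obtain i where i: "i \<in> {0, 1, 2, 3::nat}"
        and far: "\<And>l::int. \<bar>\<rho> * cos ((real (4 * m) * \<theta> - \<psi>) + real i * \<theta>) - pi * of_int l\<bar> \<ge> \<eta> / 2"
        using one_of_four_far_from_lattice[OF dio 2 eta, of "real (4 * m) * \<theta> - \<psi>"] by blast
      have "\<bar>phase t a g (4 * m + i) - pi * of_int l\<bar> \<ge> \<eta> / 2" for l :: int
        using far[of l] by (simp add: phase algebra_simps)
      then have "P (4 * m + i) \<le> exp (- (\<eta> / 2)\<^sup>2 / 3)"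
        unfolding P_def using eta by (intro abs_cos_far_from_zero_mod_pi) auto
      then have Pi: "P (4 * m + i) \<le> exp (- \<eta>\<^sup>2 / 12)"
        by (simp add: power_divide)
      have split: "P (4 * m) * P (4 * m + 1) * P (4 * m + 2) * P (4 * m + 3) \<le> P (4 * m + i)"
      proof -
        have m1: "x * y \<le> x" "x * y \<le> y" if "0 \<le> x" "x \<le> 1" "0 \<le> y" "y \<le> 1" for x y :: real
          using that mult_left_le[of y x] mult_left_le_one_le[of y x] by (auto simp: mult.commute)
        have p01: "0 \<le> P (4 * m) * P (4 * m + 1)" "P (4 * m) * P (4 * m + 1) \<le> 1"
          using P by (auto intro: mult_nonneg_nonneg mult_le_one)
        have p012: "0 \<le> P (4 * m) * P (4 * m + 1) * P (4 * m + 2)" "P (4 * m) * P (4 * m + 1) * P (4 * m + 2) \<le> 1"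
          using P p01 by (auto intro: mult_nonneg_nonneg mult_le_one)
        have a3: "P (4 * m) * P (4 * m + 1) * P (4 * m + 2) * P (4 * m + 3) \<le> P (4 * m + 3)"
          "P (4 * m) * P (4 * m + 1) * P (4 * m + 2) * P (4 * m + 3) \<le> P (4 * m) * P (4 * m + 1) * P (4 * m + 2)"
          using m1[OF p012 P(1) P(2)] by auto
        have a2: "P (4 * m) * P (4 * m + 1) * P (4 * m + 2) \<le> P (4 * m + 2)"
          "P (4 * m) * P (4 * m + 1) * P (4 * m + 2) \<le> P (4 * m) * P (4 * m + 1)"
          using m1[OF p01 P(1) P(2)] by auto
        have a1: "P (4 * m) * P (4 * m + 1) \<le> P (4 * m + 1)" "P (4 * m) * P (4 * m + 1) \<le> P (4 * m)"
          using m1[OF P P] by auto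
        show ?thesis
          using i a1 a2 a3 by auto
      qed
      have "(\<Prod>k<4 * Suc m. P k) = (\<Prod>k<4 * m. P k) * (P (4 * m) * P (4 * m + 1) * P (4 * m + 2) * P (4 * m + 3))"
      proof -
        have "4 * Suc m = Suc (Suc (Suc (Suc (4 * m))))" by simp
        then show ?thesis by (simp add: mult_ac numeral_eq_Suc)
      qed
      also have "\<dots> \<le> exp (- \<eta>\<^sup>2 / 12) ^ m * exp (- \<eta>\<^sup>2 / 12)"
        using P by (intro mult_mono Suc.IH order_trans[OF split Pi] mult_nonneg_nonneg) auto
      finally show ?case by (simp only: power_Suc2)
    qed simp
    have "\<bar>\<Prod>k<n. cos (phase t a g k)\<bar> = (\<Prod>k<n. P k)"
      by (simp add: P_def abs_prod)
    also have "\<dots> = (\<Prod>k\<in>{..<n} - {..<4 * (n div 4)}. P k) * (\<Prod>k<4 * (n div 4). P k)"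
      by (rule prod.subset_diff) auto
    also have "\<dots> \<le> 1 * (\<Prod>k<4 * (n div 4). P k)"
      using P by (intro mult_right_mono prod_le_1 prod_nonneg) auto
    also have "1 * (\<Prod>k<4 * (n div 4). P k) = (\<Prod>k<4 * (n div 4). P k)"
      by simp
    also have "\<dots> \<le> exp (- \<eta>\<^sup>2 / 12) ^ (n div 4)"
      by (rule block)
    also have "\<dots> = exp (- real (n div 4) * \<eta>\<^sup>2 / 12)"
      by (simp flip: exp_of_nat_mult)
    finally show ?thesis
      using nonneg by linarith
  next
    case 3
    then have "R\<^sup>2 \<le> \<rho>\<^sup>2"
      using R by (intro power_mono) auto
    then have "- R\<^sup>2 * real n / (8 * t) + sqn g / 4 \<ge> 0"
      using t n by (simp add: \<rho>2 field_simps)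
    then have "exp (- R\<^sup>2 * real n / (8 * t)) * exp (sqn g / 4) \<ge> 1"
      by (simp flip: exp_add)
    then show ?thesis
      using abs_prod_cos_le_1[of "phase t a g" n] nonneg by linarith
  qed
qed

lemma small_ball_diophantine:
  assumes dio: "diophantine R \<eta> \<theta>" and eta: "0 < \<eta>" "\<eta> \<le> 1 / 2" and R: "1 \<le> R" and t: "t > 0" and n: "n > 0"
  defines "a \<equiv> \<lambda>k. of_real (1 / sqrt (real n)) * cis \<theta> ^ k"
  assumes c: "cmod (\<Sum>k<n. (a k)\<^sup>2) \<le> 1 / 2"
  shows "sign_avg n (\<lambda>x. exp (- t * (cmod (\<Sum>k<n. x k *\<^sub>R a k))\<^sup>2))
    \<le> 1 / (1 + t / 3) + exp (- real (n div 4) * \<eta>\<^sup>2 / 12) + 2 * exp (- R\<^sup>2 * real n / (8 * t))"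
proof (rule sign_avg_exp_le)
  interpret prob_space gauss2 by (rule gauss2_prob)
  have "has_bochner_integral gauss2 (\<lambda>g. exp (- real (n div 4) * \<eta>\<^sup>2 / 12)) (exp (- real (n div 4) * \<eta>\<^sup>2 / 12))"
    using prob_space by (simp add: has_bochner_integral_iff)
  from has_bochner_integral_add[OF has_bochner_integral_add[OF gauss2_exp_sqn[of "t / 6"] this]
      has_bochner_integral_mult_right[OF gauss2_exp_sqn_quarter, of "exp (- R\<^sup>2 * real n / (8 * t))"]]
  show "has_bochner_integral gauss2 (\<lambda>g. exp (- (t / 6) * sqn g) + exp (- real (n div 4) * \<eta>\<^sup>2 / 12)
     + exp (- R\<^sup>2 * real n / (8 * t)) * exp (sqn g / 4))
     (1 / (1 + t / 3) + exp (- real (n div 4) * \<eta>\<^sup>2 / 12) + 2 * exp (- R\<^sup>2 * real n / (8 * t)))"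
    using t by (simp add: mult.commute)
  show "\<bar>\<Prod>k<n. cos (phase t a g k)\<bar> \<le> exp (- (t / 6) * sqn g) + exp (- real (n div 4) * \<eta>\<^sup>2 / 12)
     + exp (- R\<^sup>2 * real n / (8 * t)) * exp (sqn g / 4)" for g
    unfolding a_def by (rule diophantine_small_ball_pointwise[OF dio eta R t n c[unfolded a_def]])
qed (use t in auto)

section \<open>Few grid points are resonant\<close>

text \<open>
The bound on \<open>\<beta> - \<alpha>\<close> confines the angles with the property \<open>Q\<close> to one arc of length \<open>d\<close> in the upper half of the circle
and, by reflection, to one in the lower half.
\<close>
lemma card_grid_window:
  fixes Q :: "real \<Rightarrow> real \<Rightarrow> bool"
  assumes N: "N > 0" and d: "0 \<le> d"
    and diam: "\<And>\<alpha> \<beta>. 0 \<le> \<alpha> \<Longrightarrow> \<alpha> \<le> \<beta> \<Longrightarrow> \<beta> \<le> pi \<Longrightarrow> Q (cos \<alpha>) \<bar>sin \<alpha>\<bar> \<Longrightarrow> Q (cos \<beta>) \<bar>sin \<beta>\<bar> \<Longrightarrow> \<beta> - \<alpha> \<le> d"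
  shows "real (card {j. j < N \<and> Q (cos (2 * pi * real j / real N)) \<bar>sin (2 * pi * real j / real N)\<bar>}) \<le> real N * d / pi + 2"
proof -
  define \<theta> where "\<theta> j = 2 * pi * real j / real N" for j
  define J where "J = {j. j < N \<and> Q (cos (\<theta> j)) \<bar>sin (\<theta> j)\<bar>}"
  define J1 where "J1 = {j \<in> J. \<theta> j \<le> pi}"
  define J2 where "J2 = {j \<in> J. \<theta> j > pi}"
  have fin: "finite J1" "finite J2"
    by (auto simp: J1_def J2_def J_def)
  have range: "0 \<le> \<theta> j" "\<theta> j \<le> 2 * pi" if "j < N" for j
    using that N by (auto simp: \<theta>_def field_simps)
  have step: "\<theta> j - \<theta> i = 2 * pi / real N * (real j - real i)" for i j
    by (simp add: \<theta>_def diff_divide_distrib algebra_simps)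
  have mono: "\<theta> i \<le> \<theta> j" if "i \<le> j" for i j
    using step[of j i] that N by (simp add: field_simps zero_le_divide_iff) (simp add: \<theta>_def divide_right_mono mult_left_mono)
  have conv: "real j - real i \<le> real N * d / (2 * pi)" if "\<theta> j - \<theta> i \<le> d" for i j
    using that N unfolding step by (simp add: field_simps)
  have "real (card J1) \<le> real N * d / (2 * pi) + 1"
  proof (rule card_le_diameter[OF fin(1)])
    show "0 \<le> real N * d / (2 * pi)" using d by simp
    fix i j assume ij: "i \<in> J1" "j \<in> J1" "i \<le> j"
    then have "\<theta> j - \<theta> i \<le> d"
      using range[of i] mono[of i j] by (intro diam) (auto simp: J1_def J_def)
    then show "real j - real i \<le> real N * d / (2 * pi)" by (rule conv)
  qed
  moreover have "real (card J2) \<le> real N * d / (2 * pi) + 1"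
  proof (rule card_le_diameter[OF fin(2)])
    show "0 \<le> real N * d / (2 * pi)" using d by simp
    fix i j assume ij: "i \<in> J2" "j \<in> J2" "i \<le> j"
    have refl: "cos (2 * pi - x) = cos x" "\<bar>sin (2 * pi - x)\<bar> = \<bar>sin x\<bar>" for x
      by (simp_all add: cos_diff sin_diff)
    have "(2 * pi - \<theta> i) - (2 * pi - \<theta> j) \<le> d"
    proof (rule diam)
      show "0 \<le> 2 * pi - \<theta> j" "2 * pi - \<theta> j \<le> 2 * pi - \<theta> i" "2 * pi - \<theta> i \<le> pi"
        using ij range[of j] mono[of i j] by (auto simp: J2_def J_def)
    qed (use ij in \<open>auto simp: J2_def J_def refl\<close>)
    then show "real j - real i \<le> real N * d / (2 * pi)" by (intro conv) simp
  qed
  moreover have "J = J1 \<union> J2" "J1 \<inter> J2 = {}"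
    by (auto simp: J1_def J2_def)
  then have "card J = card J1 + card J2"
    using fin by (simp add: card_Un_disjoint)
  ultimately have "real (card J) \<le> real N * d / pi + 2"
    by simp
  then show ?thesis
    by (simp add: J_def \<theta>_def)
qed

lemma card_grid_cos_near:
  assumes N: "N > 0" and w: "0 \<le> w"
  shows "real (card {j. j < N \<and> \<bar>cos (2 * pi * real j / real N) - c\<bar> \<le> w}) \<le> real N * (4 * sqrt w) / pi + 2"
proof (rule card_grid_window[OF N, of "4 * sqrt w" "\<lambda>x y. \<bar>x - c\<bar> \<le> w"])
  fix \<alpha> \<beta> assume ab: "0 \<le> \<alpha>" "\<alpha> \<le> \<beta>" "\<beta> \<le> pi" "\<bar>cos \<alpha> - c\<bar> \<le> w" "\<bar>cos \<beta> - c\<bar> \<le> w"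
  have "(\<beta> - \<alpha>)\<^sup>2 / 8 \<le> 2 * w"
    using cos_diff_lower_bounds(1)[OF ab(1-3)] ab(4,5) by linarith
  then have "(\<beta> - \<alpha>)\<^sup>2 \<le> (4 * sqrt w)\<^sup>2"
    using w by (simp add: power_mult_distrib)
  then show "\<beta> - \<alpha> \<le> 4 * sqrt w"
    by (rule power2_le_imp_le) (use w in auto)
qed (use w in auto)

lemma card_grid_cos_near_sin_large:
  assumes N: "N > 0" and w: "0 \<le> w" and s: "s > 0"
  shows "real (card {j. j < N \<and> \<bar>cos (2 * pi * real j / real N) - c\<bar> \<le> w \<and> s \<le> \<bar>sin (2 * pi * real j / real N)\<bar>})
    \<le> real N * (4 * w / s) / pi + 2"
proof (rule card_grid_window[OF N, of "4 * w / s" "\<lambda>x y. \<bar>x - c\<bar> \<le> w \<and> s \<le> y"])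
  fix \<alpha> \<beta> assume ab: "0 \<le> \<alpha>" "\<alpha> \<le> \<beta>" "\<beta> \<le> pi"
    and 1: "\<bar>cos \<alpha> - c\<bar> \<le> w \<and> s \<le> \<bar>sin \<alpha>\<bar>" and 2: "\<bar>cos \<beta> - c\<bar> \<le> w \<and> s \<le> \<bar>sin \<beta>\<bar>"
  have "sin \<alpha> \<ge> 0" "sin \<beta> \<ge> 0"
    using ab by (auto intro!: sin_ge_zero)
  then have "s * (\<beta> - \<alpha>) / 2 \<le> cos \<alpha> - cos \<beta>"
    using ab 1 2 s by (intro cos_diff_lower_bounds(2)) auto
  also have "\<dots> \<le> 2 * w"
    using 1 2 by linarith
  finally show "\<beta> - \<alpha> \<le> 4 * w / s"
    using s by (simp add: field_simps)
qed (use w s in auto)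

text \<open>
Fractions \<open>p / q\<close> equal to \<open>2\<close> or \<open>-2\<close> are separated from the others because the cosine is stationary there. All other
admissible fractions differ from them by at least \<open>1 / q\<close>, which bounds the sine from below.
\<close>
lemma not_diophantine_cases:
  assumes nd: "\<not> diophantine R \<eta> \<theta>" and R: "1 \<le> R" and eta: "0 < \<eta>" "\<eta> \<le> 1 / 2"
  shows "\<bar>cos \<theta> - 1\<bar> \<le> \<eta> / 2 \<or> \<bar>cos \<theta> - (-1)\<bar> \<le> \<eta> / 2 \<or>
    (\<exists>q\<in>{1..nat \<lfloor>R\<rfloor>}. \<exists>p\<in>{1 - 2 * int q..2 * int q - 1}. \<bar>cos \<theta> - of_int p / (2 * real q)\<bar> \<le> \<eta> / (2 * real q) \<and> 1 / (2 * sqrt R) \<le> \<bar>sin \<theta>\<bar>)"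
proof -
  obtain q :: nat and p :: int where q: "1 \<le> q" "real q \<le> R" and p: "\<bar>2 * real q * cos \<theta> - of_int p\<bar> \<le> \<eta>"
    using nd unfolding diophantine_def by (auto simp: not_less)
  have q0: "real q \<ge> 1" using q by simp
  have close: "\<bar>cos \<theta> - of_int p / (2 * real q)\<bar> \<le> \<eta> / (2 * real q)"
  proof -
    have "2 * real q * \<bar>cos \<theta> - of_int p / (2 * real q)\<bar> = \<bar>2 * real q * (cos \<theta> - of_int p / (2 * real q))\<bar>"
      using q0 by (simp add: abs_mult)
    also have "2 * real q * (cos \<theta> - of_int p / (2 * real q)) = 2 * real q * cos \<theta> - of_int p"
      using q0 by (simp add: field_simps)
    finally have "2 * real q * \<bar>cos \<theta> - of_int p / (2 * real q)\<bar> \<le> \<eta>"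
      using p by simp
    then show ?thesis
      using q0 by (simp add: field_simps)
  qed
  have eq: "\<eta> / (2 * real q) \<le> \<eta> / 2"
    using q0 eta by (intro divide_left_mono) auto
  have "\<bar>2 * real q * cos \<theta>\<bar> \<le> 2 * real q * 1"
    unfolding abs_mult using abs_cos_le_one[of \<theta>] by (intro mult_mono) auto
  then have "\<bar>real_of_int p\<bar> < of_int (2 * int q + 1)"
    using p eta by simp
  then have pq: "\<bar>p\<bar> \<le> 2 * int q"
    by linarith
  consider "p = 2 * int q" | "p = - 2 * int q" | "\<bar>p\<bar> \<le> 2 * int q - 1"
    using pq by linarith
  then show ?thesis
  proof cases
    case 1
    then have p1: "of_int p / (2 * real q) = 1"
      using q0 by simp
    show ?thesis
      using order_trans[OF close[unfolded p1] eq] by blast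
  next
    case 2
    then have p1: "of_int p / (2 * real q) = -1"
      using q0 by simp
    show ?thesis
      using order_trans[OF close[unfolded p1] eq] by blast
  next
    case 3
    then have "\<bar>real_of_int p\<bar> \<le> 2 * real q - 1"
      by linarith
    then have "\<bar>2 * real q * cos \<theta>\<bar> \<le> 2 * real q - 1 / 2"
      using p eta by linarith
    then have "2 * real q * \<bar>cos \<theta>\<bar> \<le> 2 * real q - 1 / 2"
      by (simp add: abs_mult)
    then have "1 / (4 * real q) \<le> 1 - \<bar>cos \<theta>\<bar>"
      using q0 by (simp add: field_simps)
    also have "\<dots> \<le> 1 - (cos \<theta>)\<^sup>2"
      using mult_right_mono[OF abs_cos_le_one[of \<theta>], of "\<bar>cos \<theta>\<bar>"] by (simp add: power2_eq_square flip: abs_mult)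
    also have "\<dots> = (sin \<theta>)\<^sup>2"
      by (simp add: sin_squared_eq)
    finally have "1 / (4 * real q) \<le> (sin \<theta>)\<^sup>2" .
    moreover have "1 / (4 * R) \<le> 1 / (4 * real q)"
      using q q0 by (intro divide_left_mono) auto
    ultimately have "(1 / (2 * sqrt R))\<^sup>2 \<le> \<bar>sin \<theta>\<bar>\<^sup>2"
      using R by (simp add: power_divide power_mult_distrib)
    then have "1 / (2 * sqrt R) \<le> \<bar>sin \<theta>\<bar>"
      by (rule power2_le_imp_le) simp
    moreover have "q \<in> {1..nat \<lfloor>R\<rfloor>}"
      using q by (simp add: le_nat_floor)
    moreover have "p \<in> {1 - 2 * int q..2 * int q - 1}"
      using 3 by auto
    ultimately show ?thesis
      using close by blast
  qed
qed

text \<open>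
The two neighbourhoods of \<open>1\<close> and \<open>-1\<close> account for the term with \<open>sqrt \<eta>\<close>. For every \<open>q\<close> there are fewer than \<open>4 q\<close>
other numerators, each excluding a proportion of order \<open>\<eta> sqrt R / q\<close>.
\<close>
lemma card_grid_not_diophantine:
  assumes N: "N > 0" and R: "1 \<le> R" and eta: "0 < \<eta>" "\<eta> \<le> 1 / 2"
  shows "real (card {j. j < N \<and> \<not> diophantine R \<eta> (2 * pi * real j / real N)})
    \<le> real N * (4 * sqrt \<eta> + 8 * R * sqrt R * \<eta>) + (4 + 8 * R\<^sup>2)"
proof -
  define \<theta> where "\<theta> j = 2 * pi * real j / real N" for j
  define S where "S c = {j. j < N \<and> \<bar>cos (\<theta> j) - c\<bar> \<le> \<eta> / 2}" for c
  define T where "T q p = {j. j < N \<and> \<bar>cos (\<theta> j) - of_int p / (2 * real q)\<bar> \<le> \<eta> / (2 * real q) \<and> 1 / (2 * sqrt R) \<le> \<bar>sin (\<theta> j)\<bar>}"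
    for q :: nat and p :: int
  have "{j. j < N \<and> \<not> diophantine R \<eta> (\<theta> j)} \<subseteq> S 1 \<union> S (-1) \<union> (\<Union>q\<in>{1..nat \<lfloor>R\<rfloor>}. \<Union>p\<in>{1 - 2 * int q..2 * int q - 1}. T q p)"
    using not_diophantine_cases[OF _ R eta] unfolding S_def T_def by blast
  then have "card {j. j < N \<and> \<not> diophantine R \<eta> (\<theta> j)}
      \<le> card (S 1 \<union> S (-1) \<union> (\<Union>q\<in>{1..nat \<lfloor>R\<rfloor>}. \<Union>p\<in>{1 - 2 * int q..2 * int q - 1}. T q p))"
    by (intro card_mono) (auto simp: S_def T_def)
  also have "\<dots> \<le> card (S 1) + card (S (-1)) + (\<Sum>q\<in>{1..nat \<lfloor>R\<rfloor>}. \<Sum>p\<in>{1 - 2 * int q..2 * int q - 1}. card (T q p))"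
    by (intro order_trans[OF card_Un_le] add_mono order_trans[OF card_UN_le] sum_mono order_refl) auto
  finally have "real (card {j. j < N \<and> \<not> diophantine R \<eta> (\<theta> j)})
      \<le> real (card (S 1)) + real (card (S (-1))) + (\<Sum>q\<in>{1..nat \<lfloor>R\<rfloor>}. \<Sum>p\<in>{1 - 2 * int q..2 * int q - 1}. real (card (T q p)))"
    by (simp only: of_nat_add[symmetric] of_nat_sum[symmetric] of_nat_le_iff)
  also have "\<dots> \<le> (real N * (2 * sqrt \<eta>) + 2) + (real N * (2 * sqrt \<eta>) + 2)
      + (\<Sum>q\<in>{1..nat \<lfloor>R\<rfloor>}. \<Sum>p\<in>{1 - 2 * int q..2 * int q - 1}. real N * (2 * \<eta> * sqrt R / real q) + 2)"
  proof (intro add_mono sum_mono)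
    have S: "real (card (S c)) \<le> real N * (2 * sqrt \<eta>) + 2" for c
    proof -
      have "real (card (S c)) \<le> real N * (4 * sqrt (\<eta> / 2)) / pi + 2"
        unfolding S_def \<theta>_def using N eta by (intro card_grid_cos_near) auto
      also have "\<dots> \<le> real N * (4 * sqrt \<eta>) / 2 + 2"
        using eta pi_ge_two by (intro add_mono frac_le mult_left_mono) auto
      finally show ?thesis by simp
    qed
    show "real (card (S 1)) \<le> real N * (2 * sqrt \<eta>) + 2" "real (card (S (-1))) \<le> real N * (2 * sqrt \<eta>) + 2"
      by (rule S)+
    fix q p assume "q \<in> {1..nat \<lfloor>R\<rfloor>}"
    then have q: "real q \<ge> 1" by simp
    have "real (card (T q p)) \<le> real N * (4 * (\<eta> / (2 * real q)) / (1 / (2 * sqrt R))) / pi + 2"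
      unfolding T_def \<theta>_def using N eta R q by (intro card_grid_cos_near_sin_large) auto
    also have "4 * (\<eta> / (2 * real q)) / (1 / (2 * sqrt R)) = 4 * \<eta> * sqrt R / real q"
      using q by simp
    also have "real N * (4 * \<eta> * sqrt R / real q) / pi \<le> real N * (4 * \<eta> * sqrt R / real q) / 2"
      using eta R q pi_ge_two by (intro divide_left_mono) auto
    finally show "real (card (T q p)) \<le> real N * (2 * \<eta> * sqrt R / real q) + 2"
      by (simp add: mult_ac)
  qed
  also have "(\<Sum>q\<in>{1..nat \<lfloor>R\<rfloor>}. \<Sum>p\<in>{1 - 2 * int q..2 * int q - 1}. real N * (2 * \<eta> * sqrt R / real q) + 2)
      \<le> (\<Sum>q\<in>{1..nat \<lfloor>R\<rfloor>}. real N * (8 * \<eta> * sqrt R) + 8 * R)"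
  proof (rule sum_mono)
    fix q assume qq: "q \<in> {1..nat \<lfloor>R\<rfloor>}"
    then have q: "real q \<ge> 1" "real q \<le> R"
      using R by (auto simp: le_nat_iff le_floor_iff)
    have "(\<Sum>p\<in>{1 - 2 * int q..2 * int q - 1}. real N * (2 * \<eta> * sqrt R / real q) + 2)
       = real (card {1 - 2 * int q..2 * int q - 1}) * (real N * (2 * \<eta> * sqrt R / real q) + 2)"
      by simp
    also have "\<dots> \<le> (4 * real q) * (real N * (2 * \<eta> * sqrt R / real q) + 2)"
      using q eta R by (intro mult_right_mono) auto
    also have "\<dots> = real N * (8 * \<eta> * sqrt R) + 8 * real q"
      using q by (simp add: field_simps)
    finally show "(\<Sum>p\<in>{1 - 2 * int q..2 * int q - 1}. real N * (2 * \<eta> * sqrt R / real q) + 2) \<le> real N * (8 * \<eta> * sqrt R) + 8 * R"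
      using q by linarith
  qed
  also have "(\<Sum>q\<in>{1..nat \<lfloor>R\<rfloor>}. real N * (8 * \<eta> * sqrt R) + 8 * R) \<le> R * (real N * (8 * \<eta> * sqrt R) + 8 * R)"
    using R eta by (simp add: mult_right_mono)
  finally show ?thesis
    by (simp add: \<theta>_def power2_eq_square algebra_simps)
qed

section \<open>Logarithmic means of Littlewood polynomials\<close>

text \<open>
The coefficients, normalised to have unit square sum, of the Littlewood polynomial on the circle of radius \<open>r\<close>.
\<close>
definition weight :: "nat \<Rightarrow> real \<Rightarrow> nat \<Rightarrow> real" where
  "weight n r k = r ^ k / sqrt (\<Sum>i<n. r ^ (2 * i))"

definition grid_value :: "nat \<Rightarrow> real \<Rightarrow> nat \<Rightarrow> nat \<Rightarrow> (nat \<Rightarrow> real) \<Rightarrow> complex" where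
  "grid_value n r N j = random_sum n (\<lambda>k. of_real (weight n r k) * grid N j ^ k)"

text \<open>
The defect of rotation invariance of \<open>grid_value\<close>: the modulus of its pseudo-variance.
\<close>
definition correlation :: "nat \<Rightarrow> real \<Rightarrow> nat \<Rightarrow> nat \<Rightarrow> real" where
  "correlation n r N j = cmod (\<Sum>k<n. (of_real (weight n r k) * grid N j ^ k)\<^sup>2)"

definition log_mean :: "nat \<Rightarrow> real \<Rightarrow> nat \<Rightarrow> real \<Rightarrow> (nat \<Rightarrow> real) \<Rightarrow> real" where
  "log_mean n r N e x = (\<Sum>j<N. ln ((cmod (grid_value n r N j x))\<^sup>2 + e) / 2) / real N"

lemma sum_even_powers_pos:
  assumes "n > 0" "r > 0"
  shows "(\<Sum>i<n. r ^ (2 * i)) > (0 :: real)"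
  using assms by (intro sum_pos) auto

lemma sum_weight_sq:
  assumes "n > 0" "r > 0"
  shows "(\<Sum>k<n. (weight n r k)\<^sup>2) = 1"
proof -
  have "(\<Sum>k<n. (weight n r k)\<^sup>2) = (\<Sum>k<n. r ^ (2 * k) / (\<Sum>i<n. r ^ (2 * i)))"
    using sum_even_powers_pos[OF assms]
    by (intro sum.cong refl) (simp add: weight_def power_divide mult.commute flip: power_mult)
  also have "\<dots> = (\<Sum>k<n. r ^ (2 * k)) / (\<Sum>i<n. r ^ (2 * i))"
    by (simp only: sum_divide_distrib)
  finally have "(\<Sum>k<n. (weight n r k)\<^sup>2) = (\<Sum>k<n. r ^ (2 * k)) / (\<Sum>i<n. r ^ (2 * i))" .
  then show ?thesis
    using sum_even_powers_pos[OF assms] by simp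
qed

lemma weight_1: "(weight n 1 k)\<^sup>2 = 1 / real n"
  by (simp add: weight_def power_divide)

lemma exp_le_quadratic:
  fixes y :: real
  assumes "\<bar>y\<bar> \<le> 1"
  shows "exp y \<le> 1 + y + y\<^sup>2"
proof (cases "y \<ge> 0")
  case True
  then show ?thesis using assms exp_bound[of y] by simp
next
  case False
  have "\<bar>exp (- (- y)) - (1 - - y)\<bar> \<le> (- y)\<^sup>2 / 2"
    using False by (intro exp_minus_taylor_bound) simp
  then have "exp y \<le> 1 + y + y\<^sup>2 / 2"
    by simp
  also have "\<dots> \<le> 1 + y + y\<^sup>2"
    by simp
  finally show ?thesis .
qed

context
  fixes n :: nat and \<delta> s :: real
  assumes n: "n > 0" and \<delta>: "\<delta> \<le> 1 / 2" and s: "\<bar>s\<bar> = \<delta> / real n"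
begin

lemma exponent_small: "k < n \<Longrightarrow> \<bar>2 * s * real k\<bar> \<le> 1"
proof -
  assume "k < n"
  then have "\<bar>s\<bar> * real k \<le> \<bar>s\<bar> * real n"
    by (intro mult_left_mono) auto
  also have "\<dots> = \<delta>"
    using n by (simp add: s)
  finally show ?thesis
    using \<delta> by (simp add: abs_mult)
qed

lemma exp_power_even: "exp s ^ (2 * k) = exp (2 * s * real k)"
  by (simp flip: exp_of_nat_mult)

lemma weight_exp_le:
  assumes "k < n"
  shows "(weight n (exp s) k)\<^sup>2 \<le> 9 / real n"
proof -
  have "real n * exp (- 1) = (\<Sum>i<n. exp (- 1))" by simp
  also have "\<dots> \<le> (\<Sum>i<n. exp s ^ (2 * i))"
    using exponent_small by (intro sum_mono) (auto simp: exp_power_even abs_le_iff)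
  finally have S: "real n * exp (- 1) \<le> (\<Sum>i<n. exp s ^ (2 * i))" .
  have "(weight n (exp s) k)\<^sup>2 = exp s ^ (2 * k) / (\<Sum>i<n. exp s ^ (2 * i))"
    using sum_even_powers_pos[OF n, of "exp s"]
    by (simp add: weight_def power_divide mult.commute flip: power_mult)
  also have "\<dots> \<le> exp 1 / (real n * exp (- 1))"
    using S n exponent_small[OF assms] by (intro frac_le) (auto simp: exp_power_even)
  also have "\<dots> = exp 1 * exp 1 / real n"
    by (simp add: exp_minus field_simps)
  also have "\<dots> \<le> 3 * 3 / real n"
    using exp_le by (intro divide_right_mono mult_mono) auto
  finally show ?thesis by simp
qed

text \<open>
This is where the main term \<open>s n / 2\<close> appears: \<open>ln t \<le> t - 1\<close> reduces the bound to the sum of \<open>exp (2 s k)\<close>, which is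
expanded to second order.
\<close>
lemma ln_variance_ratio:
  "ln ((\<Sum>i<n. exp s ^ (2 * i)) / real n) / 2 \<le> s * real n / 2 + \<bar>s\<bar> / 2 + 2 * s\<^sup>2 * (real n)\<^sup>2"
proof -
  have pos: "(\<Sum>i<n. exp s ^ (2 * i)) > 0"
    by (intro sum_even_powers_pos n) simp
  have "(\<Sum>i<n. exp s ^ (2 * i)) \<le> (\<Sum>i<n. 1 + 2 * s * real i + 4 * s\<^sup>2 * (real n)\<^sup>2)"
  proof (rule sum_mono)
    fix i assume "i \<in> {..<n}"
    then have i: "i < n" by simp
    have "exp (2 * s * real i) \<le> 1 + 2 * s * real i + (2 * s * real i)\<^sup>2"
      by (intro exp_le_quadratic exponent_small i)
    also have "(2 * s * real i)\<^sup>2 \<le> 4 * s\<^sup>2 * (real n)\<^sup>2"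
      using i by (simp add: power_mult_distrib mult_left_mono power_mono)
    finally show "exp s ^ (2 * i) \<le> 1 + 2 * s * real i + 4 * s\<^sup>2 * (real n)\<^sup>2"
      by (simp add: exp_power_even)
  qed
  also have "\<dots> = real n + 2 * s * (\<Sum>i<n. real i) + real n * (4 * s\<^sup>2 * (real n)\<^sup>2)"
    by (simp add: sum.distrib sum_distrib_left)
  also have "2 * (\<Sum>i<n. real i) = real n * (real n - 1)"
    by (induction n) (auto simp: algebra_simps)
  then have "2 * s * (\<Sum>i<n. real i) = s * (real n * (real n - 1))"
    by simp
  finally have "(\<Sum>i<n. exp s ^ (2 * i)) / real n \<le> 1 + s * (real n - 1) + 4 * s\<^sup>2 * (real n)\<^sup>2"
    using n by (simp add: field_simps)
  moreover have "ln ((\<Sum>i<n. exp s ^ (2 * i)) / real n) \<le> (\<Sum>i<n. exp s ^ (2 * i)) / real n - 1"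
    using pos n by (intro ln_le_minus_one) auto
  ultimately have "ln ((\<Sum>i<n. exp s ^ (2 * i)) / real n) \<le> s * real n - s + 4 * s\<^sup>2 * (real n)\<^sup>2"
    by (simp add: algebra_simps)
  then show ?thesis
    by linarith
qed

end

text \<open>
Parseval's identity applies to the exponents \<open>2 k\<close>, which remain distinct modulo \<open>N\<close>.
\<close>
lemma correlation_sq_sum:
  assumes n: "n > 0" and r: "r > 0" and N: "2 * n \<le> N" and \<kappa>: "\<And>k. k < n \<Longrightarrow> (weight n r k)\<^sup>2 \<le> \<kappa>"
  shows "(\<Sum>j<N. (correlation n r N j)\<^sup>2) \<le> real N * \<kappa>"
proof -
  have eq: "(\<Sum>k<n. (of_real (weight n r k) * grid N j ^ k)\<^sup>2) = (\<Sum>k<n. of_real ((weight n r k)\<^sup>2) * grid N j ^ (2 * k))" for j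
    by (intro sum.cong refl) (simp add: power_mult_distrib mult.commute flip: power_mult)
  have "(\<Sum>j<N. (correlation n r N j)\<^sup>2) = real N * (\<Sum>k<n. (cmod (of_real ((weight n r k)\<^sup>2)))\<^sup>2)"
    unfolding correlation_def eq using N by (intro grid_parseval) (auto simp: inj_on_def)
  also have "\<dots> = real N * (\<Sum>k<n. (weight n r k)\<^sup>2 * (weight n r k)\<^sup>2)"
    by (simp only: norm_of_real power2_abs power2_eq_square[of "(weight n r _)\<^sup>2"])
  also have "\<dots> \<le> real N * (\<Sum>k<n. \<kappa> * (weight n r k)\<^sup>2)"
    using \<kappa> by (intro mult_left_mono sum_mono mult_right_mono) auto
  also have "\<dots> = real N * \<kappa>"
    using sum_weight_sq[OF n r] by (simp flip: sum_distrib_left)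
  finally show ?thesis .
qed

lemma correlation_sum:
  assumes n: "n > 0" and r: "r > 0" and N: "2 * n \<le> N" and \<kappa>: "\<And>k. k < n \<Longrightarrow> (weight n r k)\<^sup>2 \<le> \<kappa>"
  shows "(\<Sum>j<N. correlation n r N j) \<le> real N * sqrt \<kappa>"
proof -
  have k0: "\<kappa> \<ge> 0"
    using \<kappa>[OF n] order_trans zero_le_power2 by blast
  have "(\<Sum>j<N. correlation n r N j)\<^sup>2 \<le> real N * (\<Sum>j<N. (correlation n r N j)\<^sup>2)"
    using Cauchy_Schwarz_ineq_sum[of "\<lambda>_. 1" "correlation n r N" "{..<N}"] by simp
  also have "\<dots> \<le> real N * (real N * \<kappa>)"
    by (intro mult_left_mono correlation_sq_sum assms) auto
  also have "\<dots> = (real N * sqrt \<kappa>)\<^sup>2"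
    using k0 by (simp add: power_mult_distrib power2_eq_square)
  finally show ?thesis
    by (rule power2_le_imp_le) (use k0 in auto)
qed

lemma grid_value_clt:
  assumes n: "n > 0" and r: "r > 0" and t: "t \<ge> 0" and \<kappa>: "\<And>k. k < n \<Longrightarrow> (weight n r k)\<^sup>2 \<le> \<kappa>"
  shows "\<bar>sign_avg n (\<lambda>x. exp (- t * (cmod (grid_value n r N j x))\<^sup>2)) - 1 / (1 + t)\<bar>
    \<le> 256 * \<kappa> * t\<^sup>2 + 4 * t * correlation n r N j"
  unfolding grid_value_def random_sum_def correlation_def
  using \<kappa> sum_weight_sq[OF n r]
  by (intro sign_avg_exp_clt t) (auto simp: norm_mult norm_power)

text \<open>
The Laplace transforms on both circles are compared with \<open>1 / (1 + t)\<close>; the correlations are small on average over the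
grid by the Cauchy-Schwarz inequality.
\<close>
lemma log_mean_expectation:
  assumes n: "n > 0" and r: "r > 0" and N: "2 * n \<le> N" and e: "e > 0"
    and \<kappa>: "\<And>k. k < n \<Longrightarrow> (weight n r k)\<^sup>2 \<le> 9 / real n"
  shows "\<bar>sign_avg n (log_mean n r N e) - sign_avg n (log_mean n 1 N e)\<bar>
    \<le> 10240 / (real n * e\<^sup>2) + 32 / (sqrt (real n) * e)"
proof -
  have w1: "\<And>k. k < n \<Longrightarrow> (weight n 1 k)\<^sup>2 \<le> 1 / real n"
    by (simp add: weight_1)
  have N0: "N > 0" using n N by simp
  define E where "E r j = sign_avg n (\<lambda>x. ln ((cmod (grid_value n r N j x))\<^sup>2 + e))" for r j
  define c where "c r j = correlation n r N j" for r j
  have c0: "c r j \<ge> 0" for r j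
    by (simp add: c_def correlation_def)
  have mean: "sign_avg n (log_mean n r N e) = (\<Sum>j<N. E r j / 2) / real N" for r
    unfolding log_mean_def E_def by (simp add: sign_avg_cdiv sign_avg_sum)
  have pt: "\<bar>E r j - E 1 j\<bar> \<le> 20480 / (real n * e\<^sup>2) + 16 * (c r j + c 1 j) / e" for j
  proof -
    have "\<bar>E r j - E 1 j\<bar> \<le> 8 * (2560 / real n) / e\<^sup>2 + 4 * (4 * (c r j + c 1 j)) / e"
      unfolding E_def
    proof (rule sign_avg_ln_compare)
      fix t :: real assume t: "t \<ge> 0"
      have "\<bar>sign_avg n (\<lambda>x. exp (- t * (cmod (grid_value n r N j x))\<^sup>2)) - 1 / (1 + t)\<bar>
          \<le> 256 * (9 / real n) * t\<^sup>2 + 4 * t * c r j"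
        unfolding c_def by (rule grid_value_clt[OF n r t \<kappa>])
      moreover have "\<bar>sign_avg n (\<lambda>x. exp (- t * (cmod (grid_value n 1 N j x))\<^sup>2)) - 1 / (1 + t)\<bar>
          \<le> 256 * (1 / real n) * t\<^sup>2 + 4 * t * c 1 j"
        unfolding c_def by (rule grid_value_clt[OF n zero_less_one t w1])
      ultimately have "\<bar>sign_avg n (\<lambda>x. exp (- t * (cmod (grid_value n r N j x))\<^sup>2))
          - sign_avg n (\<lambda>x. exp (- t * (cmod (grid_value n 1 N j x))\<^sup>2))\<bar>
          \<le> (256 * (9 / real n) * t\<^sup>2 + 4 * t * c r j) + (256 * (1 / real n) * t\<^sup>2 + 4 * t * c 1 j)"
        by linarith
      also have "\<dots> = 2560 / real n * t\<^sup>2 + 4 * (c r j + c 1 j) * t"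
        by (simp add: field_simps)
      finally show "\<bar>sign_avg n (\<lambda>x. exp (- t * (cmod (grid_value n r N j x))\<^sup>2))
          - sign_avg n (\<lambda>x. exp (- t * (cmod (grid_value n 1 N j x))\<^sup>2))\<bar>
          \<le> 2560 / real n * t\<^sup>2 + 4 * (c r j + c 1 j) * t" .
    qed (use e c0 in \<open>auto intro: add_nonneg_nonneg\<close>)
    then show ?thesis
      by simp
  qed
  have "\<bar>sign_avg n (log_mean n r N e) - sign_avg n (log_mean n 1 N e)\<bar> = \<bar>\<Sum>j<N. E r j - E 1 j\<bar> / (2 * real N)"
    unfolding mean by (simp add: sum_subtractf abs_divide flip: sum_divide_distrib diff_divide_distrib)
  also have "\<dots> \<le> (\<Sum>j<N. 20480 / (real n * e\<^sup>2) + 16 * (c r j + c 1 j) / e) / (2 * real N)"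
    by (intro divide_right_mono order_trans[OF sum_abs] sum_mono pt) auto
  finally have le: "\<bar>sign_avg n (log_mean n r N e) - sign_avg n (log_mean n 1 N e)\<bar>
      \<le> (\<Sum>j<N. 20480 / (real n * e\<^sup>2) + 16 * (c r j + c 1 j) / e) / (2 * real N)" .
  have "(\<Sum>j<N. 20480 / (real n * e\<^sup>2) + 16 * (c r j + c 1 j) / e)
      = (\<Sum>j<N. 20480 / (real n * e\<^sup>2) + (16 / e * c r j + 16 / e * c 1 j))"
    by (intro sum.cong refl) (simp add: distrib_left add_divide_distrib)
  also have "\<dots> = real N * (20480 / (real n * e\<^sup>2)) + 16 / e * ((\<Sum>j<N. c r j) + (\<Sum>j<N. c 1 j))"
    by (simp add: sum.distrib distrib_left sum_distrib_left sum_divide_distrib)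
  also have "\<dots> \<le> real N * (20480 / (real n * e\<^sup>2)) + 16 / e * (real N * sqrt (9 / real n) + real N * sqrt (1 / real n))"
  proof -
    have "(\<Sum>j<N. c r j) \<le> real N * sqrt (9 / real n)"
      unfolding c_def by (rule correlation_sum[OF n r N \<kappa>])
    moreover have "(\<Sum>j<N. c 1 j) \<le> real N * sqrt (1 / real n)"
      unfolding c_def by (rule correlation_sum[OF n zero_less_one N w1])
    ultimately show ?thesis
      using e by (intro add_mono mult_left_mono) auto
  qed
  finally have sum_le: "(\<Sum>j<N. 20480 / (real n * e\<^sup>2) + 16 * (c r j + c 1 j) / e)
      \<le> real N * (20480 / (real n * e\<^sup>2)) + 16 / e * (real N * (3 / sqrt (real n)) + real N * sqrt (1 / real n))"
    by (simp add: real_sqrt_divide)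
  note le
  also have "(\<Sum>j<N. 20480 / (real n * e\<^sup>2) + 16 * (c r j + c 1 j) / e) / (2 * real N)
     \<le> (real N * (20480 / (real n * e\<^sup>2)) + 16 / e * (real N * (3 / sqrt (real n)) + real N * sqrt (1 / real n))) / (2 * real N)"
    by (intro divide_right_mono sum_le) auto
  also have "(real N * (20480 / (real n * e\<^sup>2)) + 16 / e * (real N * (3 / sqrt (real n)) + real N * sqrt (1 / real n))) / (2 * real N)
     = 10240 / (real n * e\<^sup>2) + 32 / (sqrt (real n) * e)"
    using N0 e n by (simp add: real_sqrt_divide field_simps)
  finally show ?thesis .
qed

lemma log_mean_variance:
  assumes n: "n > 0" and N: "n \<le> N" and e: "0 < e" "e \<le> 1"
    and \<kappa>: "\<And>k. k < n \<Longrightarrow> (weight n r k)\<^sup>2 \<le> 9 / real n"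
  shows "sign_avg n (\<lambda>x. (log_mean n r N e x - sign_avg n (log_mean n r N e))\<^sup>2) \<le> 2600 / (real n * e\<^sup>2)"
proof -
  have "sign_avg n (\<lambda>x. (log_mean n r N e x - sign_avg n (log_mean n r N e))\<^sup>2)
     \<le> (9 / real n) / (2 * e) + 32 * real n * (9 / real n)\<^sup>2 / e\<^sup>2"
    unfolding log_mean_def grid_value_def
    using assms by (intro grid_log_average_variance) auto
  also have "(9 / real n) / (2 * e) \<le> (9 / real n) / (2 * e\<^sup>2)"
    using e by (intro divide_left_mono mult_pos_pos) (auto simp: power2_eq_square mult_left_le)
  also have "(9 / real n) / (2 * e\<^sup>2) + 32 * real n * (9 / real n)\<^sup>2 / e\<^sup>2 = (2596 + 1 / 2) / (real n * e\<^sup>2)"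
    using n e by (simp add: field_simps power2_eq_square)
  also have "\<dots> \<le> 2600 / (real n * e\<^sup>2)"
    using n e by (intro divide_right_mono) auto
  finally show ?thesis by simp
qed

lemma log_mean_difference:
  assumes n: "n > 0" and r: "r > 0" and N: "2 * n \<le> N" and e: "0 < e" "e \<le> 1"
    and \<kappa>: "\<And>k. k < n \<Longrightarrow> (weight n r k)\<^sup>2 \<le> 9 / real n"
  shows "sign_avg n (\<lambda>x. (log_mean n r N e x - log_mean n 1 N e x)\<^sup>2)
    \<le> 3 * (5200 / (real n * e\<^sup>2) + (10240 / (real n * e\<^sup>2) + 32 / (sqrt (real n) * e))\<^sup>2)"
proof -
  define a where "a x = log_mean n r N e x - sign_avg n (log_mean n r N e)" for x
  define b where "b x = log_mean n 1 N e x - sign_avg n (log_mean n 1 N e)" for x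
  define c where "c = sign_avg n (log_mean n r N e) - sign_avg n (log_mean n 1 N e)"
  have w1: "(weight n 1 k)\<^sup>2 \<le> 9 / real n" for k
    by (simp add: weight_1 divide_right_mono)
  have sq: "(u - v + w)\<^sup>2 \<le> 3 * (u\<^sup>2 + v\<^sup>2 + w\<^sup>2)" for u v w :: real
  proof -
    have "3 * (u\<^sup>2 + v\<^sup>2 + w\<^sup>2) - (u - v + w)\<^sup>2 = (u + v)\<^sup>2 + (u - w)\<^sup>2 + (v + w)\<^sup>2"
      by (simp add: power2_eq_square algebra_simps)
    then show ?thesis
      by (smt (verit) zero_le_power2)
  qed
  have "sign_avg n (\<lambda>x. (log_mean n r N e x - log_mean n 1 N e x)\<^sup>2) = sign_avg n (\<lambda>x. (a x - b x + c)\<^sup>2)"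
    by (simp add: a_def b_def c_def)
  also have "\<dots> \<le> sign_avg n (\<lambda>x. 3 * ((a x)\<^sup>2 + (b x)\<^sup>2 + c\<^sup>2))"
    by (intro sign_avg_mono sq)
  also have "\<dots> = 3 * (sign_avg n (\<lambda>x. (a x)\<^sup>2) + sign_avg n (\<lambda>x. (b x)\<^sup>2) + c\<^sup>2)"
    by (simp add: sign_avg_cmult sign_avg_add)
  also have "sign_avg n (\<lambda>x. (a x)\<^sup>2) \<le> 2600 / (real n * e\<^sup>2)"
    unfolding a_def using n N e \<kappa> by (intro log_mean_variance) auto
  also have "sign_avg n (\<lambda>x. (b x)\<^sup>2) \<le> 2600 / (real n * e\<^sup>2)"
    unfolding b_def using n N e w1 by (intro log_mean_variance) auto
  also have "c\<^sup>2 \<le> (10240 / (real n * e\<^sup>2) + 32 / (sqrt (real n) * e))\<^sup>2"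
    using power_mono[OF log_mean_expectation[OF n r N e(1) \<kappa>], of 2] by (simp add: c_def)
  finally show ?thesis
    by simp
qed

section \<open>The cost of removing the regularisation\<close>

definition regularisation_cost :: "nat \<Rightarrow> nat \<Rightarrow> real \<Rightarrow> real \<Rightarrow> (nat \<Rightarrow> real) \<Rightarrow> real" where
  "regularisation_cost n N e d x =
     (\<Sum>j<N. ln (((cmod (grid_value n 1 N j x))\<^sup>2 + e) / ((cmod (grid_value n 1 N j x))\<^sup>2 + d)) / 2) / real N"

definition small_fraction :: "nat \<Rightarrow> nat \<Rightarrow> real \<Rightarrow> (nat \<Rightarrow> real) \<Rightarrow> real" where
  "small_fraction n N h x = real (card {j. j < N \<and> (cmod (grid_value n 1 N j x))\<^sup>2 < h}) / real N"

text \<open>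
Grid points fall into three classes. A point is degenerate if its correlation exceeds \<open>1 / 2\<close>, and among the others it is
resonant if it violates the condition \<open>diophantine\<close> and generic if it does not. The floors bound the Laplace transform
at time \<open>t\<close>, hence the probability of a small value, for the respective class. They have the orders \<open>1 / t\<close>, \<open>1 / t\<close> and
\<open>1 / sqrt t\<close>, but the generic bound remains useful for \<open>t\<close> well above \<open>n\<close>.
\<close>
definition generic_floor :: "nat \<Rightarrow> real \<Rightarrow> real \<Rightarrow> real \<Rightarrow> real" where
  "generic_floor n R \<eta> t = 1 / (1 + t / 3) + exp (- (real n / 4 - 1) * \<eta>\<^sup>2 / 12) + 2 * exp (- R\<^sup>2 * real n / (8 * t))"

definition resonant_floor :: "nat \<Rightarrow> real \<Rightarrow> real" where
  "resonant_floor n t = 1 / (1 + t / 3) + 2 * exp (- real n / (8 * t))"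

definition degenerate_floor :: "nat \<Rightarrow> real \<Rightarrow> real" where
  "degenerate_floor n t = 1 / sqrt (1 + 2 * t / 3) + 2 * exp (- real n / (8 * t))"

definition laplace :: "nat \<Rightarrow> nat \<Rightarrow> nat \<Rightarrow> real \<Rightarrow> real" where
  "laplace n N j t = sign_avg n (\<lambda>x. exp (- t * (cmod (grid_value n 1 N j x))\<^sup>2))"

lemma laplace_antimono: "s \<le> t \<Longrightarrow> laplace n N j t \<le> laplace n N j s"
  unfolding laplace_def by (intro sign_avg_mono) (simp add: mult_right_mono)

lemma laplace_0: "laplace n N j 0 = 1"
  by (simp add: laplace_def)

lemma grid_value_1:
  "grid_value n 1 N j x = (\<Sum>k<n. x k *\<^sub>R (of_real (1 / sqrt (real n)) * cis (2 * pi * real j / real N) ^ k))"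
  by (simp add: grid_value_def random_sum_def weight_def grid_def)

lemma correlation_1:
  "correlation n 1 N j = cmod (\<Sum>k<n. (of_real (1 / sqrt (real n)) * cis (2 * pi * real j / real N) ^ k)\<^sup>2)"
  by (simp add: correlation_def weight_def grid_def)

lemma unit_weights:
  "n > 0 \<Longrightarrow> (cmod (of_real (1 / sqrt (real n)) * cis \<theta> ^ k))\<^sup>2 = 1 / real n"
  by (simp add: norm_mult norm_power norm_divide power_divide)

text \<open>
The bound of \<open>small_ball_diophantine\<close> is used up to time \<open>t0\<close>; afterwards monotonicity of the Laplace transform
preserves its value at \<open>t0\<close>.
\<close>
lemma laplace_generic:
  assumes n: "n > 0" and c: "correlation n 1 N j \<le> 1 / 2" and dio: "diophantine R \<eta> (2 * pi * real j / real N)"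
    and eta: "0 < \<eta>" "\<eta> \<le> 1 / 2" and R: "1 \<le> R" and t0: "t0 > 0" and t: "t \<ge> 0"
  shows "laplace n N j t \<le> 1 / (1 + t / 3) + generic_floor n R \<eta> t0"
proof -
  have pos: "generic_floor n R \<eta> t0 \<ge> 0"
    using t0 by (simp add: generic_floor_def)
  have blocks: "exp (- real (n div 4) * \<eta>\<^sup>2 / 12) \<le> exp (- (real n / 4 - 1) * \<eta>\<^sup>2 / 12)"
  proof -
    have "real n \<le> real (4 * (n div 4) + 3)"
      by (intro of_nat_mono) presburger
    then have "- real (n div 4) \<le> - (real n / 4 - 1)"
      by simp
    then have "- real (n div 4) * \<eta>\<^sup>2 / 12 \<le> - (real n / 4 - 1) * \<eta>\<^sup>2 / 12"
      by (intro divide_right_mono mult_right_mono) auto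
    then show ?thesis
      by (simp only: exp_le_cancel_iff)
  qed
  have main: "laplace n N j t' \<le> 1 / (1 + t' / 3) + exp (- (real n / 4 - 1) * \<eta>\<^sup>2 / 12) + 2 * exp (- R\<^sup>2 * real n / (8 * t'))"
    if "t' > 0" for t'
  proof -
    have "laplace n N j t' \<le> 1 / (1 + t' / 3) + exp (- real (n div 4) * \<eta>\<^sup>2 / 12) + 2 * exp (- R\<^sup>2 * real n / (8 * t'))"
      unfolding laplace_def grid_value_1
      using c unfolding correlation_1 by (intro small_ball_diophantine dio eta R that n)
    then show ?thesis
      using blocks by linarith
  qed
  consider "t = 0" | "0 < t" "t \<le> t0" | "t0 < t"
    using t by linarith
  then show ?thesis
  proof cases
    case 1
    then show ?thesis using pos by (simp add: laplace_0)
  next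
    case 2
    have "R\<^sup>2 * real n / (8 * t) \<ge> R\<^sup>2 * real n / (8 * t0)"
      using 2 by (intro divide_left_mono) auto
    then have "exp (- R\<^sup>2 * real n / (8 * t)) \<le> exp (- R\<^sup>2 * real n / (8 * t0))"
      by simp
    moreover have "1 / (1 + t0 / 3) \<ge> 0" using t0 by simp
    ultimately show ?thesis
      using main[OF 2(1)] unfolding generic_floor_def by linarith
  next
    case 3
    have "laplace n N j t \<le> laplace n N j t0"
      using 3 by (intro laplace_antimono) auto
    moreover have "1 / (1 + t / 3) \<ge> 0" using t by simp
    ultimately show ?thesis
      using main[OF t0] unfolding generic_floor_def by linarith
  qed
qed

lemma laplace_resonant:
  assumes n: "n > 0" and c: "correlation n 1 N j \<le> 1 / 2" and t: "t > 0"
  shows "laplace n N j t \<le> resonant_floor n t"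
proof -
  have "laplace n N j t \<le> 1 / (1 + t / 3) + 2 * exp (- 1 / (8 * t * (1 / real n)))"
    unfolding laplace_def grid_value_1
    using c n t unfolding correlation_1 by (intro small_ball_nondegenerate) (auto simp: unit_weights simp del: of_real_divide)
  then show ?thesis
    using n by (simp add: resonant_floor_def)
qed

lemma laplace_degenerate:
  assumes n: "n > 0" and t: "t > 0"
  shows "laplace n N j t \<le> degenerate_floor n t"
proof -
  have "laplace n N j t \<le> 1 / sqrt (1 + 2 * t / 3) + 2 * exp (- 1 / (8 * t * (1 / real n)))"
    unfolding laplace_def grid_value_1
    using n t by (intro small_ball_general) (auto simp: unit_weights simp del: of_real_divide)
  then show ?thesis
    using n by (simp add: degenerate_floor_def)
qed

text \<open>
The indicator of \<open>u < h\<close> is at most \<open>exp (1 - u / h)\<close>, and \<open>exp 1 \<le> 3\<close>.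
\<close>
lemma probability_small_le_laplace:
  assumes "h > 0"
  shows "sign_avg n (\<lambda>x. if (cmod (grid_value n 1 N j x))\<^sup>2 < h then 1 else 0) \<le> 3 * laplace n N j (1 / h)"
  unfolding laplace_def sign_avg_cmult[symmetric]
proof (rule sign_avg_mono)
  fix x
  define u where "u = (cmod (grid_value n 1 N j x))\<^sup>2"
  have "(1 :: real) \<le> 3 * exp (- (1 / h) * u)" if "u < h"
  proof -
    have "exp (1 :: real) * exp (- (1 / h) * u) = exp (1 - u / h)"
      by (simp flip: exp_add)
    moreover have "exp (1 - u / h) \<ge> 1"
      using that assms by simp
    moreover have "exp (1 :: real) * exp (- (1 / h) * u) \<le> 3 * exp (- (1 / h) * u)"
      using exp_le by (intro mult_right_mono) auto
    ultimately show ?thesis by linarith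
  qed
  then show "(if (cmod (grid_value n 1 N j x))\<^sup>2 < h then 1 else 0) \<le> 3 * exp (- (1 / h) * (cmod (grid_value n 1 N j x))\<^sup>2)"
    by (simp add: u_def)
qed

text \<open>
Markov's inequality for the squared correlations, whose mean over the grid is at most \<open>1 / n\<close>.
\<close>
lemma card_degenerate:
  assumes n: "n > 0" and N: "2 * n \<le> N"
  shows "real (card {j. j < N \<and> correlation n 1 N j > 1 / 2}) \<le> real N * (4 / real n)"
proof -
  have "real (card {j. j < N \<and> correlation n 1 N j > 1 / 2}) * (1 / 4) = (\<Sum>j<N. if correlation n 1 N j > 1 / 2 then 1 / 4 else 0)"
    by (simp add: sum.If_cases Int_def)
  also have "\<dots> \<le> (\<Sum>j<N. (correlation n 1 N j)\<^sup>2)"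
  proof (rule sum_mono)
    fix j
    have "(1 / 2)\<^sup>2 \<le> (correlation n 1 N j)\<^sup>2" if "correlation n 1 N j > 1 / 2"
      using that by (intro power_mono) auto
    then show "(if correlation n 1 N j > 1 / 2 then 1 / 4 else 0) \<le> (correlation n 1 N j)\<^sup>2"
      by (simp add: power_divide)
  qed
  also have "\<dots> \<le> real N * (1 / real n)"
    using n N by (intro correlation_sq_sum) (auto simp: weight_1)
  finally show ?thesis by simp
qed

lemma regularisation_cost_nonneg:
  assumes "0 < d" "d \<le> e"
  shows "0 \<le> regularisation_cost n N e d x"
  unfolding regularisation_cost_def using assms
  by (intro divide_nonneg_nonneg sum_nonneg ln_ge_zero) (auto simp: add_nonneg_pos)

lemma small_fraction_nonneg: "0 \<le> small_fraction n N h x"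
  by (simp add: small_fraction_def)

text \<open>
Generic points are handled by \<open>sign_avg_ln_ratio\<close>. At the few other points the trivial bound \<open>ln (e / d)\<close> suffices.
\<close>
lemma regularisation_cost_expectation:
  assumes n: "n > 0" and N: "2 * n \<le> N" and d: "0 < d" "d \<le> e"
    and eta: "0 < \<eta>" "\<eta> \<le> 1 / 2" and R: "1 \<le> R" and t0: "t0 > 0"
    and \<beta>: "real (card {j. j < N \<and> \<not> diophantine R \<eta> (2 * pi * real j / real N)}) \<le> real N * \<beta>"
  shows "sign_avg n (regularisation_cost n N e d)
    \<le> generic_floor n R \<eta> t0 * ln (e / d) + (3 * ln (1 + 1 / (3 * d)) + 3) * e + (\<beta> + 4 / real n) * ln (e / d)"
proof -
  define G where "G = generic_floor n R \<eta> t0 * ln (e / d) + (3 * ln (1 + 1 / (3 * d)) + 3) * e"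
  define B where "B = {j. j < N \<and> \<not> diophantine R \<eta> (2 * pi * real j / real N)}"
  define D where "D = {j. j < N \<and> correlation n 1 N j > 1 / 2}"
  define E where "E j = sign_avg n (\<lambda>x. ln (((cmod (grid_value n 1 N j x))\<^sup>2 + e) / ((cmod (grid_value n 1 N j x))\<^sup>2 + d)))" for j
  have N0: "N > 0" using n N by simp
  have l0: "ln (e / d) \<ge> 0"
    using d by simp
  have G0: "G \<ge> 0"
    using l0 d t0 unfolding G_def generic_floor_def by (intro add_nonneg_nonneg mult_nonneg_nonneg ln_ge_zero) auto
  have trivial: "E j \<le> ln (e / d)" for j
  proof -
    have "E j \<le> sign_avg n (\<lambda>_. ln (e / d))"
      unfolding E_def
    proof (rule sign_avg_mono)
      fix x
      define u where "u = (cmod (grid_value n 1 N j x))\<^sup>2"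
      have u: "u \<ge> 0" by (simp add: u_def)
      have "(u + e) / (u + d) \<le> e / d"
      proof -
        have "u * d \<le> u * e" using u d by (intro mult_left_mono)
        then show ?thesis
          using u d by (simp add: field_simps add_nonneg_pos)
      qed
      moreover have "(u + e) / (u + d) > 0"
        using u d by (intro divide_pos_pos add_nonneg_pos) auto
      ultimately show "ln (((cmod (grid_value n 1 N j x))\<^sup>2 + e) / ((cmod (grid_value n 1 N j x))\<^sup>2 + d)) \<le> ln (e / d)"
        by (simp add: u_def[symmetric])
    qed
    then show ?thesis by simp
  qed
  have generic: "E j \<le> G" if "j < N" "j \<notin> B" "j \<notin> D" for j
    unfolding E_def G_def
  proof (rule sign_avg_ln_ratio)
    show "generic_floor n R \<eta> t0 \<ge> 0"
      using t0 by (simp add: generic_floor_def)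
    fix t :: real assume t: "t \<ge> 0"
    show "sign_avg n (\<lambda>x. exp (- t * (cmod (grid_value n 1 N j x))\<^sup>2)) \<le> 1 / (1 + t / 3) + generic_floor n R \<eta> t0"
      using laplace_generic[OF n _ _ eta R t0 t, of N j] that unfolding laplace_def by (simp add: B_def D_def)
  qed (use d in auto)
  have "sign_avg n (regularisation_cost n N e d) = (\<Sum>j<N. E j / 2) / real N"
    unfolding regularisation_cost_def E_def by (simp add: sign_avg_cdiv sign_avg_sum)
  also have "\<dots> \<le> (\<Sum>j<N. G + (if j \<in> B then ln (e / d) else 0) + (if j \<in> D then ln (e / d) else 0)) / real N"
  proof (intro divide_right_mono sum_mono)
    fix j assume j: "j \<in> {..<N}"
    have "E j \<le> G + (if j \<in> B then ln (e / d) else 0) + (if j \<in> D then ln (e / d) else 0)"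
      using generic[of j] trivial[of j] j G0 l0 by auto
    moreover have "0 \<le> G + (if j \<in> B then ln (e / d) else 0) + (if j \<in> D then ln (e / d) else 0)"
      using G0 l0 by auto
    ultimately show "E j / 2 \<le> G + (if j \<in> B then ln (e / d) else 0) + (if j \<in> D then ln (e / d) else 0)"
      by linarith
  qed simp
  also have "(\<Sum>j<N. G + (if j \<in> B then ln (e / d) else 0) + (if j \<in> D then ln (e / d) else 0))
     = real N * G + real (card B) * ln (e / d) + real (card D) * ln (e / d)"
  proof -
    have "{..<N} \<inter> B = B" "{..<N} \<inter> D = D"
      by (auto simp: B_def D_def)
    then show ?thesis
      by (simp add: sum.distrib sum.If_cases Int_def)
  qed
  also have "(real N * G + real (card B) * ln (e / d) + real (card D) * ln (e / d)) / real N
     \<le> (real N * G + (real N * \<beta>) * ln (e / d) + (real N * (4 / real n)) * ln (e / d)) / real N"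
    using l0 G0 \<beta> card_degenerate[OF n N]
    by (intro divide_right_mono add_mono mult_right_mono) (auto simp: B_def D_def)
  also have "\<dots> = G + (\<beta> + 4 / real n) * ln (e / d)"
    using N0 by (simp add: field_simps)
  finally show ?thesis
    by (simp add: G_def)
qed

text \<open>
In the application this quantity is multiplied by \<open>n ln n\<close>, so no class can be treated trivially: the proportion of each
class times its floor has to be well below \<open>1 / n\<close>.
\<close>
lemma small_fraction_expectation:
  assumes n: "n > 0" and N: "2 * n \<le> N" and h: "0 < h" "h * t0 \<le> 1" "h * t1 \<le> 1"
    and eta: "0 < \<eta>" "\<eta> \<le> 1 / 2" and R: "1 \<le> R" and t: "t0 > 0" "t1 > 0"
    and \<beta>: "real (card {j. j < N \<and> \<not> diophantine R \<eta> (2 * pi * real j / real N)}) \<le> real N * \<beta>"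
  shows "sign_avg n (small_fraction n N h)
    \<le> 6 * generic_floor n R \<eta> t0 + 3 * \<beta> * resonant_floor n t1 + 12 / real n * degenerate_floor n t1"
proof -
  define B where "B = {j. j < N \<and> \<not> diophantine R \<eta> (2 * pi * real j / real N)}"
  define D where "D = {j. j < N \<and> correlation n 1 N j > 1 / 2}"
  define F where "F = 2 * generic_floor n R \<eta> t0"
  define Fb where "Fb = resonant_floor n t1"
  define Fv where "Fv = degenerate_floor n t1"
  have N0: "N > 0" using n N by simp
  have F0: "F \<ge> 0" "Fb \<ge> 0" "Fv \<ge> 0"
    using t by (simp_all add: F_def Fb_def Fv_def generic_floor_def resonant_floor_def degenerate_floor_def)
  have t01: "t0 \<le> 1 / h" "t1 \<le> 1 / h"
    using h by (simp_all add: field_simps)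
  have "laplace n N j (1 / h) \<le> F + (if j \<in> B then Fb else 0) + (if j \<in> D then Fv else 0)" if j: "j < N" for j
  proof -
    consider "j \<in> D" | "j \<notin> D" "j \<in> B" | "j \<notin> D" "j \<notin> B" by blast
    then show ?thesis
    proof cases
      case 1
      have "laplace n N j (1 / h) \<le> Fv"
        using laplace_antimono[OF t01(2)] laplace_degenerate[OF n t(2)] unfolding Fv_def by (rule order_trans)
      then show ?thesis using 1 F0 by auto
    next
      case 2
      then have "laplace n N j t1 \<le> Fb"
        unfolding Fb_def using j by (intro laplace_resonant n t) (auto simp: D_def)
      then have "laplace n N j (1 / h) \<le> Fb"
        using laplace_antimono[OF t01(2), of n N j] by linarith
      then show ?thesis using 2 F0 by auto
    next
      case 3
      have "laplace n N j t0 \<le> 1 / (1 + t0 / 3) + generic_floor n R \<eta> t0"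
        using 3 j t by (intro laplace_generic n eta R) (auto simp: D_def B_def)
      also have "\<dots> \<le> F"
        unfolding F_def generic_floor_def by simp
      finally have "laplace n N j (1 / h) \<le> F"
        using laplace_antimono[OF t01(1), of n N j] by linarith
      then show ?thesis using 3 F0 by auto
    qed
  qed
  then have pt: "sign_avg n (\<lambda>x. if (cmod (grid_value n 1 N j x))\<^sup>2 < h then 1 else 0)
      \<le> 3 * (F + (if j \<in> B then Fb else 0) + (if j \<in> D then Fv else 0))" if "j < N" for j
    using probability_small_le_laplace[OF h(1), of n N j] that by (meson mult_left_mono order_trans zero_le_numeral)
  have "sign_avg n (small_fraction n N h) = sign_avg n (\<lambda>x. (\<Sum>j<N. if (cmod (grid_value n 1 N j x))\<^sup>2 < h then 1 else 0) / real N)"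
    unfolding small_fraction_def by (simp add: sum.If_cases Int_def)
  also have "\<dots> = (\<Sum>j<N. sign_avg n (\<lambda>x. if (cmod (grid_value n 1 N j x))\<^sup>2 < h then 1 else 0)) / real N"
    by (simp only: sign_avg_cdiv sign_avg_sum)
  also have "\<dots> \<le> (\<Sum>j<N. 3 * (F + (if j \<in> B then Fb else 0) + (if j \<in> D then Fv else 0))) / real N"
    using pt by (intro divide_right_mono sum_mono) auto
  also have "(\<Sum>j<N. 3 * (F + (if j \<in> B then Fb else 0) + (if j \<in> D then Fv else 0)))
      = 3 * (real N * F + real (card B) * Fb + real (card D) * Fv)"
  proof -
    have "{..<N} \<inter> B = B" "{..<N} \<inter> D = D"
      by (auto simp: B_def D_def)
    then show ?thesis
      by (simp add: sum.distrib sum.If_cases Int_def flip: sum_distrib_left)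
  qed
  also have "3 * (real N * F + real (card B) * Fb + real (card D) * Fv) / real N
      \<le> 3 * (real N * F + (real N * \<beta>) * Fb + (real N * (4 / real n)) * Fv) / real N"
    using F0 \<beta> card_degenerate[OF n N]
    by (intro divide_right_mono mult_left_mono add_mono mult_right_mono) (auto simp: B_def D_def)
  also have "\<dots> = 6 * generic_floor n R \<eta> t0 + 3 * \<beta> * Fb + 12 / real n * Fv"
    using N0 n by (simp add: F_def field_simps)
  finally show ?thesis
    by (simp add: Fb_def Fv_def)
qed

section \<open>Deviation of the number of roots\<close>

definition littlewood :: "nat \<Rightarrow> (nat \<Rightarrow> real) \<Rightarrow> complex poly" where
  "littlewood n x = (\<Sum>k<n. monom (of_real (x k)) k)"

lemma coeff_littlewood: "coeff (littlewood n x) i = (if i < n then of_real (x i) else 0)"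
proof -
  have "coeff (littlewood n x) i = (\<Sum>k<n. if k = i then of_real (x k) else 0)"
    unfolding littlewood_def coeff_sum by (intro sum.cong refl) auto
  also have "\<dots> = (if i < n then of_real (x i) else 0)"
    by simp
  finally show ?thesis .
qed

lemma degree_littlewood:
  assumes "x \<in> sign_cube n" "n > 0"
  shows "degree (littlewood n x) = n - 1" "cmod (lead_coeff (littlewood n x)) = 1"
proof -
  have x: "\<bar>x (n - 1)\<bar> = 1"
    using assms by (intro sign_cube_abs[of x n]) auto
  show deg: "degree (littlewood n x) = n - 1"
  proof (rule antisym)
    show "degree (littlewood n x) \<le> n - 1"
      by (rule degree_le) (auto simp: coeff_littlewood)
    show "n - 1 \<le> degree (littlewood n x)"
      using x assms by (intro le_degree) (auto simp: coeff_littlewood)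
  qed
  show "cmod (lead_coeff (littlewood n x)) = 1"
    unfolding deg using x assms by (simp add: coeff_littlewood)
qed

lemma poly_littlewood_grid:
  assumes "n > 0" "r > 0"
  shows "(cmod (poly (littlewood n x) (of_real r * grid N j)))\<^sup>2
    = (\<Sum>i<n. r ^ (2 * i)) * (cmod (grid_value n r N j x))\<^sup>2"
proof -
  define S where "S = (\<Sum>i<n. r ^ (2 * i))"
  have S: "S > 0"
    unfolding S_def by (rule sum_even_powers_pos[OF assms])
  have "poly (littlewood n x) (of_real r * grid N j) = (\<Sum>k<n. of_real (x k) * (of_real r * grid N j) ^ k)"
    by (simp add: littlewood_def poly_sum poly_monom)
  also have "\<dots> = of_real (sqrt S) * grid_value n r N j x"
    unfolding grid_value_def random_sum_def sum_distrib_left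
    using S by (intro sum.cong refl) (simp add: weight_def S_def[symmetric] scaleR_conv_of_real power_mult_distrib)
  finally show ?thesis
    using S by (simp add: norm_mult power_mult_distrib S_def[symmetric])
qed

text \<open>
The inequality \<open>root_count_via_grid\<close> for the normalised values of the polynomial. The two normalisations leave
the logarithm of their ratio, which \<open>ln_variance_ratio\<close> evaluates.
\<close>
lemma root_count_grid_bound:
  assumes n: "n > 0" and x: "x \<in> sign_cube n" and \<delta>: "\<delta> \<le> 1 / 2" and s: "\<bar>s\<bar> = \<delta> / real n"
    and e: "e > 0" and d: "0 < d" "0 < h" "real n * (h + d) \<le> 1" and g: "0 < g" "g \<le> 1"
  shows "eventually (\<lambda>N. s * real (root_count (littlewood n x) unit_disk)
    \<le> s * real n / 2 + \<bar>s\<bar> / 2 + 2 * s\<^sup>2 * (real n)\<^sup>2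
      + (log_mean n (exp s) N e x - log_mean n 1 N e x)
      + (regularisation_cost n N e d x + real n * ln (1 / g) * small_fraction n N h x)
      + d / (2 * h) + 2 * real n * g) sequentially"
proof -
  define S where "S = (\<Sum>i<n. exp s ^ (2 * i))"
  define \<nu> where "\<nu> = real (root_count (littlewood n x) unit_disk)"
  define m where "m = n - 1"
  have S: "S > 0"
    unfolding S_def by (intro sum_even_powers_pos n) simp
  have mn: "real m \<le> real n"
    by (simp add: m_def)
  have nd: "0 < real n * d" "0 < real n * h" "real n * h + real n * d \<le> 1" "S * e > 0"
    using n d e S by (auto simp: distrib_left)
  \<comment> \<open>the error \<open>2 m ln 2\<close> of the grid means, which does not grow with \<open>N\<close>, is absorbed by a second term \<open>n g\<close>\<close>
  have "eventually (\<lambda>N. real N \<ge> 2 * ln 2 / g) sequentially"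
    using filterlim_real_sequentially by (auto simp: filterlim_at_top)
  with root_count_via_grid[OF degree_littlewood(2)[OF x n] degree_littlewood(1)[OF x n] nd(4) nd(1,2,3) g, of s]
    eventually_gt_at_top[of 0]
  show ?thesis
  proof eventually_elim
    case (elim N)
    define U where "U r j = (cmod (grid_value n r N j x))\<^sup>2" for r j
    have U: "U r j \<ge> 0" for r j
      by (simp add: U_def)
    have P: "(cmod (poly (littlewood n x) (of_real (exp s) * grid N j)))\<^sup>2 = S * U (exp s) j" for j
      using poly_littlewood_grid[OF n, of "exp s"] by (simp add: S_def U_def)
    have P1: "(cmod (poly (littlewood n x) (grid N j)))\<^sup>2 = real n * U 1 j" for j
      using poly_littlewood_grid[OF n zero_less_one, of x N j] by (simp add: U_def)
    have a: "(\<Sum>j<N. ln (S * U (exp s) j + S * e) / 2) = real N * (ln S / 2) + real N * log_mean n (exp s) N e x"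
    proof -
      have "ln (S * U (exp s) j + S * e) / 2 = ln S / 2 + ln (U (exp s) j + e) / 2" for j
        using S U[of "exp s" j] e by (simp add: ln_mult_pos add_nonneg_pos add_divide_distrib flip: distrib_left)
      then show ?thesis
        using elim(2) by (simp only: sum.distrib) (simp add: log_mean_def U_def)
    qed
    have b: "(\<Sum>j<N. ln (real n * U 1 j + real n * d) / 2)
      = real N * (ln (real n) / 2) + real N * log_mean n 1 N e x - real N * regularisation_cost n N e d x"
    proof -
      have "ln (real n * U 1 j + real n * d) / 2 = ln (real n) / 2 + ln (U 1 j + e) / 2 - ln ((U 1 j + e) / (U 1 j + d)) / 2" for j
      proof -
        have "ln (real n * (U 1 j + d)) = ln (real n) + ln (U 1 j + d)"
          using n U[of 1 j] d by (intro ln_mult_pos) (auto simp: add_nonneg_pos)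
        moreover have "ln ((U 1 j + e) / (U 1 j + d)) = ln (U 1 j + e) - ln (U 1 j + d)"
          using add_nonneg_pos[OF U e, of 1 j] add_nonneg_pos[OF U d(1), of 1 j] by (simp add: ln_div)
        ultimately show ?thesis
          by (simp add: distrib_left add_divide_distrib diff_divide_distrib)
      qed
      then show ?thesis
        using elim(2) by (simp only: sum.distrib sum_subtractf) (simp add: log_mean_def regularisation_cost_def U_def)
    qed
    have c: "real (card {j. j < N \<and> real n * U 1 j < real n * h}) = real N * small_fraction n N h x"
      using n elim(2) by (simp add: small_fraction_def U_def)
    have lnS: "ln S - ln (real n) = ln (S / real n)"
      using S n by (simp add: ln_div)
    have lg: "ln (1 / g) \<ge> 0"
      using g by simp
    have "real N * s * \<nu> \<le> real N * (ln S / 2) + real N * log_mean n (exp s) N e x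
      - (real N * (ln (real n) / 2) + real N * log_mean n 1 N e x - real N * regularisation_cost n N e d x)
      + real N * (d / (2 * h)) + real m * ln (1 / g) * (real N * small_fraction n N h x)
      + real N * real m * g + 2 * real m * ln 2"
      using elim(1) n unfolding P P1 a b c \<nu>_def m_def by simp
    also have "real m * ln (1 / g) * (real N * small_fraction n N h x) \<le> real n * ln (1 / g) * (real N * small_fraction n N h x)"
      using mn lg small_fraction_nonneg by (intro mult_right_mono mult_nonneg_nonneg) auto
    also have "real N * real m * g \<le> real N * real n * g"
      using mn g by (intro mult_right_mono mult_left_mono) auto
    also have "2 * real m * ln 2 \<le> real N * real n * g"
    proof -
      have "2 * ln 2 \<le> real N * g"
        using elim(3) g by (simp add: field_simps)
      with mn have "real m * (2 * ln 2) \<le> real n * (real N * g)"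
        by (rule mult_mono) auto
      then show ?thesis by (simp add: mult_ac)
    qed
    finally have "real N * s * \<nu> \<le> real N * (ln S / 2) + real N * log_mean n (exp s) N e x
      - (real N * (ln (real n) / 2) + real N * log_mean n 1 N e x - real N * regularisation_cost n N e d x)
      + real N * (d / (2 * h)) + real n * ln (1 / g) * (real N * small_fraction n N h x)
      + real N * real n * g + real N * real n * g"
      by simp
    also have "\<dots> = real N * ((ln S - ln (real n)) / 2 + (log_mean n (exp s) N e x - log_mean n 1 N e x)
      + (regularisation_cost n N e d x + real n * ln (1 / g) * small_fraction n N h x) + d / (2 * h) + 2 * real n * g)"
      by (simp add: field_simps)
    finally have "s * \<nu> \<le> (ln S - ln (real n)) / 2 + (log_mean n (exp s) N e x - log_mean n 1 N e x)
      + (regularisation_cost n N e d x + real n * ln (1 / g) * small_fraction n N h x) + d / (2 * h) + 2 * real n * g"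
      using elim(2) by (simp add: mult.assoc)
    moreover have "(ln S - ln (real n)) / 2 \<le> s * real n / 2 + \<bar>s\<bar> / 2 + 2 * s\<^sup>2 * (real n)\<^sup>2"
      using ln_variance_ratio[OF n \<delta> s] lnS unfolding S_def by simp
    ultimately show ?case
      unfolding \<nu>_def by linarith
  qed
qed

definition deviation_probability :: "nat \<Rightarrow> real \<Rightarrow> real" where
  "deviation_probability n a = real (card {x \<in> sign_cube n. \<bar>real (root_count (littlewood n x) unit_disk) - real n / 2\<bar> \<ge> a}) / 2 ^ n"

lemma deviation_probability_antimono:
  assumes "a \<le> b"
  shows "deviation_probability n b \<le> deviation_probability n a"
  unfolding deviation_probability_def using assms
  by (intro divide_right_mono of_nat_mono card_mono) auto

text \<open>
The bound \<open>root_count_grid_bound\<close> is applied with \<open>s = \<delta> / n\<close> and \<open>s = - \<delta> / n\<close>. Outside three exceptional sets of sign vectors the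
two differences of logarithmic means and the total cost of small values are below \<open>y\<close>; Chebyshev's inequality bounds the
first two sets and Markov's inequality the third.
\<close>
lemma deviation_probability_bound:
  fixes n :: nat
  assumes n: "n > 0" and \<delta>: "0 < \<delta>" "\<delta> \<le> 1 / 2"
    and d: "0 < d" "d \<le> e" "e \<le> 1" and h: "0 < h" "real n * (h + d) \<le> 1" "h * t0 \<le> 1" "h * t1 \<le> 1"
    and g: "0 < g" "g \<le> 1" and eta: "0 < \<eta>" "\<eta> \<le> 1 / 2" and R: "1 \<le> R" and t: "t0 > 0" "t1 > 0" and y: "y > 0"
  defines "\<beta> \<equiv> 5 * sqrt \<eta> + 8 * R * sqrt R * \<eta>"
  defines "V \<equiv> 3 * (5200 / (real n * e\<^sup>2) + (10240 / (real n * e\<^sup>2) + 32 / (sqrt (real n) * e))\<^sup>2)"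
  defines "Q1 \<equiv> generic_floor n R \<eta> t0 * ln (e / d) + (3 * ln (1 + 1 / (3 * d)) + 3) * e + (\<beta> + 4 / real n) * ln (e / d)"
  defines "Q2 \<equiv> 6 * generic_floor n R \<eta> t0 + 3 * \<beta> * resonant_floor n t1 + 12 / real n * degenerate_floor n t1"
  assumes a: "a > 1 / 2 + 2 * \<delta> * real n + real n / \<delta> * (2 * y + d / (2 * h) + 2 * real n * g)"
  shows "deviation_probability n a \<le> 2 * (V / y\<^sup>2) + (Q1 + real n * ln (1 / g) * Q2) / y"
proof -
  define s where "s = \<delta> / real n"
  have s: "s > 0" "\<bar>s\<bar> = \<delta> / real n" "\<bar>- s\<bar> = \<delta> / real n"
    using n \<delta> by (auto simp: s_def)
  have e: "0 < e" using d by simp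
  define C where "C N x = regularisation_cost n N e d x + real n * ln (1 / g) * small_fraction n N h x" for N x
  define Det where "Det s' N x \<longleftrightarrow> s' * real (root_count (littlewood n x) unit_disk)
    \<le> s' * real n / 2 + \<bar>s'\<bar> / 2 + 2 * s'\<^sup>2 * (real n)\<^sup>2 + (log_mean n (exp s') N e x - log_mean n 1 N e x)
      + C N x + d / (2 * h) + 2 * real n * g" for s' N x
  have "eventually (\<lambda>N. \<forall>x\<in>sign_cube n. Det s' N x) sequentially" if "\<bar>s'\<bar> = \<delta> / real n" for s'
    unfolding Det_def C_def
    using root_count_grid_bound[OF n _ \<delta>(2) that e d(1) h(1,2) g]
    by (intro eventually_ball_finite) auto
  from this[OF s(2)] this[OF s(3)]
  have "eventually (\<lambda>N. \<forall>x\<in>sign_cube n. Det s N x \<and> Det (- s) N x) sequentially"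
    by eventually_elim auto
  \<comment> \<open>the rounding errors in the count of resonant points turn the coefficient \<open>4\<close> of \<open>sqrt \<eta>\<close> into \<open>5\<close>\<close>
  moreover have "eventually (\<lambda>N. real N \<ge> (4 + 8 * R\<^sup>2) / sqrt \<eta>) sequentially"
    using filterlim_real_sequentially by (auto simp: filterlim_at_top)
  moreover have "eventually (\<lambda>N. N \<ge> 2 * n) sequentially"
    by (rule eventually_ge_at_top)
  ultimately have "eventually (\<lambda>N. (\<forall>x\<in>sign_cube n. Det s N x \<and> Det (- s) N x) \<and>
     real N \<ge> (4 + 8 * R\<^sup>2) / sqrt \<eta> \<and> N \<ge> 2 * n) sequentially"
    by eventually_elim auto
  then obtain N where Det: "\<And>x. x \<in> sign_cube n \<Longrightarrow> Det s N x" "\<And>x. x \<in> sign_cube n \<Longrightarrow> Det (- s) N x"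
    and N: "real N \<ge> (4 + 8 * R\<^sup>2) / sqrt \<eta>" "2 * n \<le> N"
    by (auto dest!: eventually_happens)
  have N0: "N > 0" using n N by simp
  have \<beta>: "real (card {j. j < N \<and> \<not> diophantine R \<eta> (2 * pi * real j / real N)}) \<le> real N * \<beta>"
  proof -
    have "4 + 8 * R\<^sup>2 \<le> real N * sqrt \<eta>"
      using N(1) eta by (simp add: field_simps)
    then show ?thesis
      using card_grid_not_diophantine[OF N0 R eta] by (simp add: \<beta>_def algebra_simps)
  qed
  define D where "D s' x = (log_mean n (exp s') N e x - log_mean n 1 N e x)\<^sup>2" for s' x
  have lg: "ln (1 / g) \<ge> 0" using g by simp
  have C0: "C N x \<ge> 0" for x
    unfolding C_def using d lg by (intro add_nonneg_nonneg mult_nonneg_nonneg regularisation_cost_nonneg small_fraction_nonneg) auto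
  have "sign_avg n (C N) = sign_avg n (regularisation_cost n N e d) + real n * ln (1 / g) * sign_avg n (small_fraction n N h)"
    unfolding C_def by (simp add: sign_avg_add sign_avg_cmult)
  also have "\<dots> \<le> Q1 + real n * ln (1 / g) * Q2"
    unfolding Q1_def Q2_def using lg d h eta R t \<beta> N n
    by (intro add_mono mult_left_mono regularisation_cost_expectation small_fraction_expectation) auto
  finally have EC: "sign_avg n (C N) \<le> Q1 + real n * ln (1 / g) * Q2" .
  have ED: "sign_avg n (D s') \<le> V" if "\<bar>s'\<bar> = \<delta> / real n" for s'
    unfolding D_def V_def using weight_exp_le[OF n \<delta>(2) that] n N e d by (intro log_mean_difference) auto
  define B1 where "B1 = {x \<in> sign_cube n. D s x \<ge> y\<^sup>2}"
  define B2 where "B2 = {x \<in> sign_cube n. D (- s) x \<ge> y\<^sup>2}"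
  define B3 where "B3 = {x \<in> sign_cube n. C N x \<ge> y}"
  have y2: "y\<^sup>2 > 0" using y by simp
  have c1: "real (card B1) / 2 ^ n \<le> V / y\<^sup>2" "real (card B2) / 2 ^ n \<le> V / y\<^sup>2"
    unfolding B1_def B2_def
    by (rule order_trans[OF sign_avg_markov[OF _ y2] divide_right_mono[OF ED]]; simp add: D_def s)+
  have c3: "real (card B3) / 2 ^ n \<le> (Q1 + real n * ln (1 / g) * Q2) / y"
    unfolding B3_def using y C0 by (intro order_trans[OF sign_avg_markov divide_right_mono[OF EC]]) auto
  have "{x \<in> sign_cube n. \<bar>real (root_count (littlewood n x) unit_disk) - real n / 2\<bar> \<ge> a} \<subseteq> B1 \<union> B2 \<union> B3"
  proof
    fix x assume "x \<in> {x \<in> sign_cube n. \<bar>real (root_count (littlewood n x) unit_disk) - real n / 2\<bar> \<ge> a}"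
    then have x: "x \<in> sign_cube n" and dev: "\<bar>real (root_count (littlewood n x) unit_disk) - real n / 2\<bar> \<ge> a"
      by auto
    define \<nu> where "\<nu> = real (root_count (littlewood n x) unit_disk)"
    show "x \<in> B1 \<union> B2 \<union> B3"
    proof (rule ccontr)
      assume "x \<notin> B1 \<union> B2 \<union> B3"
      then have "D s x < y\<^sup>2" "D (- s) x < y\<^sup>2" and C: "C N x < y"
        using x by (auto simp: B1_def B2_def B3_def)
      then have "\<bar>log_mean n (exp s) N e x - log_mean n 1 N e x\<bar> < y" "\<bar>log_mean n (exp (- s)) N e x - log_mean n 1 N e x\<bar> < y"
        unfolding D_def using y by (auto intro: power2_less_imp_less[of "\<bar>_\<bar>"])
      then have "s * \<nu> - s * real n / 2 \<le> s / 2 + 2 * s\<^sup>2 * (real n)\<^sup>2 + 2 * y + d / (2 * h) + 2 * real n * g"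
        "- s * \<nu> + s * real n / 2 \<le> s / 2 + 2 * s\<^sup>2 * (real n)\<^sup>2 + 2 * y + d / (2 * h) + 2 * real n * g"
        using Det(1)[OF x] Det(2)[OF x] C s(1) unfolding Det_def \<nu>_def by (auto simp: abs_less_iff)
      then have "\<bar>s * (\<nu> - real n / 2)\<bar> \<le> s / 2 + 2 * s\<^sup>2 * (real n)\<^sup>2 + 2 * y + d / (2 * h) + 2 * real n * g"
        by (simp add: abs_le_iff algebra_simps)
      then have "s * \<bar>\<nu> - real n / 2\<bar> \<le> s / 2 + 2 * s\<^sup>2 * (real n)\<^sup>2 + 2 * y + d / (2 * h) + 2 * real n * g"
        using s(1) by (simp add: abs_mult)
      also have "\<dots> = s * (1 / 2 + 2 * \<delta> * real n + real n / \<delta> * (2 * y + d / (2 * h) + 2 * real n * g))"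
      proof -
        have "s * (real n / \<delta>) = 1"
          using n \<delta> by (simp add: s_def)
        moreover have "s * (1 / 2 + P + q * X) = s / 2 + s * P + (s * q) * X" for P q X
          by (simp add: algebra_simps)
        moreover have "s * (2 * \<delta> * real n) = 2 * s\<^sup>2 * (real n)\<^sup>2"
          using n by (simp add: s_def power2_eq_square)
        ultimately show ?thesis
          by (simp only: mult_1)
      qed
      finally have "\<bar>\<nu> - real n / 2\<bar> \<le> 1 / 2 + 2 * \<delta> * real n + real n / \<delta> * (2 * y + d / (2 * h) + 2 * real n * g)"
        using s(1) by (simp only: mult_le_cancel_left_pos)
      then show False
        using a dev by (simp add: \<nu>_def)
    qed
  qed
  then have "card {x \<in> sign_cube n. \<bar>real (root_count (littlewood n x) unit_disk) - real n / 2\<bar> \<ge> a} \<le> card (B1 \<union> B2 \<union> B3)"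
    by (intro card_mono) (auto simp: B1_def B2_def B3_def)
  also have "\<dots> \<le> card B1 + card B2 + card B3"
    by (meson add_mono card_Un_le order_refl order_trans)
  finally have "deviation_probability n a \<le> real (card B1 + card B2 + card B3) / 2 ^ n"
    unfolding deviation_probability_def by (intro divide_right_mono of_nat_mono) auto
  then show ?thesis
    using c1 c3 by (simp add: add_divide_distrib)
qed

text \<open>
All parameters are powers of \<open>n\<close>. The deviation is dominated by \<open>\<delta> n\<close> and \<open>n y / \<delta>\<close>. With exponents \<open>- 0.11\<close> for \<open>\<delta>\<close>
and \<open>- 0.22\<close> for \<open>y\<close> both equal \<open>n powr 0.89\<close>, and all costs must be of smaller order than \<open>y\<close>. The variance, which is of order \<open>1 / (n e\<^sup>2)\<close>, and the regularisation, which costs \<open>e\<close> up to a logarithm, lead to the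
exponent \<open>- 1 / 4\<close> for \<open>e\<close>. The resonant points, of proportion about \<open>sqrt \<eta>\<close>, force \<open>\<eta>\<close> below \<open>n powr (- 0.44)\<close>, while
\<open>n \<eta>\<^sup>2\<close> has to grow. Finally \<open>n / t0\<close> has to be smaller than \<open>y\<close>, so \<open>t0\<close> has to exceed \<open>n powr 1.22\<close>, and \<open>n R\<^sup>2\<close> has to
exceed \<open>t0\<close>.
\<close>
lemma deviation_probability_tendsto_zero:
  "(\<lambda>n. deviation_probability n (real n powr (9 / 10))) \<longlonglongrightarrow> 0"
proof (rule tendsto_sandwich[OF _ _ tendsto_const])
  define \<delta> where "\<delta> n = real n powr (- 11 / 100)" for n :: nat
  define e where "e n = real n powr (- 1 / 4)" for n :: nat
  define d where "d n = real n powr (- 4)" for n :: nat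
  define h where "h n = real n powr (- 2)" for n :: nat
  define t0 where "t0 n = real n powr (123 / 100)" for n :: nat
  define t1 where "t1 n = real n powr (99 / 100)" for n :: nat
  define g where "g n = real n powr (- 3)" for n :: nat
  define \<eta> where "\<eta> n = real n powr (- 48 / 100)" for n :: nat
  define R where "R n = real n powr (12 / 100)" for n :: nat
  define y where "y n = real n powr (- 22 / 100)" for n :: nat
  define \<beta> where "\<beta> n = 5 * sqrt (\<eta> n) + 8 * R n * sqrt (R n) * \<eta> n" for n
  define V where "V n = 3 * (5200 / (real n * (e n)\<^sup>2) + (10240 / (real n * (e n)\<^sup>2) + 32 / (sqrt (real n) * e n))\<^sup>2)" for n
  define F where "F n = generic_floor n (R n) (\<eta> n) (t0 n)" for n
  define Q1 where "Q1 n = F n * ln (e n / d n) + (3 * ln (1 + 1 / (3 * d n)) + 3) * e n + (\<beta> n + 4 / real n) * ln (e n / d n)" for n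
  define Q2 where "Q2 n = 6 * F n + 3 * \<beta> n * resonant_floor n (t1 n) + 12 / real n * degenerate_floor n (t1 n)" for n
  define bound where "bound n = 2 * (V n / (y n)\<^sup>2) + (Q1 n + real n * ln (1 / g n) * Q2 n) / y n" for n
  note defs = \<delta>_def e_def d_def h_def t0_def t1_def g_def \<eta>_def R_def y_def
  have V: "(\<lambda>n. V n / (y n)\<^sup>2) \<longlonglongrightarrow> 0"
    unfolding V_def defs by real_asymp
  have Q1: "(\<lambda>n. Q1 n / y n) \<longlonglongrightarrow> 0"
    unfolding Q1_def F_def generic_floor_def \<beta>_def defs by real_asymp
  have Q2: "(\<lambda>n. real n * ln (1 / g n) * Q2 n / y n) \<longlonglongrightarrow> 0"
  proof -
    define w where "w n = real n * ln (1 / g n) / y n" for n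
    have F1: "(\<lambda>n. w n * (1 / (1 + t0 n / 3))) \<longlonglongrightarrow> 0"
      unfolding w_def defs by real_asymp
    have F2: "(\<lambda>n. w n * exp (- (real n / 4 - 1) * (\<eta> n)\<^sup>2 / 12)) \<longlonglongrightarrow> 0"
      unfolding w_def defs by real_asymp
    have F3: "(\<lambda>n. w n * (2 * exp (- (R n)\<^sup>2 * real n / (8 * t0 n)))) \<longlonglongrightarrow> 0"
      unfolding w_def defs by real_asymp
    have B1: "(\<lambda>n. w n * \<beta> n * (1 / (1 + t1 n / 3))) \<longlonglongrightarrow> 0"
      unfolding w_def \<beta>_def defs by real_asymp
    have B2: "(\<lambda>n. w n * \<beta> n * (2 * exp (- real n / (8 * t1 n)))) \<longlonglongrightarrow> 0"
      unfolding w_def \<beta>_def defs by real_asymp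
    have D1: "(\<lambda>n. w n * (12 / real n) * (1 / sqrt (1 + 2 * t1 n / 3))) \<longlonglongrightarrow> 0"
      unfolding w_def defs by real_asymp
    have D2: "(\<lambda>n. w n * (12 / real n) * (2 * exp (- real n / (8 * t1 n)))) \<longlonglongrightarrow> 0"
      unfolding w_def defs by real_asymp
    have "real n * ln (1 / g n) * Q2 n / y n =
      6 * (w n * (1 / (1 + t0 n / 3)) + w n * exp (- (real n / 4 - 1) * (\<eta> n)\<^sup>2 / 12)
        + w n * (2 * exp (- (R n)\<^sup>2 * real n / (8 * t0 n))))
      + 3 * (w n * \<beta> n * (1 / (1 + t1 n / 3)) + w n * \<beta> n * (2 * exp (- real n / (8 * t1 n))))
      + (w n * (12 / real n) * (1 / sqrt (1 + 2 * t1 n / 3)) + w n * (12 / real n) * (2 * exp (- real n / (8 * t1 n))))" for n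
    proof -
      have "real n * ln (1 / g n) * Q2 n / y n = w n * Q2 n"
        by (simp add: w_def)
      also have "\<dots> = 6 * (w n * F n) + 3 * (w n * \<beta> n * resonant_floor n (t1 n)) + w n * (12 / real n) * degenerate_floor n (t1 n)"
        unfolding Q2_def by (simp only: distrib_left mult_ac)
      finally show ?thesis
        unfolding F_def generic_floor_def resonant_floor_def degenerate_floor_def by (simp only: distrib_left)
    qed
    then show ?thesis
      using tendsto_add[OF tendsto_add[OF tendsto_mult[OF tendsto_const[of 6] tendsto_add[OF tendsto_add[OF F1 F2] F3]]
        tendsto_mult[OF tendsto_const[of 3] tendsto_add[OF B1 B2]]] tendsto_add[OF D1 D2]] by simp
  qed
  have "bound n = 2 * (V n / (y n)\<^sup>2) + (Q1 n / y n + real n * ln (1 / g n) * Q2 n / y n)" for n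
    by (simp add: bound_def add_divide_distrib)
  then have bound_eq: "bound = (\<lambda>n. 2 * (V n / (y n)\<^sup>2) + (Q1 n / y n + real n * ln (1 / g n) * Q2 n / y n))"
    by (rule ext)
  show "bound \<longlonglongrightarrow> 0"
    unfolding bound_eq using tendsto_add[OF tendsto_mult[OF tendsto_const[of 2] V] tendsto_add[OF Q1 Q2]] by simp
  show "eventually (\<lambda>n. 0 \<le> deviation_probability n (real n powr (9 / 10))) sequentially"
    by (simp add: deviation_probability_def)
  have 1: "eventually (\<lambda>n. real n powr (9 / 10) >
      1 / 2 + 2 * \<delta> n * real n + real n / \<delta> n * (2 * y n + d n / (2 * h n) + 2 * real n * g n)) sequentially"
    unfolding defs by real_asymp
  have 2: "eventually (\<lambda>n. \<delta> n \<le> 1 / 2 \<and> d n \<le> e n \<and> e n \<le> 1 \<and> real n * (h n + d n) \<le> 1 \<and> h n * t0 n \<le> 1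
      \<and> h n * t1 n \<le> 1 \<and> g n \<le> 1 \<and> \<eta> n \<le> 1 / 2 \<and> 1 \<le> R n) sequentially"
    unfolding defs by (intro eventually_conj; real_asymp)
  show "eventually (\<lambda>n. deviation_probability n (real n powr (9 / 10)) \<le> bound n) sequentially"
    using 1 2 eventually_gt_at_top[of 0]
  proof eventually_elim
    case (elim n)
    have pos: "0 < \<delta> n" "0 < d n" "0 < h n" "0 < g n" "0 < \<eta> n" "0 < t0 n" "0 < t1 n" "0 < y n"
      using elim(3) by (simp_all add: defs)
    show ?case
      unfolding bound_def V_def Q1_def Q2_def F_def \<beta>_def
      using elim pos by (intro deviation_probability_bound) auto
  qed
qed

section \<open>From sign vectors to random variables\<close>

text \<open>
The cube carries all the mass: the events \<open>X = x\<close>, for sign vectors \<open>x\<close>, are disjoint with probability \<open>1 / 2 ^ n\<close> each. The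
inequality also covers sets that are not measurable, whose measure is zero by convention.
\<close>
lemma (in prob_space) sign_vector_probability:
  assumes n: "n > 0" and indep: "indep_vars (\<lambda>_. borel) X {..<n}"
    and half: "\<And>k. k < n \<Longrightarrow> prob {\<omega> \<in> space M. X k \<omega> = 1} = 1 / 2"
      "\<And>k. k < n \<Longrightarrow> prob {\<omega> \<in> space M. X k \<omega> = -1} = 1 / 2"
  shows "prob {\<omega> \<in> space M. Q (random_poly n X \<omega>)} \<le> real (card {x \<in> sign_cube n. Q (littlewood n x)}) / 2 ^ n"
proof (cases "{\<omega> \<in> space M. Q (random_poly n X \<omega>)} \<in> events")
  case True
  define A where "A x = (\<Inter>k\<in>{..<n}. X k -` {x k} \<inter> space M)" for x
  have meas: "random_variable borel (X k)" if "k < n" for k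
    using indep that unfolding indep_vars_def by auto
  have A_events: "A x \<in> events" for x
    unfolding A_def using n meas by (intro sets.finite_INT) (auto intro!: measurable_sets)
  have pA: "prob (A x) = 1 / 2 ^ n" if x: "x \<in> sign_cube n" for x
  proof -
    have "prob (A x) = (\<Prod>k\<in>{..<n}. prob (X k -` {x k} \<inter> space M))"
      unfolding A_def using n by (intro indep_varsD[OF indep]) auto
    also have "\<dots> = (\<Prod>k\<in>{..<n}. 1 / 2)"
    proof (intro prod.cong refl)
      fix k assume "k \<in> {..<n}"
      then have k: "k < n" by simp
      then have "x k = 1 \<or> x k = -1"
        using sign_cube_abs[OF x k] by auto
      moreover have "X k -` {c} \<inter> space M = {\<omega> \<in> space M. X k \<omega> = c}" for c
        by auto
      ultimately show "prob (X k -` {x k} \<inter> space M) = 1 / 2"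
        using half[OF k] by auto
    qed
    finally show ?thesis
      by (simp add: power_divide)
  qed
  have disj: "disjoint_family_on A (sign_cube n)"
  proof (unfold disjoint_family_on_def, intro ballI impI)
    fix x y assume xy: "x \<in> sign_cube n" "y \<in> sign_cube n" "x \<noteq> y"
    then obtain k where "k < n" "x k \<noteq> y k"
      unfolding sign_cube_def by (metis PiE_ext lessThan_iff)
    then show "A x \<inter> A y = {}"
      by (auto simp: A_def)
  qed
  have sum: "prob (\<Union>x\<in>S. A x) = real (card S) / 2 ^ n" if S: "S \<subseteq> sign_cube n" for S
  proof -
    have "prob (\<Union>x\<in>S. A x) = (\<Sum>x\<in>S. prob (A x))"
      using A_events finite_subset[OF S] disjoint_family_on_mono[OF S disj]
      by (intro finite_measure_finite_Union) auto
    also have "\<dots> = (\<Sum>x\<in>S. 1 / 2 ^ n)"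
      using S pA by (intro sum.cong) auto
    finally show ?thesis by simp
  qed
  define B where "B = {x \<in> sign_cube n. Q (littlewood n x)}"
  have full: "prob (\<Union>x\<in>sign_cube n. A x) = 1"
    using sum[OF order_refl] by (simp add: card_sign_cube)
  have UA: "(\<Union>x\<in>S. A x) \<in> events" if "S \<subseteq> sign_cube n" for S
    using that A_events finite_subset[OF that] by (intro sets.finite_UN) auto
  have "{\<omega> \<in> space M. Q (random_poly n X \<omega>)} \<subseteq> (\<Union>x\<in>B. A x) \<union> (space M - (\<Union>x\<in>sign_cube n. A x))"
  proof
    fix \<omega> assume w: "\<omega> \<in> {\<omega> \<in> space M. Q (random_poly n X \<omega>)}"
    show "\<omega> \<in> (\<Union>x\<in>B. A x) \<union> (space M - (\<Union>x\<in>sign_cube n. A x))"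
    proof (cases "\<omega> \<in> (\<Union>x\<in>sign_cube n. A x)")
      case True
      then obtain x where x: "x \<in> sign_cube n" "\<omega> \<in> A x" by auto
      then have "X k \<omega> = x k" if "k < n" for k
        using that unfolding A_def by blast
      then have "random_poly n X \<omega> = littlewood n x"
        unfolding random_poly_def littlewood_def by (intro sum.cong) auto
      then show ?thesis
        using x w by (auto simp: B_def)
    qed (use w in auto)
  qed
  then have "prob {\<omega> \<in> space M. Q (random_poly n X \<omega>)} \<le> prob ((\<Union>x\<in>B. A x) \<union> (space M - (\<Union>x\<in>sign_cube n. A x)))"
    using UA[of B] UA[OF order_refl] by (intro finite_measure_mono) (auto simp: B_def)
  also have "\<dots> \<le> prob (\<Union>x\<in>B. A x) + prob (space M - (\<Union>x\<in>sign_cube n. A x))"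
    using UA[of B] UA[OF order_refl] by (intro measure_Un_le) (auto simp: B_def)
  also have "prob (space M - (\<Union>x\<in>sign_cube n. A x)) = 0"
    using full UA[OF order_refl] by (simp add: prob_compl)
  also have "prob (\<Union>x\<in>B. A x) = real (card B) / 2 ^ n"
    by (rule sum) (auto simp: B_def)
  finally show ?thesis
    by (simp add: B_def)
next
  case False
  then show ?thesis
    by (simp add: measure_notin_sets)
qed

theorem theorem1:
  fixes M :: "nat \<Rightarrow> 'a measure" and X :: "nat \<Rightarrow> nat \<Rightarrow> 'a \<Rightarrow> real"
  assumes prob: "\<And>n. n \<ge> 2 \<Longrightarrow> prob_space (M n)"
    and indep: "\<And>n. n \<ge> 2 \<Longrightarrow> prob_space.indep_vars (M n) (\<lambda>_. borel) (X n) {..<n}"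
    and plus: "\<And>n k. n \<ge> 2 \<Longrightarrow> k < n \<Longrightarrow> \<P>(\<omega> in M n. X n k \<omega> = 1) = 1 / 2"
    and minus: "\<And>n k. n \<ge> 2 \<Longrightarrow> k < n \<Longrightarrow> \<P>(\<omega> in M n. X n k \<omega> = -1) = 1 / 2"
  shows "(\<lambda>n. \<P>(\<omega> in M n.
            \<bar>real (root_count (random_poly n (X n) \<omega>) unit_disk) - real n / 2\<bar> \<ge> real n powr (9 / 10)))
           \<longlonglongrightarrow> 0
       \<and> converges_in_probability M
           (\<lambda>n \<omega>. real (root_count (random_poly n (X n) \<omega>) unit_disk) / real n) (1 / 2)"
proof -
  have transfer: "\<P>(\<omega> in M n. \<bar>real (root_count (random_poly n (X n) \<omega>) unit_disk) - real n / 2\<bar> \<ge> a)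
      \<le> deviation_probability n a" if "n \<ge> 2" for n a
  proof -
    interpret prob_space "M n"
      by (rule prob[OF that])
    show ?thesis
      unfolding deviation_probability_def
      using that plus[OF that] minus[OF that] by (intro sign_vector_probability indep) auto
  qed
  have "(\<lambda>n. \<P>(\<omega> in M n.
      \<bar>real (root_count (random_poly n (X n) \<omega>) unit_disk) - real n / 2\<bar> \<ge> real n powr (9 / 10))) \<longlonglongrightarrow> 0"
  proof (rule tendsto_sandwich[OF _ _ tendsto_const deviation_probability_tendsto_zero])
    show "eventually (\<lambda>n. \<P>(\<omega> in M n. \<bar>real (root_count (random_poly n (X n) \<omega>) unit_disk) - real n / 2\<bar>
        \<ge> real n powr (9 / 10)) \<le> deviation_probability n (real n powr (9 / 10))) sequentially"
      using eventually_ge_at_top[of 2] by eventually_elim (rule transfer)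
  qed simp
  moreover have "(\<lambda>n. \<P>(\<omega> in M n.
      \<bar>real (root_count (random_poly n (X n) \<omega>) unit_disk) / real n - 1 / 2\<bar> \<ge> \<epsilon>)) \<longlonglongrightarrow> 0" if "\<epsilon> > 0" for \<epsilon> :: real
  proof (rule tendsto_sandwich[OF _ _ tendsto_const deviation_probability_tendsto_zero])
    have "eventually (\<lambda>n. real n powr (9 / 10) \<le> \<epsilon> * real n) sequentially"
      using that by real_asymp
    then show "eventually (\<lambda>n. \<P>(\<omega> in M n. \<bar>real (root_count (random_poly n (X n) \<omega>) unit_disk) / real n - 1 / 2\<bar> \<ge> \<epsilon>)
        \<le> deviation_probability n (real n powr (9 / 10))) sequentially"
      using eventually_ge_at_top[of 2]
    proof eventually_elim
      case (elim n)
      have scale: "\<bar>v / real n - 1 / 2\<bar> \<ge> \<epsilon> \<longleftrightarrow> \<bar>v - real n / 2\<bar> \<ge> \<epsilon> * real n" for v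
      proof -
        have "v - real n / 2 = real n * (v / real n - 1 / 2)"
          using elim by (simp add: field_simps)
        then have "\<bar>v - real n / 2\<bar> = real n * \<bar>v / real n - 1 / 2\<bar>"
          by (simp only: abs_mult abs_of_nat)
        then show ?thesis
          using elim by (simp add: mult.commute)
      qed
      have "\<P>(\<omega> in M n. \<bar>real (root_count (random_poly n (X n) \<omega>) unit_disk) / real n - 1 / 2\<bar> \<ge> \<epsilon>)
          \<le> deviation_probability n (\<epsilon> * real n)"
        unfolding scale by (rule transfer[OF elim(2)])
      also have "\<dots> \<le> deviation_probability n (real n powr (9 / 10))"
        by (rule deviation_probability_antimono[OF elim(1)])
      finally show ?case .
    qed
  qed simp
  ultimately show ?thesis
    unfolding converges_in_probability_def by blast
qed

end
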